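(* Let $K$ be any field. Let $E$ be any finite graph, and let $\varepsilon$ be any nonzero idempotent in $L_K(E)$. Then the corner $\varepsilon L_K(E)\varepsilon$ of $L_K(E)$ is isomorphic to a Leavitt path algebra; that is, there is a finite graph $G$ with $\varepsilon L_K(E)\varepsilon\cong L_K(G)$ as $K$-algebras.
   Context: A (directed) graph $E=(E^0,E^1,s,r)$ consists of disjoint sets $E^0$ (vertices) and $E^1$ (edges) and maps $s,r:E^1\to E^0$. It is finite if $E^0$ and $E^1$ are finite; the vertex set is nonempty. A vertex $v$ is a sink if $s^{-1}(v)=\emptyset$; in a finite graph, a vertex is regular if it is not a sink. The Leavitt path algebra $L_K(E)$ is the $K$-algebra generated by $E^0\cup E^1\cup\{e^*\mid e\in E^1\}$ subject to, for all $v,w\in E^0$ and $e,f\in E^1$: (1) $vw=\delta_{v,w}w$; (2) $s(e)e=e=er(e)$ and $r(e)e^*=e^*=e^*s(e)$; (3) $e^*f=\delta_{e,f}r(e)$; (4) $v=\sum_{e\in s^{-1}(v)}ee^*$ for every regular vertex $v$. For finite $E$ it is unital with identity $\sum_{v\in E^0}v$. For a nonzero idempotent $f$ of a ring $R$, the corner of $R$ by $f$ is the ring $fRf$ (with identity $f$). *)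

theory Defs
  imports
    "HOL-Library.Poly_Mapping"
    "HOL-Algebra.QuotRing"
    "HOL-Algebra.Module"
    "Graph_Theory.Digraph"
begin

section \<open>The free associative algebra\<close>

text \<open>
  The library type of finitely supported functions carries the convolution product as soon as its
  index type is an additively written monoid.  Words are therefore wrapped in a type of their own,
  with concatenation as addition and the empty word as zero.
\<close>

datatype 'g word = Word (letters: "'g list")

instantiation word :: (type) monoid_add
begin

definition zero_word :: "'a word" where
  "0 = Word []"

definition plus_word :: "'a word \<Rightarrow> 'a word \<Rightarrow> 'a word" where
  "u + w = Word (letters u @ letters w)"

instance
  by standard (auto simp: zero_word_def plus_word_def)

end

type_synonym ('g, 'k) free_poly = "'g word \<Rightarrow>\<^sub>0 'k"

definition gen :: "'g \<Rightarrow> ('g, 'k::field) free_poly" where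
  "gen x = Poly_Mapping.single (Word [x]) 1"

definition scale :: "'k::field \<Rightarrow> ('g, 'k) free_poly \<Rightarrow> ('g, 'k) free_poly" where
  "scale c p = Poly_Mapping.map ((*) c) p"

text \<open>The free unital algebra on the letters in \<open>X\<close>.\<close>

definition free_algebra :: "'g set \<Rightarrow> ('g, 'k::field) free_poly ring" where
  "free_algebra X =
    \<lparr>carrier = {p. \<forall>w \<in> Poly_Mapping.keys p. set (letters w) \<subseteq> X},
     mult = (*), one = 1, zero = 0, add = (+)\<rparr>"

text \<open>The free non-unital algebra on \<open>X\<close>: no constant term.\<close>

definition free_nonunital :: "'g set \<Rightarrow> ('g, 'k::field) free_poly set" where
  "free_nonunital X = {p \<in> carrier (free_algebra X). Poly_Mapping.lookup p 0 = 0}"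


section \<open>Leavitt path algebras\<close>

text \<open>
  Graphs are the directed multigraphs (loops and parallel edges allowed) of the graph library, with
  \<open>s = tail E\<close>, \<open>r = head E\<close> and \<open>s\<inverse>(v) = out_arcs E v\<close>.
\<close>

datatype ('v, 'e) lpa_gen = Vertex 'v | Edge 'e | Ghost 'e

definition lpa_gens :: "('v, 'e) pre_digraph \<Rightarrow> ('v, 'e) lpa_gen set" where
  "lpa_gens E = Vertex ` verts E \<union> Edge ` arcs E \<union> Ghost ` arcs E"

definition regular :: "('v, 'e) pre_digraph \<Rightarrow> 'v \<Rightarrow> bool" where
  "regular E v \<longleftrightarrow> v \<in> verts E \<and> out_arcs E v \<noteq> {}"

text \<open>A relation \<open>p = q\<close> is recorded as the element \<open>p - q\<close>.\<close>

definition lpa_relations ::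
    "('v, 'e) pre_digraph \<Rightarrow> (('v, 'e) lpa_gen, 'k::field) free_poly set" where
  "lpa_relations E =
     {gen (Vertex v) * gen (Vertex w) - (if v = w then gen (Vertex w) else 0) | v w.
        v \<in> verts E \<and> w \<in> verts E}
   \<union> {gen (Vertex (tail E e)) * gen (Edge e) - gen (Edge e) | e. e \<in> arcs E}
   \<union> {gen (Edge e) * gen (Vertex (head E e)) - gen (Edge e) | e. e \<in> arcs E}
   \<union> {gen (Vertex (head E e)) * gen (Ghost e) - gen (Ghost e) | e. e \<in> arcs E}
   \<union> {gen (Ghost e) * gen (Vertex (tail E e)) - gen (Ghost e) | e. e \<in> arcs E}
   \<union> {gen (Ghost e) * gen (Edge f) - (if e = f then gen (Vertex (head E e)) else 0) | e f.
        e \<in> arcs E \<and> f \<in> arcs E}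
   \<union> {gen (Vertex v) - (\<Sum>e \<in> out_arcs E v. gen (Edge e) * gen (Ghost e)) | v. regular E v}"

text \<open>
  The relations lie in the free non-unital algebra, so the ideal they generate in the free unital
  algebra is contained in it and is also the non-unital algebra ideal they generate there: writing
  \<open>R\<close> for the free unital algebra, \<open>F\<close> for its non-unital part and \<open>S\<close> for the relations, we have
  \<open>R = K + F\<close>, so \<open>R S R = K S + F S + S F + F S F\<close>.
\<close>

definition lpa_ideal ::
    "('v, 'e) pre_digraph \<Rightarrow> (('v, 'e) lpa_gen, 'k::field) free_poly set" where
  "lpa_ideal E = Idl\<^bsub>free_algebra (lpa_gens E)\<^esub> (lpa_relations E)"

text \<open>
  The Leavitt path algebra is the free non-unital algebra modulo this ideal; its elements are
  cosets.  The field \<open>one\<close> is the class of the sum of all vertices, which is an identity element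
  when there are finitely many vertices.
\<close>

definition leavitt ::
    "('v, 'e) pre_digraph \<Rightarrow> ('k::field, (('v, 'e) lpa_gen, 'k) free_poly set) module" where
  "leavitt E =
    (let R = free_algebra (lpa_gens E); I = lpa_ideal E in
      \<lparr>carrier = (\<lambda>p. I +>\<^bsub>R\<^esub> p) ` free_nonunital (lpa_gens E),
       mult = rcoset_mult R I,
       one = I +>\<^bsub>R\<^esub> (\<Sum>v \<in> verts E. gen (Vertex v)),
       zero = I,
       add = set_add R,
       smult = (\<lambda>c A. \<Union>p \<in> A. I +>\<^bsub>R\<^esub> scale c p)\<rparr>)"


section \<open>Corners and isomorphisms of algebras\<close>

definition corner :: "('k, 'a) module \<Rightarrow> 'a \<Rightarrow> ('k, 'a) module" where
  "corner A f = A\<lparr>carrier := {f \<otimes>\<^bsub>A\<^esub> x \<otimes>\<^bsub>A\<^esub> f | x. x \<in> carrier A}, one := f\<rparr>"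

text \<open>The scalars range over the whole type \<open>'k\<close>.\<close>

definition algebra_iso :: "('k, 'a) module \<Rightarrow> ('k, 'b) module \<Rightarrow> ('a \<Rightarrow> 'b) set" where
  "algebra_iso A B =
    {h \<in> ring_iso A B. \<forall>c. \<forall>x \<in> carrier A. h (c \<odot>\<^bsub>A\<^esub> x) = c \<odot>\<^bsub>B\<^esub> h x}"

definition algebra_isomorphic :: "('k, 'a) module \<Rightarrow> ('k, 'b) module \<Rightarrow> bool" where
  "algebra_isomorphic A B \<longleftrightarrow> algebra_iso A B \<noteq> {}"

end

theory Submission
  imports Defs "Graph_Theory.Arc_Walk"
begin

text \<open>
  Write \<open>L\<close> for the Leavitt path algebra of \<open>E\<close> and \<open>KE\<close> for the span of the paths in it.  The
  proof turns an idempotent \<open>\<epsilon>\<close> of \<open>L\<close> into a finite family of vertices and reads off a graph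
  from that family.

  Long paths turn elements of \<open>L\<close> into elements of \<open>KE\<close>: ghost edges cancel against the beginning
  of a path, so \<open>a q \<in> KE\<close> for all sufficiently long paths \<open>q\<close> (\<open>alg_shift_bound\<close>), while
  the relation \<open>v = \<Sum> e e\<^sup>*\<close> gives \<open>\<Sum> q q\<^sup>* = 1\<close> over suitable finite sets of long
  paths (\<open>full_code_sum\<close>).  Hence \<open>a\<close> is recovered from its products \<open>a q\<close>.  This principle is used three times.

  It shows that a homomorphism out of \<open>L\<close> is injective as soon as it is injective on
  \<open>KE\<close> (\<open>ev_inj\<close>).  So any family of elements of an algebra that satisfies the Leavitt relations
  of \<open>E\<close>, and in which the paths are linearly independent, spans a copy of \<open>L\<close>.  Such a family
  exists in an algebra of linear operators (\<open>ex_faithful_family\<close>), and from then on both \<open>L\<close> and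
  the Leavitt path algebra of the graph to be found live in that one algebra.

  It shows that the right ideal \<open>\<epsilon> L\<close> is generated by finitely many elements \<open>\<epsilon> q\<close> of \<open>KE\<close>.
  Finitely generated right ideals of a path algebra are free in the sense that they have
  generators \<open>n\<^sub>i = n\<^sub>i w\<^sub>i\<close>, with vertices \<open>w\<^sub>i\<close>, such that \<open>\<Sum> n\<^sub>i a\<^sub>i = 0\<close> with \<open>a\<^sub>i \<in> w\<^sub>i KE\<close>
  forces all \<open>a\<^sub>i = 0\<close>: reduce the generators until no leading path is a prefix of another.

  It shows, finally, that the same implication holds for \<open>a\<^sub>i \<in> w\<^sub>i L\<close>.  Writing
  \<open>\<epsilon> = \<Sum> n\<^sub>i m\<^sub>i\<close> with \<open>m\<^sub>i \<in> w\<^sub>i L \<epsilon>\<close>, uniqueness of coefficients gives \<open>m\<^sub>i n\<^sub>j = w\<^sub>i\<close> for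
  \<open>i = j\<close> and \<open>m\<^sub>i n\<^sub>j = 0\<close> otherwise (\<open>idempotent_splits\<close>).  In the language of
  projective modules, \<open>\<epsilon> L\<close> is a direct sum of modules \<open>w\<^sub>i L\<close>.

  The corner \<open>\<epsilon> L \<epsilon>\<close> is therefore spanned by the elements \<open>n\<^sub>i p q\<^sup>* m\<^sub>j\<close> with paths \<open>p\<close> and \<open>q\<close>
  from \<open>w\<^sub>i\<close> and \<open>w\<^sub>j\<close> to a common vertex.  It is a Leavitt path algebra when the paths starting
  in \<open>W = {w\<^sub>i}\<close> factor into finitely many first returns to \<open>W\<close>.  To achieve this, a summand
  \<open>w\<^sub>i\<close> may be replaced by the end points of a complete set of paths starting in \<open>w\<^sub>i\<close>.  Repeating
  this while a set \<open>D\<close> of regular vertices outside \<open>W\<close>, without cycles inside \<open>D\<close>, becomes as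
  large as possible ends in a family for which every path from \<open>W\<close> that leaves \<open>D\<close> enters \<open>W\<close>
  (\<open>ex_returning_splitting\<close>).

  The graph then has one vertex for each index \<open>i\<close>.  For every vertex in \<open>W\<close> one index is chosen
  as its representative; it emits one edge for each first return path, towards the representative
  of the end point.  Each of the other indices emits one edge, to the representative of the same
  vertex.  The edges are realised by \<open>n\<^sub>i p m\<^sub>j\<close> and their ghosts by \<open>n\<^sub>j p\<^sup>* m\<^sub>i\<close>; unique
  factorisation into first returns makes the paths of the new graph independent, and the
  elements generate exactly \<open>\<epsilon> L \<epsilon>\<close> (\<open>corner_alg\<close>).
\<close>

section \<open>Rings with central scalars\<close>

text \<open>
  An algebra over \<open>'k\<close> is given by a ring and a homomorphism \<open>\<kappa>\<close> into its centre.  In this form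
  free polynomials (\<open>\<kappa>\<close> yields constants) and linear operators (\<open>\<kappa>\<close> yields homotheties) are
  instances of the same locale.
\<close>

locale scalars =
  fixes \<kappa> :: "'k::field \<Rightarrow> 'r::ring_1"
  assumes scalar_add: "\<kappa> (a + b) = \<kappa> a + \<kappa> b"
    and scalar_mult: "\<kappa> (a * b) = \<kappa> a * \<kappa> b"
    and scalar_one: "\<kappa> 1 = 1"
    and scalar_central: "\<kappa> c * x = x * \<kappa> c"
begin

sublocale vs: vector_space "\<lambda>c x. \<kappa> c * x"
  by unfold_locales
    (simp_all add: scalar_add scalar_mult scalar_one distrib_left distrib_right mult.assoc)

lemma scalar_zero: "\<kappa> 0 = 0"
  using scalar_add[of 0 0] by simp

lemma scalar_uminus_one: "\<kappa> (- 1) = - 1"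
  using scalar_add[of "- 1" 1] by (simp add: scalar_zero scalar_one eq_neg_iff_add_eq_0)

lemma mult_scalar_left: "x * (\<kappa> c * y) = \<kappa> c * (x * y)"
  by (metis mult.assoc scalar_central)

lemma span_mult_left:
  assumes "x \<in> vs.span B" and "\<And>b. b \<in> B \<Longrightarrow> a * b \<in> vs.span B'"
  shows "a * x \<in> vs.span B'"
  using assms(1)
proof (induction rule: vs.span_induct_alt)
  case base
  show ?case by (simp add: vs.span_zero)
next
  case (step c b y)
  then show ?case
    using assms(2)[of b] by (simp add: distrib_left mult_scalar_left[of a c b] vs.span_add vs.span_scale)
qed

lemma span_mult_right:
  assumes "x \<in> vs.span B" and "\<And>b. b \<in> B \<Longrightarrow> b * a \<in> vs.span B'"
  shows "x * a \<in> vs.span B'"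
  using assms(1)
proof (induction rule: vs.span_induct_alt)
  case base
  show ?case by (simp add: vs.span_zero)
next
  case (step c b y)
  then show ?case
    using assms(2)[of b] by (simp add: distrib_right mult.assoc vs.span_add vs.span_scale)
qed

text \<open>
  The sum runs over indices instead of vectors: coefficients attached to walks can then be compared
  before it is known that distinct walks give distinct elements.
\<close>

lemma span_image_sum:
  assumes "x \<in> vs.span (f ` X)"
  shows "\<exists>A c. finite A \<and> A \<subseteq> X \<and> (\<forall>a\<in>A. c a \<noteq> 0) \<and> x = (\<Sum>a\<in>A. \<kappa> (c a) * f a)"
proof -
  have "\<exists>A c. finite A \<and> A \<subseteq> X \<and> x = (\<Sum>a\<in>A. \<kappa> (c a) * f a)"
    using assms
  proof (induction rule: vs.span_induct_alt)
    case base
    show ?case by (rule exI[of _ "{}"]) auto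
  next
    case (step d b y)
    then obtain A c a where A: "finite A" "A \<subseteq> X" "y = (\<Sum>a\<in>A. \<kappa> (c a) * f a)"
      and a: "a \<in> X" "b = f a" by blast
    define c' where "c' i = (if i \<in> A then c i else 0) + (if i = a then d else 0)" for i
    have "(\<Sum>i\<in>insert a A. \<kappa> (c' i) * f i)
        = (\<Sum>i\<in>insert a A. if i \<in> A then \<kappa> (c i) * f i else 0)
        + (\<Sum>i\<in>insert a A. if i = a then \<kappa> d * f i else 0)"
      unfolding sum.distrib[symmetric]
      by (intro sum.cong refl) (auto simp: c'_def scalar_add scalar_zero distrib_right)
    also have "(\<Sum>i\<in>insert a A. if i \<in> A then \<kappa> (c i) * f i else 0) = y"
      unfolding A(3) using A(1) by (intro sum.mono_neutral_cong_right) auto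
    also have "(\<Sum>i\<in>insert a A. if i = a then \<kappa> d * f i else 0) = \<kappa> d * b"
      using A(1) by (simp add: a(2))
    also have "y + \<kappa> d * b = \<kappa> d * b + y" by (rule add.commute)
    finally show ?case
      using A a by (intro exI[of _ "insert a A"] exI[of _ c']) auto
  qed
  then obtain A c where A: "finite A" "A \<subseteq> X" "x = (\<Sum>a\<in>A. \<kappa> (c a) * f a)" by blast
  have "x = (\<Sum>a\<in>{a\<in>A. c a \<noteq> 0}. \<kappa> (c a) * f a)"
    unfolding A(3) using A(1) by (intro sum.mono_neutral_right) (auto simp: scalar_zero)
  with A show ?thesis
    by (intro exI[of _ "{a\<in>A. c a \<noteq> 0}"] exI[of _ c]) auto
qed

end

section \<open>Complete codes of walks\<close>

context fin_digraph
begin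

text \<open>
  The finite complete prefix codes of walks from \<open>v\<close>: a walk that is infinite or ends in a sink
  has exactly one member of the code as a prefix.  The inductive form repeats the shape of
  the relation \<open>v = \<Sum> e e\<^sup>*\<close>, so that \<open>\<Sum> p p\<^sup>* = v\<close> holds over every such code.
\<close>

inductive full_code :: "'a \<Rightarrow> 'b list set \<Rightarrow> bool" where
  trivial: "v \<in> verts G \<Longrightarrow> full_code v {[]}"
| branch: "regular G v \<Longrightarrow> (\<And>e. e \<in> out_arcs G v \<Longrightarrow> full_code (head G e) (Q e))
    \<Longrightarrow> full_code v (\<Union>e\<in>out_arcs G v. (#) e ` Q e)"

lemma full_code_finite: "full_code v Q \<Longrightarrow> finite Q"
  by (induction rule: full_code.induct) auto

lemma full_code_awalk: "full_code v Q \<Longrightarrow> q \<in> Q \<Longrightarrow> \<exists>w. awalk v q w"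
proof (induction arbitrary: q rule: full_code.induct)
  case (trivial v)
  then show ?case by (auto simp: awalk_Nil_iff)
next
  case (branch v Q)
  then obtain e r where "e \<in> out_arcs G v" "r \<in> Q e" "q = e # r" by blast
  with branch.IH[of e r] show ?case by (auto simp: awalk_Cons_iff)
qed

lemma full_code_prefix_free:
  "full_code v Q \<Longrightarrow> p \<in> Q \<Longrightarrow> q \<in> Q \<Longrightarrow> p @ r = q @ s \<Longrightarrow> p = q"
proof (induction arbitrary: p q rule: full_code.induct)
  case (trivial v)
  then show ?case by simp
next
  case (branch v Q)
  from branch.prems(1,2) obtain e p' f q' where
    pq: "e \<in> out_arcs G v" "p' \<in> Q e" "p = e # p'" "q' \<in> Q f" "q = f # q'"
    by blast
  with branch.prems(3) have "f = e" "p' @ r = q' @ s" by auto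
  with pq branch.IH[of e p' q'] show ?case by simp
qed

text \<open>
  A walk that ends in a sink counts as long, whatever its length: multiplying it by a ghost edge
  removes its first edge or gives zero, as it does for a walk of positive length.
\<close>

definition long_walks :: "nat \<Rightarrow> ('a \<times> 'b list) set" where
  "long_walks n = {(v, \<alpha>). \<exists>w. awalk v \<alpha> w \<and> (n \<le> length \<alpha> \<or> out_arcs G w = {})}"

abbreviation walks :: "('a \<times> 'b list) set" where
  "walks \<equiv> {(v, \<alpha>). \<exists>w. awalk v \<alpha> w}"

lemma long_walks_0: "long_walks 0 = walks"
  by (auto simp: long_walks_def)

lemma long_walks_mono: "m \<le> n \<Longrightarrow> long_walks n \<subseteq> long_walks m"
  by (auto simp: long_walks_def)

lemma long_walks_Cons:
  assumes "(head G e, \<alpha>) \<in> long_walks n" "e \<in> arcs G"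
  shows "(tail G e, e # \<alpha>) \<in> long_walks (Suc n)"
  using assms by (auto simp: long_walks_def awalk_Cons_iff)

lemma long_full_code:
  "v \<in> verts G \<Longrightarrow> \<exists>Q. full_code v Q \<and> Pair v ` Q \<subseteq> long_walks n"
proof (induction n arbitrary: v)
  case 0
  then show ?case
    by (intro exI[of _ "{[]}"]) (auto simp: long_walks_def awalk_Nil_iff intro: full_code.trivial)
next
  case (Suc n)
  show ?case
  proof (cases "out_arcs G v = {}")
    case True
    with Suc.prems show ?thesis
      by (intro exI[of _ "{[]}"]) (auto simp: long_walks_def awalk_Nil_iff intro: full_code.trivial)
  next
    case False
    have "\<forall>e\<in>out_arcs G v. \<exists>Q. full_code (head G e) Q \<and> Pair (head G e) ` Q \<subseteq> long_walks n"
      using Suc.IH by auto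
    then obtain Q where Q: "\<And>e. e \<in> out_arcs G v \<Longrightarrow>
        full_code (head G e) (Q e) \<and> Pair (head G e) ` Q e \<subseteq> long_walks n"
      by metis
    have "full_code v (\<Union>e\<in>out_arcs G v. (#) e ` Q e)"
      using Q False Suc.prems by (intro full_code.branch) (auto simp: regular_def)
    moreover have "Pair v ` (\<Union>e\<in>out_arcs G v. (#) e ` Q e) \<subseteq> long_walks (Suc n)"
    proof
      fix x assume "x \<in> Pair v ` (\<Union>e\<in>out_arcs G v. (#) e ` Q e)"
      then obtain e q where "e \<in> out_arcs G v" "q \<in> Q e" "x = (v, e # q)" by blast
      with Q[of e] long_walks_Cons[of e q n] show "x \<in> long_walks (Suc n)" by auto
    qed
    ultimately show ?thesis by blast
  qed
qed

end

section \<open>Leavitt relations modulo an ideal\<close>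

text \<open>
  The relations are required only modulo an ideal \<open>J\<close> of the ring.  For \<open>J = {0}\<close> this describes
  a family of elements of an algebra; for the generators of the free algebra and its defining ideal
  it describes the presentation.  The computations of this section serve both.
\<close>

locale leavitt_mod = fin_digraph E + scalars \<kappa>
  for E :: "('v, 'e) pre_digraph" and \<kappa> :: "'k::field \<Rightarrow> 'r::ring_1" +
  fixes P :: "'v \<Rightarrow> 'r" and S T :: "'e \<Rightarrow> 'r" and J :: "'r set"
  assumes ideal_zero: "0 \<in> J"
    and ideal_add: "x \<in> J \<Longrightarrow> y \<in> J \<Longrightarrow> x + y \<in> J"
    and ideal_left: "x \<in> J \<Longrightarrow> a * x \<in> J"
    and ideal_right: "x \<in> J \<Longrightarrow> x * a \<in> J"
    and vertex_vertex: "v \<in> verts E \<Longrightarrow> w \<in> verts E \<Longrightarrow>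
          P v * P w - (if v = w then P w else 0) \<in> J"
    and tail_edge: "e \<in> arcs E \<Longrightarrow> P (tail E e) * S e - S e \<in> J"
    and edge_head: "e \<in> arcs E \<Longrightarrow> S e * P (head E e) - S e \<in> J"
    and head_ghost: "e \<in> arcs E \<Longrightarrow> P (head E e) * T e - T e \<in> J"
    and ghost_tail: "e \<in> arcs E \<Longrightarrow> T e * P (tail E e) - T e \<in> J"
    and ghost_edge: "e \<in> arcs E \<Longrightarrow> f \<in> arcs E \<Longrightarrow>
          T e * S f - (if e = f then P (head E e) else 0) \<in> J"
    and vertex_sum: "regular E v \<Longrightarrow> P v - (\<Sum>e\<in>out_arcs E v. S e * T e) \<in> J"
begin

definition eqv :: "'r \<Rightarrow> 'r \<Rightarrow> bool" (infix "\<approx>" 50) where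
  "x \<approx> y \<longleftrightarrow> x - y \<in> J"

lemma ideal_uminus: "x \<in> J \<Longrightarrow> - x \<in> J"
  using ideal_left[of x "- 1"] by simp

lemma eqv_refl [simp]: "x \<approx> x"
  by (simp add: eqv_def ideal_zero)

lemma eqv_sym: "x \<approx> y \<Longrightarrow> y \<approx> x"
  using ideal_uminus[of "x - y"] by (simp add: eqv_def)

lemma eqv_trans [trans]: "x \<approx> y \<Longrightarrow> y \<approx> z \<Longrightarrow> x \<approx> z"
  using ideal_add[of "x - y" "y - z"] by (simp add: eqv_def)

lemma eqv_left: "x \<approx> y \<Longrightarrow> a * x \<approx> a * y"
  using ideal_left[of "x - y" a] by (simp add: eqv_def algebra_simps)

lemma eqv_right: "x \<approx> y \<Longrightarrow> x * a \<approx> y * a"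
  using ideal_right[of "x - y" a] by (simp add: eqv_def algebra_simps)

lemma eqv_add: "x \<approx> y \<Longrightarrow> x' \<approx> y' \<Longrightarrow> x + x' \<approx> y + y'"
  using ideal_add[of "x - y" "x' - y'"] by (simp add: eqv_def algebra_simps)

lemma eqv_sum: "(\<And>i. i \<in> A \<Longrightarrow> f i \<approx> g i) \<Longrightarrow> sum f A \<approx> sum g A"
  by (induction A rule: infinite_finite_induct) (auto intro: eqv_add)

lemma ideal_sum: "(\<And>i. i \<in> A \<Longrightarrow> f i \<in> J) \<Longrightarrow> sum f A \<in> J"
  by (induction A rule: infinite_finite_induct) (auto intro: ideal_zero ideal_add)

lemma eqv_ideal: "x \<approx> y \<Longrightarrow> y \<in> J \<Longrightarrow> x \<in> J"
  using ideal_add[of "x - y" y] by (simp add: eqv_def)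

lemma P_P: "v \<in> verts E \<Longrightarrow> P v * P v \<approx> P v"
  using vertex_vertex[of v v] by (simp add: eqv_def)

lemma P_orth: "v \<in> verts E \<Longrightarrow> w \<in> verts E \<Longrightarrow> v \<noteq> w \<Longrightarrow> P v * P w \<in> J"
  using vertex_vertex[of v w] by simp

lemma P_S: "e \<in> arcs E \<Longrightarrow> P (tail E e) * S e \<approx> S e"
  and S_P: "e \<in> arcs E \<Longrightarrow> S e * P (head E e) \<approx> S e"
  and T_P: "e \<in> arcs E \<Longrightarrow> T e * P (tail E e) \<approx> T e"
  by (simp_all add: eqv_def tail_edge edge_head ghost_tail)

lemma T_S: "e \<in> arcs E \<Longrightarrow> T e * S e \<approx> P (head E e)"
  using ghost_edge[of e e] by (simp add: eqv_def)

lemma T_S_orth: "e \<in> arcs E \<Longrightarrow> f \<in> arcs E \<Longrightarrow> e \<noteq> f \<Longrightarrow> T e * S f \<in> J"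
  using ghost_edge[of e f] by simp

lemma P_sum: "regular E v \<Longrightarrow> P v \<approx> (\<Sum>e\<in>out_arcs E v. S e * T e)"
  by (simp add: eqv_def vertex_sum)

inductive_set alg :: "'r set" where
  zero: "0 \<in> alg"
| vertex: "v \<in> verts E \<Longrightarrow> P v \<in> alg"
| edge: "e \<in> arcs E \<Longrightarrow> S e \<in> alg"
| ghost: "e \<in> arcs E \<Longrightarrow> T e \<in> alg"
| add: "x \<in> alg \<Longrightarrow> y \<in> alg \<Longrightarrow> x + y \<in> alg"
| mult: "x \<in> alg \<Longrightarrow> y \<in> alg \<Longrightarrow> x * y \<in> alg"
| scale: "x \<in> alg \<Longrightarrow> \<kappa> c * x \<in> alg"

text \<open>
  The element of a walk and its ghost.  The recursion puts the vertex at the end of the walk, so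
  that prepending an edge is multiplication by definition and needs no relation.
\<close>

primrec pe :: "'v \<Rightarrow> 'e list \<Rightarrow> 'r" where
  "pe v [] = P v"
| "pe v (e # \<alpha>) = S e * pe (head E e) \<alpha>"

primrec ge :: "'v \<Rightarrow> 'e list \<Rightarrow> 'r" where
  "ge v [] = P v"
| "ge v (e # \<alpha>) = ge (head E e) \<alpha> * T e"

abbreviation path_elems :: "('v \<times> 'e list) set \<Rightarrow> 'r set" where
  "path_elems X \<equiv> case_prod pe ` X"

lemma P_pe: "awalk v \<alpha> w \<Longrightarrow> P v * pe v \<alpha> \<approx> pe v \<alpha>"
proof (cases \<alpha>)
  case Nil
  then show "awalk v \<alpha> w \<Longrightarrow> ?thesis" by (auto simp: awalk_Nil_iff P_P)
next
  case (Cons e \<beta>)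
  then show "awalk v \<alpha> w \<Longrightarrow> ?thesis"
    using eqv_right[OF P_S, of e "pe (head E e) \<beta>"] by (auto simp: awalk_Cons_iff mult.assoc)
qed

lemma ge_P: "awalk v \<alpha> w \<Longrightarrow> ge v \<alpha> * P v \<approx> ge v \<alpha>"
proof (cases \<alpha>)
  case Nil
  then show "awalk v \<alpha> w \<Longrightarrow> ?thesis" by (auto simp: awalk_Nil_iff P_P)
next
  case (Cons e \<beta>)
  then show "awalk v \<alpha> w \<Longrightarrow> ?thesis"
    using eqv_left[OF T_P, of e "ge (head E e) \<beta>"] by (auto simp: awalk_Cons_iff mult.assoc)
qed

lemma pe_P: "awalk v \<alpha> w \<Longrightarrow> pe v \<alpha> * P w \<approx> pe v \<alpha>"
  by (induction \<alpha> arbitrary: v) (auto simp: awalk_simps P_P mult.assoc intro: eqv_left)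

lemma P_ge: "awalk v \<alpha> w \<Longrightarrow> P w * ge v \<alpha> \<approx> ge v \<alpha>"
  by (induction \<alpha> arbitrary: v) (auto simp: awalk_simps P_P mult.assoc[symmetric] intro: eqv_right)

lemma pe_append: "awalk v \<alpha> w \<Longrightarrow> awalk w \<beta> u \<Longrightarrow> pe v \<alpha> * pe w \<beta> \<approx> pe v (\<alpha> @ \<beta>)"
  by (induction \<alpha> arbitrary: v) (auto simp: awalk_simps P_pe mult.assoc intro: eqv_left)

lemma ge_append: "awalk v \<alpha> w \<Longrightarrow> awalk w \<beta> u \<Longrightarrow> ge w \<beta> * ge v \<alpha> \<approx> ge v (\<alpha> @ \<beta>)"
  by (induction \<alpha> arbitrary: v) (auto simp: awalk_simps ge_P mult.assoc[symmetric] intro: eqv_right)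

lemma pe_P_orth: "awalk v \<alpha> w \<Longrightarrow> u \<in> verts E \<Longrightarrow> u \<noteq> w \<Longrightarrow> pe v \<alpha> * P u \<in> J"
  by (induction \<alpha> arbitrary: v) (auto simp: awalk_simps P_orth mult.assoc intro: ideal_left)

lemma P_pe_orth: "awalk v \<alpha> w \<Longrightarrow> u \<in> verts E \<Longrightarrow> u \<noteq> v \<Longrightarrow> P u * pe v \<alpha> \<in> J"
  using eqv_left[OF eqv_sym[OF P_pe[of v \<alpha> w]], of "P u"] ideal_right[OF P_orth[of u v], of "pe v \<alpha>"]
    awalk_hd_in_verts[of v \<alpha> w]
  by (auto simp: mult.assoc[symmetric] elim: eqv_ideal)

lemma ge_pe:
  assumes "awalk v \<alpha> w"
  shows "ge v \<alpha> * pe v \<alpha> \<approx> P w"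
  using assms
proof (induction \<alpha> arbitrary: v)
  case Nil
  then show ?case by (auto simp: awalk_Nil_iff P_P)
next
  case (Cons e \<alpha>)
  let ?h = "head E e"
  have e: "e \<in> arcs E" "awalk ?h \<alpha> w" using Cons.prems by (auto simp: awalk_Cons_iff)
  have "ge ?h \<alpha> * (T e * S e * pe ?h \<alpha>) \<approx> ge ?h \<alpha> * (P ?h * pe ?h \<alpha>)"
    by (intro eqv_left eqv_right T_S e)
  also have "\<dots> \<approx> ge ?h \<alpha> * pe ?h \<alpha>" by (intro eqv_left P_pe[OF e(2)])
  also have "\<dots> \<approx> P w" by (rule Cons.IH[OF e(2)])
  finally show ?case by (simp add: mult.assoc)
qed

lemma full_code_orth:
  "full_code v Q \<Longrightarrow> p \<in> Q \<Longrightarrow> q \<in> Q \<Longrightarrow> p \<noteq> q \<Longrightarrow> ge v p * pe v q \<in> J"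
proof (induction arbitrary: p q rule: full_code.induct)
  case (trivial v)
  then show ?case by simp
next
  case (branch v Q)
  from branch.prems obtain e p' f q' where
    pq: "e \<in> out_arcs E v" "p' \<in> Q e" "p = e # p'" "f \<in> out_arcs E v" "q' \<in> Q f" "q = f # q'"
    by blast
  let ?h = "head E e"
  have eq: "ge v p * pe v q = ge ?h p' * (T e * S f) * pe (head E f) q'"
    by (simp add: pq mult.assoc)
  show ?case
  proof (cases "e = f")
    case False
    then show ?thesis
      unfolding eq using pq by (intro ideal_right ideal_left T_S_orth) auto
  next
    case True
    obtain w where w: "awalk ?h q' w"
      using full_code_awalk[OF branch.hyps(2)[OF pq(1)], of q'] pq(5) True by auto
    have "ge ?h p' * (T e * S e * pe ?h q') \<approx> ge ?h p' * (P ?h * pe ?h q')"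
      using pq(1) by (intro eqv_left eqv_right T_S) simp
    also have "\<dots> \<approx> ge ?h p' * pe ?h q'"
      by (intro eqv_left P_pe[OF w])
    finally have "ge v p * pe v q \<approx> ge ?h p' * pe ?h q'"
      unfolding eq using True by (simp add: mult.assoc)
    moreover have "ge ?h p' * pe ?h q' \<in> J"
      using branch.IH[of e p' q'] pq branch.prems True by simp
    ultimately show ?thesis by (rule eqv_ideal)
  qed
qed

text \<open>
  The relation \<open>v = \<Sum> e e\<^sup>*\<close>, applied once for every branching of the code.
\<close>

lemma full_code_sum:
  "full_code v Q \<Longrightarrow> P v \<approx> (\<Sum>q\<in>Q. pe v q * ge v q)"
proof (induction rule: full_code.induct)
  case (trivial v)
  then show ?case using eqv_sym[OF P_P] by simp
next
  case (branch v Q)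
  let ?O = "out_arcs E v"
  have "(\<Sum>q\<in>(\<Union>e\<in>?O. (#) e ` Q e). pe v q * ge v q) = (\<Sum>e\<in>?O. \<Sum>q\<in>(#) e ` Q e. pe v q * ge v q)"
    using full_code_finite[OF branch.hyps(2)] by (intro sum.UNION_disjoint) auto
  also have "\<dots> = (\<Sum>e\<in>?O. \<Sum>q\<in>Q e. S e * (pe (head E e) q * ge (head E e) q) * T e)"
    by (rule sum.cong[OF refl], subst sum.reindex) (simp_all add: mult.assoc)
  also have "\<dots> = (\<Sum>e\<in>?O. S e * (\<Sum>q\<in>Q e. pe (head E e) q * ge (head E e) q) * T e)"
    by (simp only: sum_distrib_left sum_distrib_right)
  also have "\<dots> \<approx> (\<Sum>e\<in>?O. S e * P (head E e) * T e)"
    by (intro eqv_sum eqv_left eqv_right eqv_sym[OF branch.IH])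
  also have "\<dots> \<approx> (\<Sum>e\<in>?O. S e * T e)"
    by (intro eqv_sum eqv_right S_P) simp
  also have "\<dots> \<approx> P v"
    by (rule eqv_sym) (rule P_sum[OF branch.hyps(1)])
  finally show ?case by (rule eqv_sym)
qed

lemma alg_unit_right: "a \<in> alg \<Longrightarrow> a * (\<Sum>v\<in>verts E. P v) \<approx> a"
proof (induction rule: alg.induct)
  have *: "P w * (\<Sum>v\<in>verts E. P v) \<approx> P w" if "w \<in> verts E" for w
  proof -
    have "(\<Sum>v\<in>verts E. P w * P v) \<approx> (\<Sum>v\<in>verts E. if w = v then P v else 0)"
      using that by (intro eqv_sum) (simp add: eqv_def vertex_vertex)
    then show ?thesis using that by (simp add: sum_distrib_left)
  qed
  {
    fix w assume "w \<in> verts E" then show "P w * (\<Sum>v\<in>verts E. P v) \<approx> P w" by (rule *)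
  next
    fix e assume e: "e \<in> arcs E"
    have "S e * (\<Sum>v\<in>verts E. P v) \<approx> S e * P (head E e) * (\<Sum>v\<in>verts E. P v)"
      using e by (intro eqv_right eqv_sym[OF S_P])
    also have "\<dots> \<approx> S e * P (head E e)"
      using e by (auto simp: mult.assoc intro!: eqv_left *)
    also have "\<dots> \<approx> S e" by (rule S_P[OF e])
    finally show "S e * (\<Sum>v\<in>verts E. P v) \<approx> S e" .
    have "T e * (\<Sum>v\<in>verts E. P v) \<approx> T e * P (tail E e) * (\<Sum>v\<in>verts E. P v)"
      using e by (intro eqv_right eqv_sym[OF T_P])
    also have "\<dots> \<approx> T e * P (tail E e)"
      using e by (auto simp: mult.assoc intro!: eqv_left *)
    also have "\<dots> \<approx> T e" by (rule T_P[OF e])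
    finally show "T e * (\<Sum>v\<in>verts E. P v) \<approx> T e" .
  }
qed (auto simp: distrib_right mult.assoc intro: eqv_add eqv_left)

text \<open>
  Multiplication by \<open>a\<close> on the left takes combinations of walks to combinations of walks and
  shortens them by at most \<open>N\<close>, provided that the walks are long enough to begin with.
\<close>

definition shift_bound :: "nat \<Rightarrow> 'r \<Rightarrow> bool" where
  "shift_bound N a \<longleftrightarrow> (\<forall>n v \<alpha>. (v, \<alpha>) \<in> long_walks (n + N) \<longrightarrow>
     a * pe v \<alpha> \<in> vs.span (path_elems (long_walks n) \<union> J))"

lemma span_eqv: "x \<approx> y \<Longrightarrow> y \<in> vs.span (B \<union> J) \<Longrightarrow> x \<in> vs.span (B \<union> J)"
  using vs.span_add[of "x - y" "B \<union> J" y] by (simp add: eqv_def vs.span_base)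

lemma shift_bound_mono:
  assumes "shift_bound N a" "N \<le> M" shows "shift_bound M a"
  unfolding shift_bound_def
proof (intro allI impI)
  fix n v \<alpha> assume "(v, \<alpha>) \<in> long_walks (n + M)"
  then have "(v, \<alpha>) \<in> long_walks (n + N)"
    using assms(2) long_walks_mono[of "n + N" "n + M"] by auto
  with assms(1) show "a * pe v \<alpha> \<in> vs.span (path_elems (long_walks n) \<union> J)"
    by (auto simp: shift_bound_def)
qed

lemma shift_bound_mult:
  assumes "shift_bound N a" "shift_bound M b" shows "shift_bound (N + M) (a * b)"
  unfolding shift_bound_def
proof (intro allI impI)
  fix n v \<alpha> assume "(v, \<alpha>) \<in> long_walks (n + (N + M))"
  then have "b * pe v \<alpha> \<in> vs.span (path_elems (long_walks (n + N)) \<union> J)"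
    using assms(2) by (auto simp: shift_bound_def add.assoc)
  then show "a * b * pe v \<alpha> \<in> vs.span (path_elems (long_walks n) \<union> J)"
    unfolding mult.assoc
  proof (rule span_mult_left)
    fix y assume "y \<in> path_elems (long_walks (n + N)) \<union> J"
    then show "a * y \<in> vs.span (path_elems (long_walks n) \<union> J)"
      using assms(1) by (auto simp: shift_bound_def ideal_left vs.span_base)
  qed
qed

text \<open>
  A ghost edge shortens by one and the other generators do not shorten at all; bounds add up in
  products.
\<close>

lemma alg_shift_bound: "a \<in> alg \<Longrightarrow> \<exists>N. shift_bound N a"
proof (induction rule: alg.induct)
  case zero
  show ?case by (auto simp: shift_bound_def vs.span_zero)
next
  case (vertex u)
  have "P u * pe v \<alpha> \<in> vs.span (path_elems (long_walks n) \<union> J)" if l: "(v, \<alpha>) \<in> long_walks n" for v \<alpha> n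
  proof -
    obtain w where w: "awalk v \<alpha> w" using l by (auto simp: long_walks_def)
    show ?thesis
    proof (cases "u = v")
      case True
      have "pe v \<alpha> \<in> vs.span (path_elems (long_walks n) \<union> J)" using l by (force intro: vs.span_base)
      with P_pe[OF w] show ?thesis unfolding True by (rule span_eqv)
    next
      case False
      then show ?thesis using P_pe_orth[OF w vertex] by (auto intro: vs.span_base)
    qed
  qed
  then show ?case by (intro exI[of _ 0]) (auto simp: shift_bound_def)
next
  case (edge e)
  have "S e * pe v \<alpha> \<in> vs.span (path_elems (long_walks n) \<union> J)" if l: "(v, \<alpha>) \<in> long_walks n" for v \<alpha> n
  proof -
    obtain w where w: "awalk v \<alpha> w" using l by (auto simp: long_walks_def)
    show ?thesis
    proof (cases "head E e = v")
      case True
      have "(tail E e, e # \<alpha>) \<in> long_walks n"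
        using long_walks_Cons[of e \<alpha> n] l edge True long_walks_mono[of n "Suc n"] by auto
      then have "S e * pe v \<alpha> \<in> path_elems (long_walks n)" using True by force
      then show ?thesis by (blast intro: vs.span_base)
    next
      case False
      have "S e * pe v \<alpha> \<approx> S e * P (head E e) * pe v \<alpha>"
        by (intro eqv_right eqv_sym[OF S_P] edge)
      moreover have "S e * P (head E e) * pe v \<alpha> \<in> J"
        unfolding mult.assoc using False edge by (intro ideal_left P_pe_orth[OF w]) auto
      ultimately show ?thesis by (auto intro: vs.span_base eqv_ideal)
    qed
  qed
  then show ?case by (intro exI[of _ 0]) (auto simp: shift_bound_def)
next
  case (ghost e)
  have "T e * pe v \<alpha> \<in> vs.span (path_elems (long_walks n) \<union> J)"
    if l: "(v, \<alpha>) \<in> long_walks (Suc n)" for v \<alpha> n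
  proof -
    obtain w where w: "awalk v \<alpha> w" "Suc n \<le> length \<alpha> \<or> out_arcs E w = {}"
      using l by (auto simp: long_walks_def)
    have "T e * pe v \<alpha> \<in> J" if "tail E e \<noteq> v"
    proof (rule eqv_ideal)
      show "T e * pe v \<alpha> \<approx> T e * P (tail E e) * pe v \<alpha>"
        by (intro eqv_right eqv_sym[OF T_P] ghost)
      show "T e * P (tail E e) * pe v \<alpha> \<in> J"
        unfolding mult.assoc using that ghost by (intro ideal_left P_pe_orth[OF w(1)]) auto
    qed
    moreover have "T e * pe v \<alpha> \<in> vs.span (path_elems (long_walks n) \<union> J)" if v: "tail E e = v"
    proof (cases \<alpha>)
      case Nil
      \<comment> \<open>A trivial long walk sits at a sink, but \<open>v\<close> emits \<open>e\<close>.\<close>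
      then show ?thesis using w v ghost by (auto simp: awalk_Nil_iff)
    next
      case (Cons f \<beta>)
      then have f: "f \<in> arcs E" "awalk (head E f) \<beta> w" using w by (auto simp: awalk_Cons_iff)
      show ?thesis
      proof (cases "e = f")
        case True
        have "T e * pe v \<alpha> \<approx> P (head E f) * pe (head E f) \<beta>"
          unfolding Cons pe.simps mult.assoc[symmetric] True by (intro eqv_right T_S f)
        also have "\<dots> \<approx> pe (head E f) \<beta>" by (rule P_pe[OF f(2)])
        finally have "T e * pe v \<alpha> \<approx> pe (head E f) \<beta>" .
        moreover have "(head E f, \<beta>) \<in> long_walks n" using w f Cons by (auto simp: long_walks_def)
        then have "pe (head E f) \<beta> \<in> vs.span (path_elems (long_walks n) \<union> J)"
          by (force intro: vs.span_base)
        ultimately show ?thesis by (rule span_eqv)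
      next
        case False
        then have "T e * pe v \<alpha> \<in> J"
          unfolding Cons pe.simps mult.assoc[symmetric] by (intro ideal_right T_S_orth f ghost)
        then show ?thesis by (auto intro: vs.span_base)
      qed
    qed
    ultimately show ?thesis by (auto intro: vs.span_base)
  qed
  then show ?case by (intro exI[of _ 1]) (auto simp: shift_bound_def)
next
  case (add x y)
  then obtain N M where "shift_bound N x" "shift_bound M y" by blast
  then have "shift_bound (N + M) x" "shift_bound (N + M) y" by (auto elim: shift_bound_mono)
  then have "shift_bound (N + M) (x + y)" by (auto simp: shift_bound_def distrib_right intro: vs.span_add)
  then show ?case by blast
next
  case (mult x y)
  then show ?case by (blast intro: shift_bound_mult)
next
  case (scale x c)
  then obtain N where "shift_bound N x" by blast
  then have "shift_bound N (\<kappa> c * x)" by (auto simp: shift_bound_def mult.assoc intro: vs.span_scale)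
  then show ?case by blast
qed

lemma alg_decompose:
  assumes "a \<in> alg" and "\<And>v. v \<in> verts E \<Longrightarrow> full_code v (Q v)"
  shows "a \<approx> (\<Sum>v\<in>verts E. \<Sum>q\<in>Q v. a * pe v q * ge v q)"
proof -
  have "a \<approx> a * (\<Sum>v\<in>verts E. P v)" by (rule eqv_sym[OF alg_unit_right[OF assms(1)]])
  also have "\<dots> \<approx> a * (\<Sum>v\<in>verts E. \<Sum>q\<in>Q v. pe v q * ge v q)"
    by (intro eqv_left eqv_sum full_code_sum assms(2))
  finally show ?thesis by (simp add: sum_distrib_left mult.assoc)
qed

lemma alg_sum: "(\<And>i. i \<in> A \<Longrightarrow> f i \<in> alg) \<Longrightarrow> sum f A \<in> alg"
  by (induction A rule: infinite_finite_induct) (auto intro: alg.intros)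

lemma pe_alg: "awalk v \<alpha> w \<Longrightarrow> pe v \<alpha> \<in> alg"
  by (induction \<alpha> arbitrary: v) (auto simp: awalk_simps intro: alg.intros)

lemma ge_alg: "awalk v \<alpha> w \<Longrightarrow> ge v \<alpha> \<in> alg"
  by (induction \<alpha> arbitrary: v) (auto simp: awalk_simps intro: alg.intros)

end

section \<open>Evaluation of noncommutative polynomials\<close>

lemma poly_sum_single: "(p :: 'g word \<Rightarrow>\<^sub>0 'k::ring_1) = (\<Sum>w\<in>Poly_Mapping.keys p. Poly_Mapping.single w (Poly_Mapping.lookup p w))"
  by (rule poly_mapping_eqI)
    (auto simp: lookup_sum lookup_single when_def in_keys_iff sum.delta' intro: sum.neutral)

interpretation poly: scalars "Poly_Mapping.single 0 :: 'k::field \<Rightarrow> ('g, 'k) free_poly"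
proof
  fix c :: 'k and p :: "('g, 'k) free_poly"
  show "Poly_Mapping.single 0 c * p = p * Poly_Mapping.single 0 c"
    by (subst (1 2) poly_sum_single[of p])
      (simp add: sum_distrib_left sum_distrib_right mult_single mult.commute)
qed (simp_all add: single_add mult_single)

lemma scale_eq: "scale c p = Poly_Mapping.single 0 c * p"
proof -
  have "Poly_Mapping.single 0 c * p = (\<Sum>w\<in>Poly_Mapping.keys p. Poly_Mapping.single w (c * Poly_Mapping.lookup p w))"
    by (subst poly_sum_single[of p]) (simp add: sum_distrib_left mult_single)
  also have "Poly_Mapping.lookup \<dots> w = c * Poly_Mapping.lookup p w" for w
    by (auto simp: lookup_sum lookup_single when_def in_keys_iff sum.delta' intro: sum.neutral)
  moreover have "Poly_Mapping.lookup (scale c p) w = c * Poly_Mapping.lookup p w" for w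
    by (simp add: scale_def map.rep_eq when_def)
  ultimately show ?thesis by (simp add: poly_mapping_eqI)
qed

lemma prod_list_gen: "prod_list (map gen ws) = Poly_Mapping.single (Word ws) (1::'k::field)"
  by (induction ws) (simp_all add: gen_def mult_single plus_word_def zero_word_def flip: single_one)

context scalars
begin

text \<open>
  The homomorphism from free polynomials that sends the letter \<open>x\<close> to \<open>g x\<close>.
\<close>

definition ev :: "('g \<Rightarrow> 'r) \<Rightarrow> ('g, 'k) free_poly \<Rightarrow> 'r" where
  "ev g p = (\<Sum>w\<in>Poly_Mapping.keys p. \<kappa> (Poly_Mapping.lookup p w) * prod_list (map g (letters w)))"

lemma ev_superset:
  "finite A \<Longrightarrow> Poly_Mapping.keys p \<subseteq> A \<Longrightarrow>
    ev g p = (\<Sum>w\<in>A. \<kappa> (Poly_Mapping.lookup p w) * prod_list (map g (letters w)))"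
  unfolding ev_def by (rule sum.mono_neutral_left) (auto simp: in_keys_iff scalar_zero)

lemma ev_zero [simp]: "ev g 0 = 0"
  by (simp add: ev_def)

lemma ev_add: "ev g (p + q) = ev g p + ev g q"
proof -
  let ?A = "Poly_Mapping.keys p \<union> Poly_Mapping.keys q"
  have "ev g (p + q) = (\<Sum>w\<in>?A. \<kappa> (Poly_Mapping.lookup (p + q) w) * prod_list (map g (letters w)))"
    by (intro ev_superset) (auto dest: keys_add[THEN subsetD])
  also have "\<dots> = (\<Sum>w\<in>?A. \<kappa> (Poly_Mapping.lookup p w) * prod_list (map g (letters w)))
      + (\<Sum>w\<in>?A. \<kappa> (Poly_Mapping.lookup q w) * prod_list (map g (letters w)))"
    by (simp add: lookup_add scalar_add distrib_right sum.distrib)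
  also have "\<dots> = ev g p + ev g q"
    by (intro arg_cong2[of _ _ _ _ "(+)"] ev_superset[symmetric]) auto
  finally show ?thesis .
qed

lemma ev_sum: "ev g (\<Sum>i\<in>A. f i) = (\<Sum>i\<in>A. ev g (f i))"
  by (induction A rule: infinite_finite_induct) (auto simp: ev_add)

lemma ev_single: "ev g (Poly_Mapping.single w c) = \<kappa> c * prod_list (map g (letters w))"
  by (subst ev_superset[of "{w}"]) auto

lemma ev_const: "ev g (Poly_Mapping.single 0 c) = \<kappa> c"
  by (simp add: ev_single zero_word_def)

lemma ev_gen [simp]: "ev g (gen x) = g x"
  by (simp add: gen_def ev_single scalar_one)

lemma ev_mult: "ev g (p * q) = ev g p * ev g q"
proof -
  have "p * q = (\<Sum>u\<in>Poly_Mapping.keys p. \<Sum>w\<in>Poly_Mapping.keys q.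
      Poly_Mapping.single (u + w) (Poly_Mapping.lookup p u * Poly_Mapping.lookup q w))"
    using arg_cong2[OF poly_sum_single[of p] poly_sum_single[of q], of "(*)"]
    by (simp only: sum_product mult_single)
  moreover have "\<kappa> (a * b) * prod_list (map g (letters (u + w))) =
      \<kappa> a * prod_list (map g (letters u)) * (\<kappa> b * prod_list (map g (letters w)))" for a b u w
  proof -
    have "prod_list (map g (letters (u + w))) = prod_list (map g (letters u)) * prod_list (map g (letters w))"
      by (simp add: plus_word_def)
    then show ?thesis
      by (simp only: scalar_mult mult.assoc mult_scalar_left[of "prod_list (map g (letters u))" b])
  qed
  ultimately show ?thesis
    by (simp only: ev_sum ev_single ev_def[of g p] ev_def[of g q] sum_product)
qed

lemma ev_uminus: "ev g (- p) = - ev g p"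
  using ev_add[of g p "- p"] by (simp add: eq_neg_iff_add_eq_0 add.commute)

lemma ev_diff: "ev g (p - q) = ev g p - ev g q"
  using ev_add[of g p "- q"] by (simp add: ev_uminus)

end

section \<open>The free algebra\<close>

lemma free_algebra_sel [simp]:
  "\<zero>\<^bsub>free_algebra X\<^esub> = 0" "\<one>\<^bsub>free_algebra X\<^esub> = 1"
  "x \<oplus>\<^bsub>free_algebra X\<^esub> y = x + y" "x \<otimes>\<^bsub>free_algebra X\<^esub> y = x * y"
  by (simp_all add: free_algebra_def)

lemma free_carrier: "p \<in> carrier (free_algebra X) \<longleftrightarrow> (\<forall>w \<in> Poly_Mapping.keys p. set (letters w) \<subseteq> X)"
  by (simp add: free_algebra_def)

lemma free_carrier_closed [simp, intro]:
  "0 \<in> carrier (free_algebra X)"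
  "1 \<in> carrier (free_algebra X)"
  "p \<in> carrier (free_algebra X) \<Longrightarrow> q \<in> carrier (free_algebra X) \<Longrightarrow> p + q \<in> carrier (free_algebra X)"
  "p \<in> carrier (free_algebra X) \<Longrightarrow> q \<in> carrier (free_algebra X) \<Longrightarrow> p * q \<in> carrier (free_algebra X)"
  "p \<in> carrier (free_algebra X) \<Longrightarrow> - p \<in> carrier (free_algebra X)"
  "Poly_Mapping.single 0 c \<in> carrier (free_algebra X)"
  "x \<in> X \<Longrightarrow> gen x \<in> carrier (free_algebra X)"
proof -
  assume p: "p \<in> carrier (free_algebra X)" and q: "q \<in> carrier (free_algebra X)"
  show "p + q \<in> carrier (free_algebra X)"
    using p q keys_add[of p q] unfolding free_carrier by blast
  show "p * q \<in> carrier (free_algebra X)"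
    unfolding free_carrier
  proof
    fix w assume "w \<in> Poly_Mapping.keys (p * q)"
    then obtain a b where "w = a + b" "a \<in> Poly_Mapping.keys p" "b \<in> Poly_Mapping.keys q"
      using keys_mult[of p q] by auto
    with p q show "set (letters w) \<subseteq> X" by (auto simp: free_carrier plus_word_def)
  qed
qed (auto simp: free_carrier zero_word_def gen_def)

lemma free_carrier_diff [simp, intro]:
  "p \<in> carrier (free_algebra X) \<Longrightarrow> q \<in> carrier (free_algebra X) \<Longrightarrow> p - q \<in> carrier (free_algebra X)"
  using free_carrier_closed(3)[of p X "- q"] by auto

lemma free_carrier_sum [intro]:
  "(\<And>i. i \<in> A \<Longrightarrow> f i \<in> carrier (free_algebra X)) \<Longrightarrow> sum f A \<in> carrier (free_algebra X)"
  by (induction A rule: infinite_finite_induct) auto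

lemma ring_free_algebra: "ring (free_algebra X)"
proof (rule ringI)
  show "abelian_group (free_algebra X)"
    by (rule abelian_groupI) (auto simp: add_ac intro: exI[of _ "- x" for x] bexI[of _ "- x" for x])
  show "monoid (free_algebra X)"
    by (rule monoidI) (auto simp: mult.assoc)
qed (auto simp: distrib_left distrib_right)

text \<open>
  The retraction onto the free algebra on \<open>X\<close> that kills all other letters.  It transports the
  ideal of the free algebra on \<open>X\<close> to an ideal of the ring of all free polynomials.
\<close>

definition letter_proj :: "'g set \<Rightarrow> ('g, 'k::field) free_poly \<Rightarrow> ('g, 'k) free_poly" where
  "letter_proj X = poly.ev (\<lambda>x. if x \<in> X then gen x else 0)"

lemma letter_proj_mem: "letter_proj X p \<in> carrier (free_algebra X)"
proof -
  have "prod_list (map (\<lambda>x. if x \<in> X then gen x else 0) ws) \<in> carrier (free_algebra X)" for ws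
    by (induction ws) auto
  then show ?thesis
    unfolding letter_proj_def poly.ev_def by (intro free_carrier_sum free_carrier_closed)
qed

lemma letter_proj_id:
  fixes p :: "('g, 'k::field) free_poly"
  assumes "p \<in> carrier (free_algebra X)"
  shows "letter_proj X p = p"
proof -
  have "prod_list (map (\<lambda>x. if x \<in> X then gen x else 0) (letters w)) = Poly_Mapping.single w (1::'k)"
    if "w \<in> Poly_Mapping.keys p" for w
  proof -
    have "map (\<lambda>x. if x \<in> X then gen x else 0) (letters w) = map (gen :: 'g \<Rightarrow> ('g, 'k) free_poly) (letters w)"
      using assms that by (auto simp: free_carrier)
    from arg_cong[OF this, of prod_list] show ?thesis
      using prod_list_gen[of "letters w"] by simp
  qed
  then have "letter_proj X p = (\<Sum>w\<in>Poly_Mapping.keys p. Poly_Mapping.single w (Poly_Mapping.lookup p w))"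
    unfolding letter_proj_def poly.ev_def by (intro sum.cong refl) (simp add: mult_single)
  then show ?thesis by (simp only: poly_sum_single[symmetric])
qed

lemma word_add_eq_zero: "(u + w = 0) \<longleftrightarrow> u = 0 \<and> w = (0 :: 'g word)"
  by (cases u; cases w) (auto simp: plus_word_def zero_word_def)

lemma free_nonunital_mult:
  assumes "p \<in> free_nonunital X" "q \<in> carrier (free_algebra X)"
  shows "p * q \<in> free_nonunital X"
proof -
  have "0 \<notin> Poly_Mapping.keys (p * q)"
  proof
    assume "0 \<in> Poly_Mapping.keys (p * q)"
    then obtain a b where "0 = a + b" "a \<in> Poly_Mapping.keys p" using keys_mult[of p q] by blast
    then have "0 \<in> Poly_Mapping.keys p" by (metis word_add_eq_zero)
    then show False using assms(1) by (simp add: free_nonunital_def in_keys_iff)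
  qed
  then show ?thesis
    using assms by (auto simp: free_nonunital_def in_keys_iff)
qed


lemma a_r_coset_free: "I +>\<^bsub>free_algebra X\<^esub> p = (\<lambda>i. i + p) ` I"
  by (auto simp: a_r_coset_def r_coset_def free_algebra_def)

section \<open>The Leavitt path algebra as a quotient\<close>

lemma lpa_gens_simps [simp]:
  "Vertex v \<in> lpa_gens E \<longleftrightarrow> v \<in> verts E"
  "Edge e \<in> lpa_gens E \<longleftrightarrow> e \<in> arcs E"
  "Ghost e \<in> lpa_gens E \<longleftrightarrow> e \<in> arcs E"
  by (auto simp: lpa_gens_def)

lemma lpa_relations_carrier:
  assumes "fin_digraph E"
  shows "(lpa_relations E :: (('v, 'e) lpa_gen, 'k::field) free_poly set) \<subseteq> carrier (free_algebra (lpa_gens E))"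
proof -
  interpret fin_digraph E by fact
  show ?thesis
    unfolding lpa_relations_def
    by (auto simp: regular_def intro!: free_carrier_diff free_carrier_closed free_carrier_sum split: if_splits)
qed

lemma lpa_ideal_ideal:
  "fin_digraph E \<Longrightarrow> ideal (lpa_ideal E) (free_algebra (lpa_gens E))"
  unfolding lpa_ideal_def by (intro ring.genideal_ideal ring_free_algebra lpa_relations_carrier)

lemma lpa_ideal_closed:
  fixes x y a :: "(('v, 'e) lpa_gen, 'k::field) free_poly"
  assumes "fin_digraph E"
  shows "(0 :: (('v, 'e) lpa_gen, 'k) free_poly) \<in> lpa_ideal E"
    and "x \<in> lpa_ideal E \<Longrightarrow> y \<in> lpa_ideal E \<Longrightarrow> x + y \<in> lpa_ideal E"
    and "x \<in> lpa_ideal E \<Longrightarrow> a \<in> carrier (free_algebra (lpa_gens E)) \<Longrightarrow> a * x \<in> lpa_ideal E"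
    and "x \<in> lpa_ideal E \<Longrightarrow> a \<in> carrier (free_algebra (lpa_gens E)) \<Longrightarrow> x * a \<in> lpa_ideal E"
  using additive_subgroup.zero_closed[OF ideal.axioms(1)[OF lpa_ideal_ideal[OF assms]]]
    additive_subgroup.a_closed[OF ideal.axioms(1)[OF lpa_ideal_ideal[OF assms]]]
    ideal.I_l_closed[OF lpa_ideal_ideal[OF assms]] ideal.I_r_closed[OF lpa_ideal_ideal[OF assms]]
  by auto

text \<open>
  This is a two-sided ideal of the whole type, hence a congruence for all free polynomials; on
  polynomials in the generators of \<open>E\<close> it agrees with \<open>lpa_ideal E\<close>.
\<close>

definition full_ideal :: "('v, 'e) pre_digraph \<Rightarrow> (('v, 'e) lpa_gen, 'k::field) free_poly set" where
  "full_ideal E = {p. letter_proj (lpa_gens E) p \<in> lpa_ideal E}"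

lemma letter_proj_mult: "letter_proj X (p * q) = letter_proj X p * letter_proj X q"
  and letter_proj_add: "letter_proj X (p + q) = letter_proj X p + letter_proj X q"
  by (simp_all add: letter_proj_def poly.ev_mult poly.ev_add)

lemma leavitt_mod_free:
  assumes "fin_digraph E"
  shows "leavitt_mod E (Poly_Mapping.single 0 :: 'k::field \<Rightarrow> (('v, 'e) lpa_gen, 'k) free_poly)
     (\<lambda>v. gen (Vertex v)) (\<lambda>e. gen (Edge e)) (\<lambda>e. gen (Ghost e)) (full_ideal E)"
proof -
  interpret fin_digraph E by fact
  let ?R = "free_algebra (lpa_gens E) :: (('v, 'e) lpa_gen, 'k) free_poly ring"
  let ?J = "full_ideal E :: (('v, 'e) lpa_gen, 'k) free_poly set"
  interpret R: ring ?R by (rule ring_free_algebra)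
  note closed = lpa_ideal_closed[OF assms]
  have rel: "r \<in> full_ideal E" if "r \<in> lpa_relations E" for r :: "(('v, 'e) lpa_gen, 'k) free_poly"
    using R.genideal_self[OF lpa_relations_carrier[OF assms]] lpa_relations_carrier[OF assms] that
    by (auto simp: full_ideal_def lpa_ideal_def letter_proj_id subset_iff)
  show ?thesis
  proof
    show "0 \<in> ?J"
      using closed by (simp add: full_ideal_def letter_proj_def)
    show "x + y \<in> ?J" if "x \<in> ?J" "y \<in> ?J" for x y :: "(('v, 'e) lpa_gen, 'k) free_poly"
      using closed that by (simp add: full_ideal_def letter_proj_add)
    show "a * x \<in> ?J" "x * a \<in> ?J" if "x \<in> ?J" for a x :: "(('v, 'e) lpa_gen, 'k) free_poly"
      using closed letter_proj_mem[of "lpa_gens E" a] that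
      by (simp_all add: full_ideal_def letter_proj_mult)
  next
    fix v w assume "v \<in> verts E" "w \<in> verts E"
    then show "gen (Vertex v) * gen (Vertex w) - (if v = w then gen (Vertex w) else 0) \<in> ?J"
      by (intro rel) (unfold lpa_relations_def, blast)
  next
    fix e assume e: "e \<in> arcs E"
    show "gen (Vertex (tail E e)) * gen (Edge e) - gen (Edge e) \<in> ?J"
      "gen (Edge e) * gen (Vertex (head E e)) - gen (Edge e) \<in> ?J"
      "gen (Vertex (head E e)) * gen (Ghost e) - gen (Ghost e) \<in> ?J"
      "gen (Ghost e) * gen (Vertex (tail E e)) - gen (Ghost e) \<in> ?J"
      using e by (intro rel; unfold lpa_relations_def; blast)+
    fix f assume "f \<in> arcs E"
    with e show "gen (Ghost e) * gen (Edge f) - (if e = f then gen (Vertex (head E e)) else 0) \<in> ?J"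
      by (intro rel) (unfold lpa_relations_def, blast)
  next
    fix v assume "regular E v"
    then show "gen (Vertex v) - (\<Sum>e\<in>out_arcs E v. gen (Edge e) * gen (Ghost e)) \<in> ?J"
      by (intro rel) (unfold lpa_relations_def, blast)
  qed
qed

text \<open>
  Polynomials without constant term are combinations of nonempty words, that is, of products of
  generators.
\<close>

lemma free_nonunital_alg:
  fixes E :: "('v, 'e) pre_digraph"
  assumes "fin_digraph E"
  shows "free_nonunital (lpa_gens E) =
    leavitt_mod.alg E (Poly_Mapping.single 0 :: 'k::field \<Rightarrow> (('v, 'e) lpa_gen, 'k) free_poly)
     (\<lambda>v. gen (Vertex v)) (\<lambda>e. gen (Edge e)) (\<lambda>e. gen (Ghost e))" (is "_ = ?A")
proof -
  interpret fr: leavitt_mod E "Poly_Mapping.single 0 :: 'k::field \<Rightarrow> (('v, 'e) lpa_gen, 'k) free_poly"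
     "\<lambda>v. gen (Vertex v)" "\<lambda>e. gen (Edge e)" "\<lambda>e. gen (Ghost e)" "full_ideal E"
    by (rule leavitt_mod_free[OF assms])
  have gen: "gen x \<in> ?A" if "x \<in> lpa_gens E" for x
    using that by (cases x) (auto intro: fr.alg.intros)
  have word: "Poly_Mapping.single w c \<in> ?A" if ws: "set (letters w) \<subseteq> lpa_gens E" "w \<noteq> 0" for w c
  proof -
    obtain x ws where w: "w = Word (x # ws)"
      using ws(2) by (cases w; cases "letters w") (auto simp: zero_word_def)
    have "prod_list (map gen (x # ws)) \<in> ?A" if "set (x # ws) \<subseteq> lpa_gens E" for x ws
      using that
    proof (induction ws arbitrary: x)
      case Nil
      then show ?case using gen by simp
    next
      case (Cons y ws)
      then show ?case using fr.alg.mult[OF gen[of x] Cons.IH[of y]] by simp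
    qed
    from fr.alg.scale[OF this, of x ws c] show ?thesis
      using ws(1) unfolding prod_list_gen by (simp add: w mult_single)
  qed
  show ?thesis
  proof (intro equalityI subsetI)
    fix p :: "(('v, 'e) lpa_gen, 'k) free_poly" assume p: "p \<in> free_nonunital (lpa_gens E)"
    have "(\<Sum>w\<in>Poly_Mapping.keys p. Poly_Mapping.single w (Poly_Mapping.lookup p w)) \<in> ?A"
      using p by (intro fr.alg_sum word) (auto simp: free_nonunital_def free_carrier in_keys_iff)
    then show "p \<in> ?A" by (simp only: poly_sum_single[symmetric])
  next
    fix p :: "(('v, 'e) lpa_gen, 'k) free_poly" assume "p \<in> ?A"
    then show "p \<in> free_nonunital (lpa_gens E)"
    proof induction
      case (add x y)
      then show ?case by (auto simp: free_nonunital_def lookup_add)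
    next
      case (mult x y)
      then show ?case using free_nonunital_mult[of x "lpa_gens E" y] by (simp add: free_nonunital_def)
    next
      case (scale x c)
      then have "scale c x \<in> free_nonunital (lpa_gens E)"
        by (auto simp: free_nonunital_def scale_def map.rep_eq when_def free_carrier in_keys_iff)
      then show ?case by (simp only: scale_eq)
    qed (auto simp: free_nonunital_def gen_def lookup_single when_def zero_word_def free_carrier)
  qed
qed

section \<open>Faithful families generate the Leavitt path algebra\<close>

locale leavitt_family = leavitt_mod E \<kappa> P S T "{0}"
  for E :: "('v, 'e) pre_digraph" and \<kappa> :: "'k::field \<Rightarrow> 'r::ring_1"
  and P :: "'v \<Rightarrow> 'r" and S T :: "'e \<Rightarrow> 'r"
begin

lemma eqv_iff: "eqv x y \<longleftrightarrow> x = y"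
  by (simp add: eqv_def)

end

text \<open>
  Independence of the elements of distinct walks is what injectivity of the induced homomorphism
  comes down to.
\<close>

locale faithful_family = leavitt_family E \<kappa> P S T
  for E :: "('v, 'e) pre_digraph" and \<kappa> :: "'k::field \<Rightarrow> 'r::ring_1"
  and P :: "'v \<Rightarrow> 'r" and S T :: "'e \<Rightarrow> 'r" +
  assumes independent: "finite A \<Longrightarrow> A \<subseteq> walks \<Longrightarrow>
      (\<Sum>\<mu>\<in>A. \<kappa> (c \<mu>) * case_prod pe \<mu>) = 0 \<Longrightarrow> \<mu> \<in> A \<Longrightarrow> c \<mu> = 0"
begin

primrec gen_value :: "('v, 'e) lpa_gen \<Rightarrow> 'r" where
  "gen_value (Vertex v) = P v"
| "gen_value (Edge e) = S e"
| "gen_value (Ghost e) = T e"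

lemma ev_ideal:
  assumes "p \<in> lpa_ideal E"
  shows "ev gen_value p = 0"
proof -
  let ?R = "free_algebra (lpa_gens E) :: (('v, 'e) lpa_gen, 'k) free_poly ring"
  let ?N = "{p \<in> carrier ?R. ev gen_value p = 0}"
  interpret R: ring ?R by (rule ring_free_algebra)
  have "ideal ?N ?R"
  proof (rule idealI)
    show "subgroup ?N (add_monoid ?R)"
    proof (rule R.add.subgroupI)
      fix a assume a: "a \<in> ?N"
      have "\<ominus>\<^bsub>?R\<^esub> a = - a" using a by (intro R.minus_equality) auto
      then show "\<ominus>\<^bsub>?R\<^esub> a \<in> ?N" using a by (auto simp: ev_uminus)
    qed (auto simp: ev_add)
  qed (auto simp: ev_mult ring_free_algebra)
  moreover have "lpa_relations E \<subseteq> ?N"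
  proof
    fix r assume r: "r \<in> (lpa_relations E :: (('v, 'e) lpa_gen, 'k) free_poly set)"
    have "ev gen_value r = 0"
      using r unfolding lpa_relations_def
      using vertex_vertex tail_edge edge_head head_ghost ghost_tail ghost_edge vertex_sum
      by (auto simp: ev_diff ev_mult ev_sum)
    then show "r \<in> ?N"
      using r lpa_relations_carrier[OF fin_digraph_axioms] by blast
  qed
  ultimately have "lpa_ideal E \<subseteq> ?N"
    unfolding lpa_ideal_def by (rule R.genideal_minimal)
  with assms show ?thesis by blast
qed

text \<open>
  For a long walk \<open>q\<close>, the product \<open>p q\<close> is congruent to a combination of walks.  Its value is
  zero with that of \<open>p\<close>, so by independence its coefficients vanish and \<open>p q\<close> is
  congruent to zero.  Summing \<open>p q q\<^sup>*\<close> over complete codes of long walks recovers \<open>p\<close>.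
\<close>

lemma ev_inj:
  assumes "p \<in> free_nonunital (lpa_gens E)" and "ev gen_value p = 0"
  shows "p \<in> lpa_ideal E"
proof -
  interpret fr: leavitt_mod E "Poly_Mapping.single 0 :: 'k::field \<Rightarrow> (('v, 'e) lpa_gen, 'k) free_poly"
     "\<lambda>v. gen (Vertex v)" "\<lambda>e. gen (Edge e)" "\<lambda>e. gen (Ghost e)" "full_ideal E"
    by (rule leavitt_mod_free[OF fin_digraph_axioms])
  let ?C = "carrier (free_algebra (lpa_gens E)) :: (('v, 'e) lpa_gen, 'k) free_poly set"
  have pC: "p \<in> ?C" using assms(1) by (simp add: free_nonunital_def)
  have C: "q \<in> lpa_ideal E" if "q \<in> ?C" "q \<in> full_ideal E" for q
    using that by (simp add: full_ideal_def letter_proj_id)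
  have ev_pe: "ev gen_value (fr.pe v \<alpha>) = pe v \<alpha>" for v \<alpha>
    by (induction \<alpha> arbitrary: v) (simp_all add: ev_mult)
  have pe_C: "fr.pe v \<alpha> \<in> ?C" if "awalk v \<alpha> w" for v w \<alpha>
    using that by (induction \<alpha> arbitrary: v) (auto simp: awalk_simps)
  have palg: "p \<in> fr.alg" using assms(1) free_nonunital_alg[OF fin_digraph_axioms] by blast
  then obtain N where N: "fr.shift_bound N p" using fr.alg_shift_bound by blast
  have "\<forall>v\<in>verts E. \<exists>Q. full_code v Q \<and> Pair v ` Q \<subseteq> long_walks N"
    using long_full_code by blast
  then obtain Q where Q: "\<And>v. v \<in> verts E \<Longrightarrow> full_code v (Q v) \<and> Pair v ` Q v \<subseteq> long_walks N"
    by metis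
  have zero: "p * fr.pe v q \<in> full_ideal E" if vq: "v \<in> verts E" "q \<in> Q v" for v q
  proof -
    have "(v, q) \<in> long_walks (0 + N)" using Q vq by auto
    then have "p * fr.pe v q \<in> poly.vs.span (fr.path_elems walks \<union> full_ideal E)"
      using N unfolding fr.shift_bound_def long_walks_0 by (metis long_walks_0)
    then obtain s j where sj: "p * fr.pe v q = s + j"
      "s \<in> poly.vs.span (fr.path_elems walks)" "j \<in> poly.vs.span (full_ideal E)"
      unfolding poly.vs.span_Un by blast
    from sj(3) have j: "j \<in> full_ideal E"
      by (induction rule: poly.vs.span_induct_alt)
        (auto intro: fr.ideal_zero fr.ideal_add fr.ideal_left)
    from poly.span_image_sum[OF sj(2)] obtain A c where A: "finite A" "A \<subseteq> walks"
      and s: "s = (\<Sum>\<mu>\<in>A. Poly_Mapping.single 0 (c \<mu>) * case_prod fr.pe \<mu>)" by blast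
    have sC: "s \<in> ?C"
      unfolding s using A(2) by (intro free_carrier_sum free_carrier_closed) (auto intro: pe_C)
    obtain w where "awalk v q w" using Q[OF vq(1)] full_code_awalk vq(2) by blast
    then have pqC: "p * fr.pe v q \<in> ?C" using pC pe_C by blast
    have "j = p * fr.pe v q - s" using sj(1) by simp
    then have "j \<in> ?C" using pqC sC by blast
    then have "ev gen_value j = 0" using C[OF _ j] ev_ideal by blast
    then have "ev gen_value s = 0" using arg_cong[OF sj(1), of "ev gen_value"] assms(2) by (simp add: ev_add ev_mult)
    then have "(\<Sum>\<mu>\<in>A. \<kappa> (c \<mu>) * case_prod pe \<mu>) = 0"
      unfolding s by (simp add: ev_sum ev_mult ev_const ev_pe case_prod_beta)
    then have "s = 0"
      unfolding s using independent[OF A] by (intro sum.neutral) auto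
    with sj(1) j show ?thesis by simp
  qed
  have "(\<Sum>v\<in>verts E. \<Sum>q\<in>Q v. p * fr.pe v q * fr.ge v q) \<in> full_ideal E"
    by (intro fr.ideal_sum fr.ideal_right zero)
  moreover have "fr.eqv p (\<Sum>v\<in>verts E. \<Sum>q\<in>Q v. p * fr.pe v q * fr.ge v q)"
    using Q by (intro fr.alg_decompose[OF palg]) auto
  ultimately show ?thesis using C[OF pC] fr.eqv_ideal by blast
qed

lemma ev_image: "ev gen_value ` free_nonunital (lpa_gens E) = alg"
proof -
  interpret fr: leavitt_mod E "Poly_Mapping.single 0 :: 'k::field \<Rightarrow> (('v, 'e) lpa_gen, 'k) free_poly"
     "\<lambda>v. gen (Vertex v)" "\<lambda>e. gen (Edge e)" "\<lambda>e. gen (Ghost e)" "full_ideal E"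
    by (rule leavitt_mod_free[OF fin_digraph_axioms])
  have "ev gen_value p \<in> alg" if "p \<in> fr.alg" for p
    using that by induction (auto simp: ev_add ev_mult ev_const intro: alg.intros)
  moreover have "\<exists>p\<in>fr.alg. ev gen_value p = a" if "a \<in> alg" for a
    using that
  proof induction
    case zero
    show ?case by (rule bexI[of _ 0]) (auto intro: fr.alg.intros)
  next
    case (vertex v)
    then show ?case by (intro bexI[of _ "gen (Vertex v)"]) (auto intro: fr.alg.intros)
  next
    case (edge e)
    then show ?case by (intro bexI[of _ "gen (Edge e)"]) (auto intro: fr.alg.intros)
  next
    case (ghost e)
    then show ?case by (intro bexI[of _ "gen (Ghost e)"]) (auto intro: fr.alg.intros)
  next
    case (add x y)
    then obtain p q where "p \<in> fr.alg" "q \<in> fr.alg" "ev gen_value p = x" "ev gen_value q = y" by blast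
    then show ?case by (intro bexI[of _ "p + q"]) (auto simp: ev_add intro: fr.alg.intros)
  next
    case (mult x y)
    then obtain p q where "p \<in> fr.alg" "q \<in> fr.alg" "ev gen_value p = x" "ev gen_value q = y" by blast
    then show ?case by (intro bexI[of _ "p * q"]) (auto simp: ev_mult intro: fr.alg.intros)
  next
    case (scale x c)
    then obtain p where "p \<in> fr.alg" "ev gen_value p = x" by blast
    then show ?case
      by (intro bexI[of _ "Poly_Mapping.single 0 c * p"]) (auto simp: ev_mult ev_const intro: fr.alg.intros)
  qed
  ultimately show ?thesis
    unfolding free_nonunital_alg[OF fin_digraph_axioms] by blast
qed


text \<open>
  Elements of the Leavitt path algebra are cosets, and all members of a coset have the same value.
\<close>

definition embed :: "(('v, 'e) lpa_gen, 'k) free_poly set \<Rightarrow> 'r" where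
  "embed A = the_elem (ev gen_value ` A)"

abbreviation coset :: "(('v, 'e) lpa_gen, 'k) free_poly \<Rightarrow> (('v, 'e) lpa_gen, 'k) free_poly set" where
  "coset p \<equiv> (\<lambda>i. i + p) ` lpa_ideal E"

lemma embed_coset: "embed (coset p) = ev gen_value p"
proof -
  note closed = lpa_ideal_closed[OF fin_digraph_axioms, where 'k = 'k]
  have "ev gen_value ` coset p = {ev gen_value p}"
    using closed(1) by (auto simp: ev_add ev_ideal image_iff)
  then show ?thesis by (simp add: embed_def)
qed

lemma coset_eqI:
  assumes "p - q \<in> lpa_ideal E" shows "coset p = coset q"
proof -
  note closed = lpa_ideal_closed[OF fin_digraph_axioms, where 'k = 'k]
  have neg: "- r \<in> lpa_ideal E" if "r \<in> lpa_ideal E" for r :: "(('v, 'e) lpa_gen, 'k) free_poly"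
    using closed(3)[OF that, of "- 1"] by auto
  have "coset r \<subseteq> coset s" if "r - s \<in> lpa_ideal E" for r s :: "(('v, 'e) lpa_gen, 'k) free_poly"
  proof
    fix x assume "x \<in> coset r"
    then obtain i where i: "i \<in> lpa_ideal E" "x = i + r" by blast
    have "i + (r - s) \<in> lpa_ideal E" by (rule closed(2)[OF i(1) that])
    moreover have "x = (i + (r - s)) + s" using i by simp
    ultimately show "x \<in> coset s" by blast
  qed
  from this[OF assms] this[of q p] neg[OF assms] show ?thesis by auto
qed

lemma leavitt_carrier: "carrier (leavitt E) = coset ` free_nonunital (lpa_gens E)"
  by (simp add: leavitt_def Let_def a_r_coset_free)

lemma leavitt_one: "\<one>\<^bsub>leavitt E\<^esub> = coset (\<Sum>v\<in>verts E. gen (Vertex v))"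
  by (simp add: leavitt_def Let_def a_r_coset_free)

lemma leavitt_one_closed:
  "\<one>\<^bsub>leavitt E\<^esub> \<in> carrier (leavitt E :: ('k, (('v, 'e) lpa_gen, 'k) free_poly set) module)"
  unfolding leavitt_one leavitt_carrier
proof (rule imageI)
  have "(\<Sum>v\<in>verts E. gen (Vertex v)) \<in> carrier (free_algebra (lpa_gens E))"
    by (intro free_carrier_sum free_carrier_closed) simp
  moreover have "Poly_Mapping.lookup (\<Sum>v\<in>verts E. gen (Vertex v)) 0 = (0 :: 'k)"
    by (simp add: lookup_sum gen_def lookup_single when_def zero_word_def)
  ultimately show "(\<Sum>v\<in>verts E. gen (Vertex v)) \<in> (free_nonunital (lpa_gens E) :: (('v, 'e) lpa_gen, 'k) free_poly set)"
    by (simp add: free_nonunital_def)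
qed

lemma leavitt_zero: "\<zero>\<^bsub>leavitt E\<^esub> = coset 0"
  by (simp add: leavitt_def Let_def)

lemma leavitt_mult:
  assumes "p \<in> carrier (free_algebra (lpa_gens E))" "q \<in> carrier (free_algebra (lpa_gens E))"
  shows "coset p \<otimes>\<^bsub>leavitt E\<^esub> coset q = coset (p * q)"
  using ideal.rcoset_mult_add[OF lpa_ideal_ideal[OF fin_digraph_axioms] assms]
  by (simp add: leavitt_def Let_def a_r_coset_free)

lemma leavitt_add: "coset p \<oplus>\<^bsub>leavitt E\<^esub> coset q = coset (p + q)"
proof -
  note closed = lpa_ideal_closed[OF fin_digraph_axioms, where 'k = 'k]
  have "(\<Union>x\<in>coset p. \<Union>y\<in>coset q. {x + y}) = coset (p + q)"
  proof (intro equalityI subsetI)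
    fix z assume "z \<in> (\<Union>x\<in>coset p. \<Union>y\<in>coset q. {x + y})"
    then obtain i j where ij: "i \<in> lpa_ideal E" "j \<in> lpa_ideal E" "z = (i + p) + (j + q)" by blast
    then have "z = (i + j) + (p + q)" by (simp add: algebra_simps)
    moreover have "i + j \<in> lpa_ideal E" using closed(2)[OF ij(1,2)] .
    ultimately show "z \<in> coset (p + q)" by blast
  next
    fix z assume "z \<in> coset (p + q)"
    then obtain i where i: "i \<in> lpa_ideal E" "z = i + (p + q)" by blast
    then have "z = (i + p) + (0 + q)" by (simp add: algebra_simps)
    moreover have "(0 :: (('v, 'e) lpa_gen, 'k) free_poly) \<in> lpa_ideal E" using closed(1) .
    ultimately show "z \<in> (\<Union>x\<in>coset p. \<Union>y\<in>coset q. {x + y})" using i(1) by blast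
  qed
  then show ?thesis by (simp add: leavitt_def Let_def set_add_def')
qed

lemma leavitt_smult: "c \<odot>\<^bsub>leavitt E\<^esub> coset p = coset (Poly_Mapping.single 0 c * p)"
proof -
  note closed = lpa_ideal_closed[OF fin_digraph_axioms, where 'k = 'k]
  have "coset (Poly_Mapping.single 0 c * q) = coset (Poly_Mapping.single 0 c * p)" if q: "q \<in> coset p" for q
  proof (rule coset_eqI)
    obtain i where i: "i \<in> lpa_ideal E" "q = i + p" using q by blast
    have "Poly_Mapping.single 0 c * i \<in> lpa_ideal E"
      using closed(3)[OF i(1), of "Poly_Mapping.single 0 c"] by simp
    then show "Poly_Mapping.single 0 c * q - Poly_Mapping.single 0 c * p \<in> lpa_ideal E"
      by (simp add: i(2) distrib_left)
  qed
  moreover have "p \<in> coset p" using imageI[OF closed(1), of "\<lambda>i. i + p"] by simp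
  ultimately have UN: "(\<Union>q\<in>coset p. coset (Poly_Mapping.single 0 c * q)) = coset (Poly_Mapping.single 0 c * p)"
  proof (intro UN_constant_eq[of p] ballI)
    show "p \<in> coset p" by fact
    fix q assume "q \<in> coset p"
    then show "coset (Poly_Mapping.single 0 c * q) = coset (Poly_Mapping.single 0 c * p)" by fact
  qed
  show ?thesis unfolding UN[symmetric] by (simp add: leavitt_def Let_def a_r_coset_free scale_eq)
qed

lemma leavitt_cases:
  assumes "x \<in> carrier (leavitt E)"
  obtains p where "p \<in> free_nonunital (lpa_gens E)" "p \<in> carrier (free_algebra (lpa_gens E))" "x = coset p"
  using assms by (auto simp: leavitt_carrier free_nonunital_def)

lemma embed_inj: "inj_on embed (carrier (leavitt E))"
proof (rule inj_onI)
  fix x y assume "x \<in> carrier (leavitt E)" "y \<in> carrier (leavitt E)" and eq: "embed x = embed y"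
  then obtain p q where pq: "p \<in> free_nonunital (lpa_gens E)" "x = coset p"
    "q \<in> free_nonunital (lpa_gens E)" "y = coset q" by (metis leavitt_cases)
  have "p - q \<in> free_nonunital (lpa_gens E)"
    using pq by (auto simp: free_nonunital_def lookup_minus)
  moreover have "ev gen_value (p - q) = 0" using eq pq by (simp add: embed_coset ev_diff)
  ultimately show "x = y" unfolding pq by (intro coset_eqI ev_inj)
qed

lemma embed_image: "embed ` carrier (leavitt E) = alg"
  by (simp add: leavitt_carrier image_image embed_coset ev_image)

lemma embed_one: "embed \<one>\<^bsub>leavitt E\<^esub> = (\<Sum>v\<in>verts E. P v)"
  by (simp add: leavitt_one embed_coset ev_sum)

lemma embed_zero: "embed \<zero>\<^bsub>leavitt E\<^esub> = 0"
  by (simp only: leavitt_zero embed_coset ev_zero)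

lemma embed_mult:
  assumes "x \<in> carrier (leavitt E)" "y \<in> carrier (leavitt E)"
  shows "embed (x \<otimes>\<^bsub>leavitt E\<^esub> y) = embed x * embed y" "x \<otimes>\<^bsub>leavitt E\<^esub> y \<in> carrier (leavitt E)"
proof -
  obtain p q where p: "p \<in> free_nonunital (lpa_gens E)" "p \<in> carrier (free_algebra (lpa_gens E))" "x = coset p"
    and q: "q \<in> free_nonunital (lpa_gens E)" "q \<in> carrier (free_algebra (lpa_gens E))" "y = coset q"
    using assms by (metis leavitt_cases)
  show "embed (x \<otimes>\<^bsub>leavitt E\<^esub> y) = embed x * embed y"
    unfolding p(3) q(3) by (simp only: leavitt_mult[OF p(2) q(2)] embed_coset ev_mult)
  show "x \<otimes>\<^bsub>leavitt E\<^esub> y \<in> carrier (leavitt E)"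
    unfolding p(3) q(3) leavitt_mult[OF p(2) q(2)] leavitt_carrier
    by (intro imageI free_nonunital_mult p q)
qed

lemma embed_add:
  assumes "x \<in> carrier (leavitt E)" "y \<in> carrier (leavitt E)"
  shows "embed (x \<oplus>\<^bsub>leavitt E\<^esub> y) = embed x + embed y" "x \<oplus>\<^bsub>leavitt E\<^esub> y \<in> carrier (leavitt E)"
  using assms by (auto simp: leavitt_add embed_coset ev_add leavitt_carrier free_nonunital_def lookup_add)

lemma embed_smult:
  assumes "x \<in> carrier (leavitt E)"
  shows "embed (c \<odot>\<^bsub>leavitt E\<^esub> x) = \<kappa> c * embed x" "c \<odot>\<^bsub>leavitt E\<^esub> x \<in> carrier (leavitt E)"
proof -
  obtain p where p: "p \<in> free_nonunital (lpa_gens E)" "x = coset p" using assms by (metis leavitt_cases)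
  then have "Poly_Mapping.single 0 c * p \<in> free_nonunital (lpa_gens E)"
    using free_nonunital_mult[of p _ "Poly_Mapping.single 0 c"] by (simp add: poly.scalar_central)
  then show "c \<odot>\<^bsub>leavitt E\<^esub> x \<in> carrier (leavitt E)"
    unfolding p(2) leavitt_smult leavitt_carrier by blast
  show "embed (c \<odot>\<^bsub>leavitt E\<^esub> x) = \<kappa> c * embed x"
    unfolding p(2) leavitt_smult by (simp only: embed_coset ev_mult ev_const)
qed

end

section \<open>Right ideals of the path algebra\<close>

text \<open>
  A walk is read as a numeral: the leading digit, which is not zero, encodes the start vertex and
  the further digits encode the edges.  Numerals of this kind determine their digits, and appending
  the same digits to two of them preserves their order.  This is a monomial order of type \<open>\<omega>\<close>,
  compatible with multiplication on the right.
\<close>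

lemma (in fin_digraph) walk_enumeration:
  "\<exists>enc :: 'a \<times> 'b list \<Rightarrow> nat. inj_on enc walks \<and>
    (\<forall>v \<alpha> w \<beta> q. enc (v, \<alpha>) < enc (w, \<beta>) \<longrightarrow> enc (v, \<alpha> @ q) < enc (w, \<beta> @ q))"
proof -
  obtain dv :: "'a \<Rightarrow> nat" and nv where dv: "inj_on dv (verts G)" "dv ` verts G = {i. i < nv}"
    using finite_imp_inj_to_nat_seg[OF finite_verts] by metis
  obtain de :: "'b \<Rightarrow> nat" and ne where de: "inj_on de (arcs G)" "de ` arcs G = {i. i < ne}"
    using finite_imp_inj_to_nat_seg[OF finite_arcs] by metis
  define b where "b = Suc (nv + ne)"
  \<comment> \<open>The reduction modulo \<open>b\<close> bounds the digits of edges outside the graph.\<close>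
  define step where "step n e = n * b + de e mod b" for n e
  define enc where "enc = (\<lambda>(v, \<alpha>). foldl step (Suc (dv v)) \<alpha>)"
  have snoc: "enc (v, \<alpha> @ [e]) = enc (v, \<alpha>) * b + de e mod b" for v \<alpha> e
    by (simp add: enc_def step_def)
  have nil: "enc (v, []) = Suc (dv v)" for v by (simp add: enc_def)
  have mod_less: "de e mod b < b" for e by (simp add: b_def)
  have pos: "1 \<le> enc (v, \<alpha>)" for v \<alpha>
    by (induction \<alpha> rule: rev_induct) (auto simp: snoc nil b_def)
  have less: "m * b + d < n * b + d" if "m < n" for m n d :: nat
    using mult_less_mono1[OF that, of b] by (simp add: b_def)
  have digit: "m = n \<and> d = d'" if "m * b + d = n * b + d'" "d < b" "d' < b" for m n d d' :: nat
  proof -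
    have "m = (m * b + d) div b" "n = (n * b + d') div b" using that(2,3) by auto
    then have "m = n" using that(1) by simp
    with that(1) show ?thesis by simp
  qed
  have small: "Suc (dv v) < b" if "v \<in> verts G" for v
  proof -
    have "dv v \<in> {i. i < nv}" using that dv(2) by blast
    then show ?thesis by (simp add: b_def)
  qed
  have small_e: "de e mod b = de e" if "e \<in> arcs G" for e
  proof -
    have "de e \<in> {i. i < ne}" using that de(2) by blast
    then show ?thesis by (simp add: b_def)
  qed
  have "\<alpha> = \<beta> \<and> v = w" if "enc (v, \<alpha>) = enc (w, \<beta>)"
    "v \<in> verts G" "w \<in> verts G" "set \<alpha> \<subseteq> arcs G" "set \<beta> \<subseteq> arcs G" for v w \<alpha> \<beta>
    using that
  proof (induction \<alpha> arbitrary: \<beta> rule: rev_induct)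
    case Nil
    show ?case
    proof (cases \<beta> rule: rev_cases)
      case Nil
      with Nil.prems dv(1) show ?thesis by (auto simp: nil dest: inj_onD)
    next
      case (snoc \<beta>' e)
      with Nil.prems \<open>\<And>v \<alpha> e. enc (v, \<alpha> @ [e]) = _\<close> have "Suc (dv v) = enc (w, \<beta>') * b + de e mod b"
        by (simp add: nil)
      moreover have "1 * b \<le> enc (w, \<beta>') * b" using pos[of w \<beta>'] by (intro mult_right_mono) auto
      ultimately show ?thesis using small[OF Nil.prems(2)] by simp
    qed
  next
    case (snoc e \<alpha>)
    show ?case
    proof (cases \<beta> rule: rev_cases)
      case Nil
      with snoc.prems \<open>\<And>v \<alpha> e. enc (v, \<alpha> @ [e]) = _\<close> have "Suc (dv w) = enc (v, \<alpha>) * b + de e mod b"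
        by (simp add: nil)
      moreover have "1 * b \<le> enc (v, \<alpha>) * b" using pos[of v \<alpha>] by (intro mult_right_mono) auto
      ultimately show ?thesis using small[OF snoc.prems(3)] by simp
    next
      case (snoc \<beta>' f)
      with snoc.prems \<open>\<And>v \<alpha> e. enc (v, \<alpha> @ [e]) = _\<close>
      have "enc (v, \<alpha>) * b + de e mod b = enc (w, \<beta>') * b + de f mod b" by simp
      then have "enc (v, \<alpha>) = enc (w, \<beta>')" "de e mod b = de f mod b"
        using digit mod_less by blast+
      with snoc.IH[of \<beta>'] snoc.prems snoc small_e de(1) show ?thesis
        by (auto dest: inj_onD)
    qed
  qed
  then have "inj_on enc walks"
    by (intro inj_onI) (fastforce simp: awalk_def)
  moreover have "enc (v, \<alpha> @ q) < enc (w, \<beta> @ q)" if "enc (v, \<alpha>) < enc (w, \<beta>)" for v \<alpha> w \<beta> q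
    using that
  proof (induction q rule: rev_induct)
    case (snoc e q)
    then show ?case
      using less[of "enc (v, \<alpha> @ q)" "enc (w, \<beta> @ q)"] \<open>\<And>v \<alpha> e. enc (v, \<alpha> @ [e]) = _\<close>
      by (metis append.assoc)
  qed simp
  ultimately show ?thesis by blast
qed

context leavitt_family
begin

lemmas exact_P_P = P_P[unfolded eqv_iff]
lemmas exact_P_pe = P_pe[unfolded eqv_iff]
lemmas exact_pe_P = pe_P[unfolded eqv_iff]
lemmas exact_P_ge = P_ge[unfolded eqv_iff]
lemmas exact_ge_P = ge_P[unfolded eqv_iff]
lemmas exact_pe_append = pe_append[unfolded eqv_iff]
lemmas exact_ge_append = ge_append[unfolded eqv_iff]
lemmas exact_ge_pe = ge_pe[unfolded eqv_iff]
lemmas exact_pe_P_orth = pe_P_orth[unfolded singleton_iff]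
lemmas exact_P_pe_orth = P_pe_orth[unfolded singleton_iff]
lemmas exact_full_code_orth = full_code_orth[unfolded singleton_iff]
lemmas exact_full_code_sum = full_code_sum[unfolded eqv_iff]
lemmas exact_alg_decompose = alg_decompose[unfolded eqv_iff]

abbreviation path_alg :: "'r set" where
  "path_alg \<equiv> vs.span (path_elems walks)"

lemma exact_pe_pe_orth:
  assumes "awalk v \<alpha> u" "awalk w \<beta> x" "u \<noteq> w"
  shows "pe v \<alpha> * pe w \<beta> = 0"
proof -
  have "pe v \<alpha> * pe w \<beta> = pe v \<alpha> * (P u * pe w \<beta>)"
    using exact_pe_P[OF assms(1)] by (metis mult.assoc)
  also have "P u * pe w \<beta> = 0"
    using assms by (intro exact_P_pe_orth[OF assms(2)]) auto
  finally show ?thesis by simp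
qed

lemma alg_path_multiple:
  assumes "a \<in> alg"
  shows "\<exists>N. \<forall>(v, \<alpha>)\<in>long_walks N. a * pe v \<alpha> \<in> path_alg"
proof -
  obtain N where "shift_bound N a" using alg_shift_bound[OF assms] by blast
  then show ?thesis
    unfolding shift_bound_def by (intro exI[of _ N]) (fastforce simp: long_walks_0[symmetric] dest: spec[of _ 0])
qed

lemma path_alg_subset: "x \<in> path_alg \<Longrightarrow> x \<in> alg"
  by (induction rule: vs.span_induct_alt) (auto intro: alg.intros pe_alg)

lemma path_alg_mult_pe:
  assumes "x \<in> path_alg" "awalk w q u" shows "x * pe w q \<in> path_alg"
  using assms(1)
proof (rule span_mult_right)
  fix y assume "y \<in> path_elems walks"
  then obtain v \<alpha> z where y: "y = pe v \<alpha>" "awalk v \<alpha> z" by auto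
  show "y * pe w q \<in> path_alg"
  proof (cases "z = w")
    case True
    have "pe v (\<alpha> @ q) \<in> path_elems walks" using y(2) assms(2) True by (force intro!: image_eqI[of _ _ "(v, \<alpha> @ q)"])
    moreover have "y * pe w q = pe v (\<alpha> @ q)"
      using exact_pe_append[OF y(2), of q u] assms(2) True y(1) by simp
    ultimately show ?thesis by (simp only: vs.span_base)
  next
    case False
    then show ?thesis using exact_pe_pe_orth[OF y(2) assms(2)] y(1) by (simp add: vs.span_zero)
  qed
qed

end

context faithful_family
begin

definition enc :: "'v \<times> 'e list \<Rightarrow> nat" where
  "enc = (SOME enc. inj_on enc walks \<and>
    (\<forall>v \<alpha> w \<beta> q. enc (v, \<alpha>) < enc (w, \<beta>) \<longrightarrow> enc (v, \<alpha> @ q) < enc (w, \<beta> @ q)))"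

lemma enc_inj: "inj_on enc walks"
  and enc_append_less: "enc (v, \<alpha>) < enc (w, \<beta>) \<Longrightarrow> enc (v, \<alpha> @ q) < enc (w, \<beta> @ q)"
  using someI_ex[OF walk_enumeration] unfolding enc_def by blast+

text \<open>
  The combinations of walks with numbers less than \<open>k\<close>.  A \<open>lead\<close> of \<open>x\<close> is its largest walk.
\<close>

definition below :: "nat \<Rightarrow> 'r set" where
  "below k = vs.span (path_elems {\<mu> \<in> walks. enc \<mu> < k})"

definition lead :: "'r \<Rightarrow> 'v \<times> 'e list \<Rightarrow> bool" where
  "lead x \<mu> \<longleftrightarrow> \<mu> \<in> walks \<and> (\<exists>c. c \<noteq> 0 \<and> x - \<kappa> c * case_prod pe \<mu> \<in> below (enc \<mu>))"

lemma below_mono: "k \<le> l \<Longrightarrow> below k \<subseteq> below l"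
  unfolding below_def by (intro vs.span_mono) auto

lemma below_closed:
  "x \<in> below k \<Longrightarrow> y \<in> below k \<Longrightarrow> x + y \<in> below k"
  "x \<in> below k \<Longrightarrow> y \<in> below k \<Longrightarrow> x - y \<in> below k"
  "x \<in> below k \<Longrightarrow> \<kappa> c * x \<in> below k"
  "0 \<in> below k"
  by (simp_all add: below_def vs.span_add vs.span_diff vs.span_scale vs.span_zero)

lemma below_base: "\<mu> \<in> walks \<Longrightarrow> enc \<mu> < k \<Longrightarrow> case_prod pe \<mu> \<in> below k"
  unfolding below_def by (intro vs.span_base imageI) simp

lemma pe_not_below:
  assumes "\<mu> \<in> walks" shows "case_prod pe \<mu> \<notin> below (enc \<mu>)"
proof
  assume "case_prod pe \<mu> \<in> below (enc \<mu>)"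
  from span_image_sum[OF this[unfolded below_def]] obtain A c where
    A: "finite A" "A \<subseteq> {\<mu>' \<in> walks. enc \<mu>' < enc \<mu>}"
    and eq: "case_prod pe \<mu> = (\<Sum>a\<in>A. \<kappa> (c a) * case_prod pe a)" by blast
  have "\<mu> \<notin> A" using A(2) by auto
  then have "(\<Sum>a\<in>insert \<mu> A. \<kappa> ((c(\<mu> := - 1)) a) * case_prod pe a) = - case_prod pe \<mu> + (\<Sum>a\<in>A. \<kappa> (c a) * case_prod pe a)"
    using A(1) by (simp add: scalar_uminus_one) (rule sum.cong, auto)
  then have "(c(\<mu> := - 1)) \<mu> = 0"
    using A assms eq by (intro independent[of "insert \<mu> A"]) auto
  then show False by simp
qed

lemma path_alg_below: "x \<in> path_alg \<Longrightarrow> \<exists>k. x \<in> below k"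
proof (induction rule: vs.span_induct_alt)
  case base
  show ?case using below_closed(4) by blast
next
  case (step c b y)
  then obtain k \<mu> where k: "y \<in> below k" and \<mu>: "\<mu> \<in> walks" "b = case_prod pe \<mu>" by auto
  have "y \<in> below (max k (Suc (enc \<mu>)))" using k below_mono[of k "max k (Suc (enc \<mu>))"] by auto
  moreover have "b \<in> below (max k (Suc (enc \<mu>)))" unfolding \<mu>(2) by (intro below_base \<mu>) auto
  ultimately have "\<kappa> c * b + y \<in> below (max k (Suc (enc \<mu>)))" by (intro below_closed(1,3))
  then show ?case by blast
qed

lemma below_Suc:
  assumes "x \<in> below (Suc k)"
  shows "x \<in> below k \<or> (\<exists>\<mu>. enc \<mu> = k \<and> lead x \<mu>)"
proof (cases "\<exists>\<mu>\<in>walks. enc \<mu> = k")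
  case True
  then obtain \<mu> where \<mu>: "\<mu> \<in> walks" "enc \<mu> = k" by blast
  have "{\<nu> \<in> walks. enc \<nu> < Suc k} = insert \<mu> {\<nu> \<in> walks. enc \<nu> < k}"
  proof (intro equalityI subsetI)
    fix \<nu> assume "\<nu> \<in> {\<nu> \<in> walks. enc \<nu> < Suc k}"
    then have "\<nu> \<in> walks" "enc \<nu> < k \<or> enc \<nu> = enc \<mu>" using \<mu>(2) by (simp_all add: less_Suc_eq)
    then show "\<nu> \<in> insert \<mu> {\<nu> \<in> walks. enc \<nu> < k}"
      using inj_onD[OF enc_inj _ _ \<mu>(1)] by blast
  qed (use \<mu> in auto)
  then have "x \<in> vs.span (insert (case_prod pe \<mu>) (path_elems {\<nu> \<in> walks. enc \<nu> < k}))"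
    using assms by (simp only: below_def image_insert)
  then obtain c where c: "x - \<kappa> c * case_prod pe \<mu> \<in> below k"
    unfolding vs.span_breakdown_eq below_def by blast
  show ?thesis
  proof (cases "c = 0")
    case True
    with c show ?thesis by (simp add: scalar_zero)
  next
    case False
    with c \<mu> have "lead x \<mu>" by (auto simp: lead_def)
    with \<mu>(2) show ?thesis by blast
  qed
next
  case False
  then have "{\<nu> \<in> walks. enc \<nu> < Suc k} = {\<nu> \<in> walks. enc \<nu> < k}" by (auto simp: less_Suc_eq)
  with assms show ?thesis by (simp add: below_def)
qed

lemma lead_exists:
  assumes "x \<in> path_alg" "x \<noteq> 0" shows "\<exists>\<mu>. lead x \<mu>"
proof -
  have "x \<in> below k \<Longrightarrow> \<exists>\<mu>. lead x \<mu>" for k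
  proof (induction k)
    case 0
    then show ?case using assms(2) by (simp add: below_def)
  next
    case (Suc k)
    then show ?case using below_Suc by blast
  qed
  then show ?thesis using path_alg_below[OF assms(1)] by blast
qed

lemma lead_not_below: "lead x \<mu> \<Longrightarrow> x \<notin> below (enc \<mu>)"
proof
  assume l: "lead x \<mu>" and x: "x \<in> below (enc \<mu>)"
  then obtain c where c: "\<mu> \<in> walks" "c \<noteq> 0" "x - \<kappa> c * case_prod pe \<mu> \<in> below (enc \<mu>)"
    by (auto simp: lead_def)
  have "x - (x - \<kappa> c * case_prod pe \<mu>) \<in> below (enc \<mu>)" by (rule below_closed(2)[OF x c(3)])
  then have b: "\<kappa> (1 / c) * (\<kappa> c * case_prod pe \<mu>) \<in> below (enc \<mu>)" by (intro below_closed(3)[of "\<kappa> c * case_prod pe \<mu>"]) simp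
  have e: "\<kappa> (1 / c) * (\<kappa> c * case_prod pe \<mu>) = case_prod pe \<mu>"
  proof -
    have "\<kappa> (1 / c) * \<kappa> c = 1" unfolding scalar_mult[symmetric] using c(2) by (simp add: scalar_one)
    then show ?thesis by (simp only: mult.assoc[symmetric] mult_1_left)
  qed
  show False using pe_not_below[OF c(1)] b unfolding e by contradiction
qed

lemma lead_below: "lead x \<mu> \<Longrightarrow> x \<in> below (Suc (enc \<mu>))"
proof -
  assume "lead x \<mu>"
  then obtain c where c: "\<mu> \<in> walks" "x - \<kappa> c * case_prod pe \<mu> \<in> below (enc \<mu>)"
    by (auto simp: lead_def)
  have "(x - \<kappa> c * case_prod pe \<mu>) + \<kappa> c * case_prod pe \<mu> \<in> below (Suc (enc \<mu>))"
    using c below_mono[of "enc \<mu>" "Suc (enc \<mu>)"] by (intro below_closed(1,3) below_base) auto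
  then show ?thesis by simp
qed

lemma lead_scale:
  assumes "lead x \<mu>" "d \<noteq> 0" shows "lead (\<kappa> d * x) \<mu>"
proof -
  obtain c where c: "\<mu> \<in> walks" "c \<noteq> 0" "x - \<kappa> c * case_prod pe \<mu> \<in> below (enc \<mu>)"
    using assms(1) by (auto simp: lead_def)
  have "\<kappa> d * x - \<kappa> (d * c) * case_prod pe \<mu> = \<kappa> d * (x - \<kappa> c * case_prod pe \<mu>)"
    by (simp only: scalar_mult right_diff_distrib mult.assoc)
  also have "\<dots> \<in> below (enc \<mu>)" by (rule below_closed(3)[OF c(3)])
  finally show ?thesis
    unfolding lead_def using c(1,2) assms(2) by (intro conjI exI[of _ "d * c"]) simp_all
qed

lemma sum_below: "(\<And>i. i \<in> A \<Longrightarrow> f i \<in> below k) \<Longrightarrow> sum f A \<in> below k"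
  by (induction A rule: infinite_finite_induct) (simp_all add: below_closed)

text \<open>
  The largest of the leading walks occurs in one summand only and cannot cancel.
\<close>

lemma sum_lead_nonzero:
  assumes "finite A" "A \<noteq> {}" "\<And>i. i \<in> A \<Longrightarrow> lead (x i) (\<mu> i)" "inj_on \<mu> A"
  shows "sum x A \<noteq> 0"
proof
  assume zero: "sum x A = 0"
  obtain i where i: "i \<in> A" and max: "\<And>j. j \<in> A \<Longrightarrow> enc (\<mu> j) \<le> enc (\<mu> i)"
  proof -
    have "Max ((\<lambda>j. enc (\<mu> j)) ` A) \<in> (\<lambda>j. enc (\<mu> j)) ` A" using assms(1,2) by (intro Max_in) auto
    then obtain i where i: "i \<in> A" "Max ((\<lambda>j. enc (\<mu> j)) ` A) = enc (\<mu> i)" by blast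
    show ?thesis
    proof (rule that[OF i(1)])
      fix j assume "j \<in> A"
      with assms(1) show "enc (\<mu> j) \<le> enc (\<mu> i)" unfolding i(2)[symmetric] by (intro Max_ge) auto
    qed
  qed
  have "x j \<in> below (enc (\<mu> i))" if j: "j \<in> A - {i}" for j
  proof -
    have "\<mu> j \<in> walks" "\<mu> i \<in> walks" using assms(3) i j by (auto simp: lead_def)
    moreover have "\<mu> j \<noteq> \<mu> i" using inj_onD[OF assms(4)] i j by blast
    ultimately have "enc (\<mu> j) \<noteq> enc (\<mu> i)" by (simp add: inj_on_eq_iff[OF enc_inj])
    then have "Suc (enc (\<mu> j)) \<le> enc (\<mu> i)" using max[of j] j by auto
    with below_mono lead_below[OF assms(3), of j] j show ?thesis by (meson DiffD1 subsetD)
  qed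
  then have "0 - sum x (A - {i}) \<in> below (enc (\<mu> i))"
    using sum_below[of "A - {i}" x "enc (\<mu> i)"] below_closed(2)[OF below_closed(4)] by blast
  moreover have "x i = 0 - sum x (A - {i})"
    using zero sum.remove[OF assms(1) i, of x] by (simp add: eq_neg_iff_add_eq_0)
  ultimately show False using lead_not_below[OF assms(3)[OF i]] by simp
qed

lemma lead_end:
  assumes "lead x (v, \<alpha>)" "x * P w = x" "w \<in> verts E"
  shows "awalk v \<alpha> w"
proof (rule ccontr)
  assume nw: "\<not> awalk v \<alpha> w"
  obtain c u where c: "awalk v \<alpha> u" "x - \<kappa> c * pe v \<alpha> \<in> below (enc (v, \<alpha>))"
    using assms(1) by (auto simp: lead_def)
  have "(x - \<kappa> c * pe v \<alpha>) * P w \<in> below (enc (v, \<alpha>))"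
    using c(2) unfolding below_def
  proof (rule span_mult_right)
    fix y assume y: "y \<in> path_elems {\<mu> \<in> walks. enc \<mu> < enc (v, \<alpha>)}"
    then obtain v' \<beta> z where "y = pe v' \<beta>" "awalk v' \<beta> z" by auto
    then have "y * P w = y \<or> y * P w = 0"
      using exact_pe_P[of v' \<beta> z] exact_pe_P_orth[of v' \<beta> z w] assms(3) by metis
    then show "y * P w \<in> vs.span (path_elems {\<mu> \<in> walks. enc \<mu> < enc (v, \<alpha>)})"
      using vs.span_base[OF y] vs.span_zero by (elim disjE) (simp_all only:)
  qed
  moreover have "pe v \<alpha> * P w = 0"
    using nw c(1) by (intro exact_pe_P_orth[OF c(1)] assms(3)) auto
  then have "(x - \<kappa> c * pe v \<alpha>) * P w = x" by (simp add: assms(2) left_diff_distrib mult.assoc)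
  ultimately show False using lead_not_below[OF assms(1)] by simp
qed

text \<open>
  If \<open>x\<close> is concentrated on walks that end in \<open>w\<close>, none of them is lost when \<open>q\<close> is appended, and
  their order is preserved.
\<close>

lemma lead_mult:
  assumes "lead x (v, \<alpha>)" "x * P w = x" "awalk w q u"
  shows "lead (x * pe w q) (v, \<alpha> @ q)"
proof -
  have w: "awalk v \<alpha> w" using lead_end[OF assms(1,2)] assms(3) by auto
  obtain c where c: "c \<noteq> 0" "x - \<kappa> c * pe v \<alpha> \<in> below (enc (v, \<alpha>))"
    using assms(1) by (auto simp: lead_def)
  have "(x - \<kappa> c * pe v \<alpha>) * pe w q \<in> below (enc (v, \<alpha> @ q))"
    using c(2) unfolding below_def
  proof (rule span_mult_right)
    fix y assume "y \<in> path_elems {\<mu> \<in> walks. enc \<mu> < enc (v, \<alpha>)}"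
    then obtain v' \<beta> z where y: "y = pe v' \<beta>" "awalk v' \<beta> z" "enc (v', \<beta>) < enc (v, \<alpha>)" by auto
    show "y * pe w q \<in> vs.span (path_elems {\<mu> \<in> walks. enc \<mu> < enc (v, \<alpha> @ q)})"
    proof (cases "z = w")
      case True
      have "(v', \<beta> @ q) \<in> {\<mu> \<in> walks. enc \<mu> < enc (v, \<alpha> @ q)}"
        using y(2,3) assms(3) True by (auto intro: enc_append_less)
      then have "pe v' (\<beta> @ q) \<in> path_elems {\<mu> \<in> walks. enc \<mu> < enc (v, \<alpha> @ q)}"
        by (metis (no_types, lifting) image_eqI case_prod_conv)
      moreover have "y * pe w q = pe v' (\<beta> @ q)"
        using exact_pe_append[OF y(2), of q u] assms(3) True y(1) by simp
      ultimately show ?thesis by (simp only: vs.span_base)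
    next
      case False
      then show ?thesis using exact_pe_pe_orth[OF y(2) assms(3)] y(1) by (simp add: vs.span_zero)
    qed
  qed
  moreover have "(x - \<kappa> c * pe v \<alpha>) * pe w q = x * pe w q - \<kappa> c * pe v (\<alpha> @ q)"
    using exact_pe_append[OF w assms(3)] by (simp add: left_diff_distrib mult.assoc)
  moreover have "(v, \<alpha> @ q) \<in> walks" using w assms(3) by auto
  ultimately show ?thesis using c(1) by (auto simp: lead_def)
qed

definition rank :: "'r \<Rightarrow> nat" where
  "rank x = (LEAST k. x \<in> below k)"

lemma rank_le: "x \<in> below k \<Longrightarrow> rank x \<le> k"
  unfolding rank_def by (rule Least_le)

lemma lead_rank:
  assumes "lead x \<mu>" shows "enc \<mu> < rank x"
proof (rule ccontr)
  assume "\<not> enc \<mu> < rank x"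
  moreover have "x \<in> below (rank x)"
    unfolding rank_def using lead_below[OF assms] by (rule LeastI)
  ultimately have "x \<in> below (enc \<mu>)" using below_mono[of "rank x" "enc \<mu>"] by auto
  with lead_not_below[OF assms] show False by simp
qed

end

section \<open>Splitting idempotents\<close>

context faithful_family
begin

text \<open>
  The \<open>n i\<close> lie in the path algebra, end in \<open>w i\<close>, and generate the right ideal \<open>e alg\<close>: they
  belong to it by \<open>e * n i = n i\<close>, and it is enough to reach \<open>e\<close> itself.
\<close>

definition generates :: "'r \<Rightarrow> 'i set \<Rightarrow> ('i \<Rightarrow> 'v) \<Rightarrow> ('i \<Rightarrow> 'r) \<Rightarrow> bool" where
  "generates e I w n \<longleftrightarrow> finite I \<and>
     (\<forall>i\<in>I. w i \<in> verts E \<and> n i \<in> path_alg \<and> n i * P (w i) = n i \<and> e * n i = n i) \<and>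
     (\<exists>b. (\<forall>i\<in>I. b i \<in> alg) \<and> e = (\<Sum>i\<in>I. n i * b i))"

text \<open>
  The generators are the products \<open>e q\<close> with the walks \<open>q\<close> of a complete code that are long enough
  for \<open>e q\<close> to lie in the path algebra.
\<close>

lemma ex_generates:
  assumes e: "e \<in> alg" "e * e = e"
  shows "\<exists>(I :: ('v \<times> 'e list) set) w n. generates e I w n"
proof -
  obtain N where N: "\<And>v \<alpha>. (v, \<alpha>) \<in> long_walks N \<Longrightarrow> e * pe v \<alpha> \<in> path_alg"
    using alg_path_multiple[OF e(1)] by blast
  have "\<forall>v\<in>verts E. \<exists>Q. full_code v Q \<and> Pair v ` Q \<subseteq> long_walks N"
    using long_full_code by blast
  then obtain Q where Q: "\<And>v. v \<in> verts E \<Longrightarrow> full_code v (Q v)"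
    "\<And>v. v \<in> verts E \<Longrightarrow> Pair v ` Q v \<subseteq> long_walks N"
    by metis
  let ?I = "SIGMA v:verts E. Q v"
  let ?w = "\<lambda>(v, q). awlast v q"
  let ?n = "\<lambda>(v, q). e * pe v q"
  have walk: "awalk v q (awlast v q)" if "v \<in> verts E" "q \<in> Q v" for v q
    using full_code_awalk[OF Q(1)[OF that(1)] that(2)] by (auto elim: awalkE)
  have "finite ?I" using Q(1) full_code_finite by (intro finite_SigmaI) auto
  moreover have "?w i \<in> verts E \<and> ?n i \<in> path_alg \<and> ?n i * P (?w i) = ?n i \<and> e * ?n i = ?n i"
    if mem: "i \<in> ?I" for i
  proof -
    obtain v q where i: "i = (v, q)" "v \<in> verts E" "q \<in> Q v" using mem by auto
    have "e * pe v q \<in> path_alg" using N Q(2)[OF i(2)] i(3) by blast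
    moreover have "awlast v q \<in> verts E" using walk[OF i(2,3)] by auto
    ultimately show ?thesis
      using exact_pe_P[OF walk[OF i(2,3)]] e(2) by (simp add: i(1) mult.assoc) (simp flip: mult.assoc)
  qed
  moreover have "e = (\<Sum>i\<in>?I. ?n i * (case i of (v, q) \<Rightarrow> ge v q))"
  proof -
    have "e = (\<Sum>v\<in>verts E. \<Sum>q\<in>Q v. e * pe v q * ge v q)"
      using exact_alg_decompose[OF e(1), of Q] Q(1) by blast
    also have "\<dots> = (\<Sum>(v, q)\<in>?I. e * pe v q * ge v q)"
      using Q(1) full_code_finite by (intro sum.Sigma) auto
    finally show ?thesis by (simp add: case_prod_beta)
  qed
  moreover have "(case i of (v, q) \<Rightarrow> ge v q) \<in> alg" if "i \<in> ?I" for i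
    using that ge_alg[OF walk] by (cases i) auto
  ultimately have "generates e ?I ?w ?n"
    unfolding generates_def by (intro conjI ballI exI[of _ "\<lambda>(v, q). ge v q"]) simp_all
  then show ?thesis by blast
qed

lemma generates_remove_zero:
  assumes "generates e I w n" "i \<in> I" "n i = 0"
  shows "generates e (I - {i}) w n"
proof -
  obtain b where b: "\<forall>i\<in>I. b i \<in> alg" "e = (\<Sum>i\<in>I. n i * b i)" and fin: "finite I"
    using assms(1) by (auto simp: generates_def)
  have "e = (\<Sum>i\<in>I - {i}. n i * b i)"
    using b(2) sum.remove[OF fin assms(2), of "\<lambda>i. n i * b i"] assms(3) by simp
  with b(1) assms(1) show ?thesis
    unfolding generates_def by (intro conjI exI[of _ b]) auto
qed

lemma generates_reduce:
  assumes gen: "generates e I w n" and ij: "i \<in> I" "j \<in> I" "i \<noteq> j"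
    and q: "awalk (w i) q (w j)"
  shows "generates e I w (n(j := n j - \<kappa> c * (n i * pe (w i) q)))"
proof -
  obtain b where b: "\<forall>i\<in>I. b i \<in> alg" "e = (\<Sum>i\<in>I. n i * b i)" and fin: "finite I"
    using gen by (auto simp: generates_def)
  have I: "w k \<in> verts E" "n k \<in> path_alg" "n k * P (w k) = n k" "e * n k = n k" if "k \<in> I" for k
    using gen that by (auto simp: generates_def)
  define m where "m = n j - \<kappa> c * (n i * pe (w i) q)"
  define d where "d = b i + \<kappa> c * (pe (w i) q * b j)"
  have m: "m \<in> path_alg"
    unfolding m_def using I[OF ij(1)] I[OF ij(2)] path_alg_mult_pe[OF _ q]
    by (intro vs.span_diff vs.span_scale)
  have m_P: "m * P (w j) = m"
    using I(3)[OF ij(2)] exact_pe_P[OF q] by (simp add: m_def left_diff_distrib mult.assoc)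
  have e_m: "e * m = m"
  proof -
    have "e * (\<kappa> c * (n i * pe (w i) q)) = \<kappa> c * (e * n i * pe (w i) q)"
      by (simp only: mult_scalar_left mult.assoc)
    then show ?thesis using I(4)[OF ij(1)] I(4)[OF ij(2)] by (simp add: m_def right_diff_distrib)
  qed
  have d: "d \<in> alg"
    unfolding d_def using b(1) ij pe_alg[OF q] by (intro alg.add alg.scale alg.mult) auto
  have split: "(\<Sum>k\<in>I. f k) = f j + (f i + (\<Sum>k\<in>I - {i, j}. f k))" for f :: "_ \<Rightarrow> 'r"
  proof -
    have "(\<Sum>k\<in>I. f k) = f j + (\<Sum>k\<in>I - {j}. f k)" using fin ij by (intro sum.remove)
    also have "(\<Sum>k\<in>I - {j}. f k) = f i + (\<Sum>k\<in>I - {j} - {i}. f k)" using fin ij by (intro sum.remove) auto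
    also have "I - {j} - {i} = I - {i, j}" by auto
    finally show ?thesis .
  qed
  have "m * b j + n i * d = n j * b j + n i * b i"
  proof -
    have "\<kappa> c * (n i * pe (w i) q) * b j = n i * (\<kappa> c * (pe (w i) q * b j))"
      by (simp only: mult_scalar_left mult.assoc)
    then show ?thesis by (simp add: m_def d_def left_diff_distrib distrib_left)
  qed
  then have "e = (\<Sum>k\<in>I. (n(j := m)) k * (b(i := d)) k)"
    unfolding b(2) split[of "\<lambda>k. n k * b k"] split[of "\<lambda>k. (n(j := m)) k * (b(i := d)) k"]
    using ij(3) by (simp flip: add.assoc)
  moreover have "\<forall>k\<in>I. (b(i := d)) k \<in> alg" using b(1) d by simp
  ultimately show ?thesis
    unfolding generates_def m_def[symmetric] using fin I m m_P e_m
    by (intro conjI ballI exI[of _ "b(i := d)"]) auto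
qed

text \<open>
  Among all generating families, one that minimises the number of its members plus the sum of their
  ranks is reduced: a zero generator could be dropped, and if the leading walk of one generator is a
  prefix of that of another, subtracting a multiple of the first from the second lowers the
  rank of the second.
\<close>

lemma ex_reduced_generators:
  fixes I0 :: "'i set"
  assumes "generates e I0 w n0"
  shows "\<exists>I n. generates e I w n \<and> (\<forall>i\<in>I. n i \<noteq> 0) \<and>
    (\<forall>i\<in>I. \<forall>j\<in>I. \<forall>v \<alpha> q. lead (n i) (v, \<alpha>) \<longrightarrow> lead (n j) (v, \<alpha> @ q) \<longrightarrow> i = j)"
proof -
  define size where "size = (\<lambda>(I :: 'i set, n). \<Sum>i\<in>I. Suc (rank (n i)))"
  obtain I n where gen: "generates e I w n"
    and min: "\<And>I' n'. generates e I' w n' \<Longrightarrow> size (I, n) \<le> size (I', n')"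
    using ex_has_least_nat[of "\<lambda>(I, n). generates e I w n" "(I0, n0)" size] assms by auto
  have fin: "finite I" using gen by (auto simp: generates_def)
  have I: "w k \<in> verts E" "n k \<in> path_alg" "n k * P (w k) = n k" if "k \<in> I" for k
    using gen that by (auto simp: generates_def)
  have "n i \<noteq> 0" if i: "i \<in> I" for i
  proof
    assume "n i = 0"
    then have "size (I, n) \<le> size (I - {i}, n)" by (intro min generates_remove_zero gen i)
    then show False using sum.remove[OF fin i, of "\<lambda>i. Suc (rank (n i))"] by (simp add: size_def)
  qed
  moreover have "i = j" if ij: "i \<in> I" "j \<in> I" and li: "lead (n i) (v, \<alpha>)" and lj: "lead (n j) (v, \<alpha> @ q)"
    for i j v \<alpha> q
  proof (rule ccontr)
    assume ne: "i \<noteq> j"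
    have "awalk v \<alpha> (w i)" by (rule lead_end[OF li I(3)[OF ij(1)] I(1)[OF ij(1)]])
    moreover have "awalk v (\<alpha> @ q) (w j)" by (rule lead_end[OF lj I(3)[OF ij(2)] I(1)[OF ij(2)]])
    ultimately have q: "awalk (w i) q (w j)" by (auto simp: awalk_append_iff elim!: awalkE)
    have liq: "lead (n i * pe (w i) q) (v, \<alpha> @ q)" by (rule lead_mult[OF li I(3)[OF ij(1)] q])
    let ?p = "pe v (\<alpha> @ q)" and ?k = "enc (v, \<alpha> @ q)"
    obtain c d where c: "c \<noteq> 0" "n i * pe (w i) q - \<kappa> c * ?p \<in> below ?k"
      and d: "n j - \<kappa> d * ?p \<in> below ?k"
      using liq lj by (auto simp: lead_def)
    let ?m = "n j - \<kappa> (d / c) * (n i * pe (w i) q)"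
    have "\<kappa> (d / c) * (\<kappa> c * ?p) = \<kappa> d * ?p"
      using c(1) by (simp only: mult.assoc[symmetric] scalar_mult[symmetric]) simp
    then have "?m = (n j - \<kappa> d * ?p) - \<kappa> (d / c) * (n i * pe (w i) q - \<kappa> c * ?p)"
      by (simp only: right_diff_distrib) simp
    then have "?m \<in> below ?k" using c(2) d below_closed(2,3) by metis
    then have less: "rank ?m < rank (n j)" using rank_le lead_rank[OF lj] by (metis le_less_trans)
    have "size (I, n) \<le> size (I, n(j := ?m))" by (intro min generates_reduce gen ij ne q)
    moreover have "size (I, n(j := ?m)) < size (I, n)"
    proof -
      have "(\<Sum>k\<in>I - {j}. Suc (rank ((n(j := ?m)) k))) = (\<Sum>k\<in>I - {j}. Suc (rank (n k)))"
        by (intro sum.cong) auto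
      then show ?thesis
        using sum.remove[OF fin ij(2), of "\<lambda>k. Suc (rank (n k))"]
          sum.remove[OF fin ij(2), of "\<lambda>k. Suc (rank ((n(j := ?m)) k))"] less
        by (simp add: size_def)
    qed
    ultimately show False by simp
  qed
  ultimately show ?thesis using gen by blast
qed

lemma path_alg_at:
  assumes "s \<in> path_alg" "P w * s = s" "w \<in> verts E"
  shows "s \<in> vs.span (pe w ` {\<alpha>. \<exists>u. awalk w \<alpha> u})"
proof -
  have "P w * s \<in> vs.span (pe w ` {\<alpha>. \<exists>u. awalk w \<alpha> u})"
    using assms(1)
  proof (rule span_mult_left)
    fix y assume "y \<in> path_elems walks"
    then obtain v \<beta> z where y: "y = pe v \<beta>" "awalk v \<beta> z" by auto
    show "P w * y \<in> vs.span (pe w ` {\<alpha>. \<exists>u. awalk w \<alpha> u})"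
    proof (cases "v = w")
      case True
      then show ?thesis using exact_P_pe[OF y(2)] y by (auto intro!: vs.span_base)
    next
      case False
      then show ?thesis using exact_P_pe_orth[OF y(2) assms(3)] y(1) by (simp add: vs.span_zero)
    qed
  qed
  then show ?thesis by (simp add: assms(2))
qed

text \<open>
  Expand every \<open>s i\<close> into walks \<open>a\<close>.  The products \<open>n i a\<close> have as leading walks those of the
  \<open>n i\<close> followed by \<open>a\<close>, and these are distinct because no leading walk is a prefix of another.
\<close>

lemma reduced_path_independent:
  assumes fin: "finite I" and I: "\<And>i. i \<in> I \<Longrightarrow> w i \<in> verts E \<and> n i \<in> path_alg \<and> n i * P (w i) = n i \<and> n i \<noteq> 0"
    and red: "\<And>i j v \<alpha> q. i \<in> I \<Longrightarrow> j \<in> I \<Longrightarrow> lead (n i) (v, \<alpha>) \<Longrightarrow> lead (n j) (v, \<alpha> @ q) \<Longrightarrow> i = j"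
    and s: "\<And>i. i \<in> I \<Longrightarrow> s i \<in> path_alg \<and> P (w i) * s i = s i"
    and zero: "(\<Sum>i\<in>I. n i * s i) = 0" and i: "i \<in> I"
  shows "s i = 0"
proof -
  have "\<forall>i\<in>I. \<exists>A c. finite A \<and> A \<subseteq> {\<alpha>. \<exists>u. awalk (w i) \<alpha> u} \<and> (\<forall>a\<in>A. c a \<noteq> 0) \<and>
      s i = (\<Sum>a\<in>A. \<kappa> (c a) * pe (w i) a)"
  proof
    fix i assume "i \<in> I"
    then have "s i \<in> vs.span (pe (w i) ` {\<alpha>. \<exists>u. awalk (w i) \<alpha> u})" using s I path_alg_at by blast
    then show "\<exists>A c. finite A \<and> A \<subseteq> {\<alpha>. \<exists>u. awalk (w i) \<alpha> u} \<and> (\<forall>a\<in>A. c a \<noteq> 0) \<and>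
      s i = (\<Sum>a\<in>A. \<kappa> (c a) * pe (w i) a)" by (rule span_image_sum)
  qed
  then obtain A c where Ac: "\<forall>i\<in>I. finite (A i) \<and> A i \<subseteq> {\<alpha>. \<exists>u. awalk (w i) \<alpha> u} \<and>
      (\<forall>a\<in>A i. c i a \<noteq> 0) \<and> s i = (\<Sum>a\<in>A i. \<kappa> (c i a) * pe (w i) a)"
    unfolding bchoice_iff by blast
  have A: "\<And>i. i \<in> I \<Longrightarrow> finite (A i)"
    "\<And>i a. i \<in> I \<Longrightarrow> a \<in> A i \<Longrightarrow> (\<exists>u. awalk (w i) a u) \<and> c i a \<noteq> 0"
    "\<And>i. i \<in> I \<Longrightarrow> s i = (\<Sum>a\<in>A i. \<kappa> (c i a) * pe (w i) a)"
    using Ac by blast+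
  have "\<forall>i\<in>I. \<exists>\<mu>. lead (n i) \<mu>" using lead_exists I by blast
  then obtain \<mu> where \<mu>: "\<And>i. i \<in> I \<Longrightarrow> lead (n i) (\<mu> i)" by metis
  let ?X = "SIGMA i:I. A i"
  let ?x = "\<lambda>(i, a). \<kappa> (c i a) * (n i * pe (w i) a)"
  let ?\<nu> = "\<lambda>(i, a). (fst (\<mu> i), snd (\<mu> i) @ a)"
  have finX: "finite ?X" using fin A(1) by (intro finite_SigmaI)
  have "(\<Sum>i\<in>I. n i * s i) = (\<Sum>i\<in>I. \<Sum>a\<in>A i. \<kappa> (c i a) * (n i * pe (w i) a))"
    by (intro sum.cong refl) (simp only: A(3) sum_distrib_left mult_scalar_left)
  also have "\<dots> = sum ?x ?X" using fin A(1) by (intro sum.Sigma) auto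
  finally have "sum ?x ?X = 0" using zero by simp
  moreover have "lead (?x p) (?\<nu> p)" if p: "p \<in> ?X" for p
  proof -
    obtain i a where ia: "p = (i, a)" "i \<in> I" "a \<in> A i" using p by auto
    obtain u where "awalk (w i) a u" using A(2)[OF ia(2,3)] by blast
    then have "lead (n i * pe (w i) a) (fst (\<mu> i), snd (\<mu> i) @ a)"
      using lead_mult[of "n i" "fst (\<mu> i)" "snd (\<mu> i)" "w i" a u] \<mu>[OF ia(2)] I[OF ia(2)] by simp
    then show ?thesis using lead_scale A(2)[OF ia(2,3)] by (simp add: ia(1))
  qed
  moreover have "inj_on ?\<nu> ?X"
  proof (rule inj_onI)
    fix p p' assume p: "p \<in> ?X" "p' \<in> ?X" and eq: "?\<nu> p = ?\<nu> p'"
    obtain i a j a' where ij: "p = (i, a)" "p' = (j, a')" "i \<in> I" "j \<in> I" using p by auto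
    have eqs: "fst (\<mu> i) = fst (\<mu> j)" "snd (\<mu> i) @ a = snd (\<mu> j) @ a'" using eq ij by auto
    have li: "lead (n i) (fst (\<mu> i), snd (\<mu> i))" using \<mu>[OF ij(3)] by simp
    have lj: "lead (n j) (fst (\<mu> i), snd (\<mu> j))" unfolding eqs(1) using \<mu>[OF ij(4)] by simp
    consider us where "snd (\<mu> i) = snd (\<mu> j) @ us" | us where "snd (\<mu> j) = snd (\<mu> i) @ us"
      using eqs(2) unfolding append_eq_append_conv2 by metis
    then have "i = j"
    proof cases
      case 1
      show ?thesis using red[OF ij(4,3) lj li[unfolded 1]] by simp
    next
      case 2
      show ?thesis by (rule red[OF ij(3,4) li lj[unfolded 2]])
    qed
    with eqs(2) show "p = p'" by (simp add: ij)
  qed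
  ultimately have "?X = {}" using sum_lead_nonzero[OF finX, of ?x ?\<nu>] by blast
  then have "A i = {}" using i by auto
  then show ?thesis using A(3)[OF i] by simp
qed

text \<open>
  Multiplying on the right by long walks leads back to coefficients in the path algebra.
\<close>

lemma reduced_alg_independent:
  assumes fin: "finite I" and I: "\<And>i. i \<in> I \<Longrightarrow> w i \<in> verts E \<and> n i \<in> path_alg \<and> n i * P (w i) = n i \<and> n i \<noteq> 0"
    and red: "\<And>i j v \<alpha> q. i \<in> I \<Longrightarrow> j \<in> I \<Longrightarrow> lead (n i) (v, \<alpha>) \<Longrightarrow> lead (n j) (v, \<alpha> @ q) \<Longrightarrow> i = j"
    and b: "\<And>i. i \<in> I \<Longrightarrow> b i \<in> alg \<and> P (w i) * b i = b i"
    and zero: "(\<Sum>i\<in>I. n i * b i) = 0" and i: "i \<in> I"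
  shows "b i = 0"
proof -
  have "\<forall>i\<in>I. \<exists>N. \<forall>(v, \<alpha>)\<in>long_walks N. b i * pe v \<alpha> \<in> path_alg"
    using alg_path_multiple b by blast
  then obtain N where N: "\<forall>i\<in>I. \<forall>(v, \<alpha>)\<in>long_walks (N i). b i * pe v \<alpha> \<in> path_alg"
    unfolding bchoice_iff by blast
  \<comment> \<open>one length that is sufficient for all \<open>b i\<close>\<close>
  define M where "M = Max (N ` I)"
  have M: "b j * pe v \<alpha> \<in> path_alg" if "j \<in> I" "(v, \<alpha>) \<in> long_walks M" for j v \<alpha>
  proof -
    have "N j \<le> M" unfolding M_def using fin that(1) by (intro Max_ge) auto
    then show ?thesis using bspec[OF N that(1)] subsetD[OF long_walks_mono that(2)] by blast
  qed
  have "\<forall>v\<in>verts E. \<exists>Q. full_code v Q \<and> Pair v ` Q \<subseteq> long_walks M"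
    using long_full_code by blast
  then obtain Q where Q: "\<And>v. v \<in> verts E \<Longrightarrow> full_code v (Q v)"
    "\<And>v. v \<in> verts E \<Longrightarrow> Pair v ` Q v \<subseteq> long_walks M"
    by metis
  have "b i * pe v q = 0" if v: "v \<in> verts E" and q: "q \<in> Q v" for v q
  proof (rule reduced_path_independent[OF fin I red])
    fix j assume j: "j \<in> I"
    show "b j * pe v q \<in> path_alg \<and> P (w j) * (b j * pe v q) = b j * pe v q"
      using M[OF j] Q(2)[OF v] q b[OF j] by (simp add: image_subset_iff flip: mult.assoc)
  next
    show "(\<Sum>i\<in>I. n i * (b i * pe v q)) = 0"
      using zero by (simp flip: mult.assoc sum_distrib_right)
  qed (use i in auto)
  moreover have "b i = (\<Sum>v\<in>verts E. \<Sum>q\<in>Q v. b i * pe v q * ge v q)"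
    using exact_alg_decompose[of "b i" Q] b[OF i] Q(1) by blast
  ultimately show ?thesis by simp
qed

end

context leavitt_family
begin

text \<open>
  The right ideal \<open>e alg\<close> is the direct sum of copies of the \<open>P (w i) alg\<close>: multiplication on
  the left by \<open>n i\<close> is the inclusion of the summand \<open>i\<close>, and by \<open>m i\<close> the projection to it.
\<close>

definition splits :: "'r \<Rightarrow> 'i set \<Rightarrow> ('i \<Rightarrow> 'v) \<Rightarrow> ('i \<Rightarrow> 'r) \<Rightarrow> ('i \<Rightarrow> 'r) \<Rightarrow> bool" where
  "splits e I w n m \<longleftrightarrow> finite I \<and>
     (\<forall>i\<in>I. w i \<in> verts E \<and> n i \<in> alg \<and> m i \<in> alg \<and> n i * P (w i) = n i \<and> P (w i) * m i = m i) \<and>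
     (\<forall>i\<in>I. \<forall>j\<in>I. m i * n j = (if i = j then P (w i) else 0)) \<and>
     e = (\<Sum>i\<in>I. n i * m i)"

end

text \<open>
  Idempotence of \<open>e\<close> gives \<open>n j = e n j = \<Sum> n i (m i n j)\<close>, and by independence the coefficients
  \<open>m i n j\<close> agree with those of the trivial representation of \<open>n j\<close>.
\<close>

theorem (in faithful_family) idempotent_splits:
  assumes e: "e \<in> alg" "e * e = e"
  shows "\<exists>(I :: ('v \<times> 'e list) set) w n m. splits e I w n m"
proof -
  obtain I0 :: "('v \<times> 'e list) set" and w n0 where "generates e I0 w n0"
    using ex_generates[OF e] by blast
  from ex_reduced_generators[OF this] obtain I n where gen: "generates e I w n"
    and nz': "\<forall>i\<in>I. n i \<noteq> 0"
    and red': "\<forall>i\<in>I. \<forall>j\<in>I. \<forall>v \<alpha> q. lead (n i) (v, \<alpha>) \<longrightarrow> lead (n j) (v, \<alpha> @ q) \<longrightarrow> i = j"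
    by (elim exE conjE)
  have nz: "n i \<noteq> 0" if "i \<in> I" for i using nz' that by blast
  have red: "i = j" if "i \<in> I" "j \<in> I" "lead (n i) (v, \<alpha>)" "lead (n j) (v, \<alpha> @ q)" for i j v \<alpha> q
    using red' that by blast
  obtain b where b: "\<And>i. i \<in> I \<Longrightarrow> b i \<in> alg" "e = (\<Sum>i\<in>I. n i * b i)" and fin: "finite I"
    using gen by (auto simp: generates_def)
  have I: "w k \<in> verts E" "n k \<in> path_alg" "n k * P (w k) = n k" "e * n k = n k" if "k \<in> I" for k
    using gen that by (auto simp: generates_def)
  define m where "m i = P (w i) * b i * e" for i
  have m: "m i \<in> alg" "P (w i) * m i = m i" if "i \<in> I" for i
  proof -
    show "m i \<in> alg" unfolding m_def by (intro alg.mult alg.vertex I(1) b(1) that e(1))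
    show "P (w i) * m i = m i"
      unfolding m_def using exact_P_P[OF I(1)[OF that]] by (simp flip: mult.assoc)
  qed
  have e_sum: "e = (\<Sum>i\<in>I. n i * m i)"
  proof -
    have "(\<Sum>i\<in>I. n i * m i) = (\<Sum>i\<in>I. n i * b i * e)"
      by (intro sum.cong refl) (simp add: m_def I(3) flip: mult.assoc)
    also have "\<dots> = e" using b(2) e(2) by (simp flip: sum_distrib_right)
    finally show ?thesis by simp
  qed
  have mn: "m i * n j = (if i = j then P (w i) else 0)" if "i \<in> I" and j: "j \<in> I" for i j
  proof -
    let ?d = "\<lambda>i. m i * n j - (if i = j then P (w j) else 0)"
    have "?d i = 0"
    proof (rule reduced_alg_independent[OF fin _ red, where b = ?d])
      show "w k \<in> verts E \<and> n k \<in> path_alg \<and> n k * P (w k) = n k \<and> n k \<noteq> 0" if "k \<in> I" for k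
        using I nz that by simp
      fix k assume k: "k \<in> I"
      have "(if k = j then P (w j) else 0) \<in> alg"
        using I(1)[OF j] by (simp add: alg.vertex alg.zero)
      then have "\<kappa> (- 1) * (if k = j then P (w j) else 0) \<in> alg" by (rule alg.scale)
      from alg.add[OF alg.mult[OF m(1)[OF k] path_alg_subset[OF I(2)[OF j]]] this]
      have "?d k \<in> alg" by (simp add: scalar_uminus_one)
      moreover have "P (w k) * ?d k = ?d k"
        using m(2)[OF k] exact_P_P[OF I(1)[OF j]] by (simp add: right_diff_distrib flip: mult.assoc)
      ultimately show "?d k \<in> alg \<and> P (w k) * ?d k = ?d k" by blast
    next
      have "(\<Sum>i\<in>I. n i * (m i * n j)) = e * n j"
        by (simp add: e_sum sum_distrib_right mult.assoc)
      also have "\<dots> = n j" by (rule I(4)[OF j])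
      also have "n j = (\<Sum>i\<in>I. n i * (if i = j then P (w j) else 0))"
        using fin j I(3)[OF j] by (simp add: if_distrib cong: if_cong)
      finally show "(\<Sum>i\<in>I. n i * ?d i) = 0" by (simp add: right_diff_distrib sum_subtractf)
    qed (use that in auto)
    then show ?thesis by auto
  qed
  have "splits e I w n m"
    unfolding splits_def using fin I m path_alg_subset e_sum mn by auto
  then show ?thesis by blast
qed

section \<open>Walks leaving a set of vertices\<close>

context fin_digraph
begin

text \<open>
  A walk whose vertices lie in \<open>D\<close> with the exception of the last one.
\<close>

primrec exits :: "'a set \<Rightarrow> 'a \<Rightarrow> 'b list \<Rightarrow> bool" where
  "exits D v [] \<longleftrightarrow> v \<in> verts G \<and> v \<notin> D"
| "exits D v (e # p) \<longleftrightarrow> v \<in> D \<and> e \<in> out_arcs G v \<and> exits D (head G e) p"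

text \<open>
  The nonempty walks from \<open>u\<close> whose inner vertices lie in \<open>D\<close> and whose end point does not; for
  \<open>u\<close> outside \<open>D\<close> they are the first returns to the complement of \<open>D\<close>.
\<close>

definition returns :: "'a set \<Rightarrow> 'a \<Rightarrow> 'b list set" where
  "returns D u = (\<Union>e\<in>out_arcs G u. (#) e ` {p. exits D (head G e) p})"

text \<open>
  Oriented against the edges, so that well-foundedness says that every walk inside \<open>D\<close> stops.
\<close>

definition inner_steps :: "'a set \<Rightarrow> ('a \<times> 'a) set" where
  "inner_steps D = {(head G e, tail G e) | e. e \<in> arcs G \<and> tail G e \<in> D \<and> head G e \<in> D}"

text \<open>
  No infinite walk stays in \<open>D\<close> and no sink lies in it, so the walks leaving \<open>D\<close> form complete
  codes.
\<close>

definition transient :: "'a set \<Rightarrow> bool" where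
  "transient D \<longleftrightarrow> D \<subseteq> verts G \<and> (\<forall>v\<in>D. out_arcs G v \<noteq> {}) \<and> wf (inner_steps D)"

lemma exits_awalk: "exits D v p \<Longrightarrow> awalk v p (awlast v p) \<and> awlast v p \<notin> D"
  by (induction p arbitrary: v) (auto simp: awalk_Nil_iff awalk_Cons_iff)

lemma exits_full_code:
  assumes D: "transient D" and v: "v \<in> verts G"
  shows "full_code v {p. exits D v p}"
proof -
  have wfD: "wf (inner_steps D)" using D by (simp add: transient_def)
  have out: "{p. exits D v p} = {[]}" if "v \<notin> D" "v \<in> verts G" for v
  proof -
    have "exits D v p \<longleftrightarrow> p = []" for p using that by (cases p) auto
    then show ?thesis by simp
  qed
  have "v \<in> D \<Longrightarrow> full_code v {p. exits D v p}" for v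
    using wfD
  proof (induction v rule: wf_induct_rule)
    case (less v)
    have "{p. exits D v p} = (\<Union>e\<in>out_arcs G v. (#) e ` {p. exits D (head G e) p})" (is "?L = ?R")
    proof (intro equalityI subsetI)
      fix p assume p: "p \<in> ?L"
      then obtain e q where q: "p = e # q" using less(2) by (cases p) auto
      then have "e \<in> out_arcs G v" "exits D (head G e) q" using p by simp_all
      then show "p \<in> ?R" unfolding q by blast
    qed (use less(2) in auto)
    moreover have "full_code v ?R"
    proof (rule full_code.branch)
      show "regular G v" using D less(2) by (auto simp: regular_def transient_def)
      fix e assume e: "e \<in> out_arcs G v"
      show "full_code (head G e) {p. exits D (head G e) p}"
      proof (cases "head G e \<in> D")
        case True
        then have "(head G e, v) \<in> inner_steps D" using e less(2) by (auto simp: inner_steps_def)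
        then show ?thesis using less(1) True by blast
      next
        case False
        moreover have "head G e \<in> verts G" using e by auto
        ultimately show ?thesis using out full_code.trivial by simp
      qed
    qed
    ultimately show ?case by simp
  qed
  then show ?thesis using out[OF _ v] full_code.trivial[OF v] by (cases "v \<in> D") simp_all
qed

lemma returns_full_code: "transient D \<Longrightarrow> regular G u \<Longrightarrow> full_code u (returns D u)"
  unfolding returns_def by (intro full_code.branch exits_full_code) auto

lemma returns_awalk:
  assumes "q \<in> returns D u"
  shows "awalk u q (awlast u q)" "awlast u q \<notin> D" "q \<noteq> []"
proof -
  obtain e p where "e \<in> out_arcs G u" "exits D (head G e) p" "q = e # p"
    using assms by (auto simp: returns_def)
  then show "awalk u q (awlast u q)" "awlast u q \<notin> D" "q \<noteq> []"
    using exits_awalk[of D "head G e" p] by (auto simp: awalk_Cons_iff)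
qed

lemma exits_prefix: "awalk v p w \<Longrightarrow> w \<notin> D \<Longrightarrow> \<exists>q r. p = q @ r \<and> exits D v q"
proof (induction p arbitrary: v)
  case Nil
  then show ?case by (intro exI[of _ "[]"]) (auto simp: awalk_Nil_iff)
next
  case (Cons e p)
  show ?case
  proof (cases "v \<in> D")
    case True
    obtain q r where "p = q @ r" "exits D (head G e) q"
      using Cons.IH[of "head G e"] Cons.prems by (auto simp: awalk_Cons_iff)
    then show ?thesis
      using True Cons.prems by (intro exI[of _ "e # q"] exI[of _ r]) (auto simp: awalk_Cons_iff)
  next
    case False
    moreover have "v \<in> verts G" using Cons.prems(1) by (rule awalk_hd_in_verts)
    ultimately show ?thesis using False by (intro exI[of _ "[]"] exI[of _ "e # p"]) simp
  qed
qed

lemma returns_prefix: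
  assumes "awalk u p w" "w \<notin> D" "p \<noteq> []"
  shows "\<exists>q r. p = q @ r \<and> q \<in> returns D u"
proof -
  obtain e p' where p: "p = e # p'" using assms(3) by (cases p) auto
  have e: "e \<in> out_arcs G u" "awalk (head G e) p' w" using assms(1) by (auto simp: p awalk_Cons_iff)
  obtain q r where "p' = q @ r" "exits D (head G e) q"
    using exits_prefix[OF e(2) assms(2)] by blast
  with e(1) show ?thesis
    unfolding p returns_def by (intro exI[of _ "e # q"] exI[of _ r]) auto
qed

text \<open>
  A cycle in the enlarged set would have to pass through \<open>u\<close> and then contain a return from \<open>u\<close> to
  itself.  In terms of accessibility: vertices of \<open>D\<close> from which \<open>u\<close> is not the exit of any walk
  are accessible by induction, hence so is \<open>u\<close>, and hence so are all vertices of \<open>D\<close>.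
\<close>

lemma transient_insert:
  assumes D: "transient D" and u: "u \<notin> D" "regular G u"
    and no_return: "\<And>q. q \<in> returns D u \<Longrightarrow> awlast u q \<noteq> u"
  shows "transient (insert u D)"
proof -
  have wfD: "wf (inner_steps D)" using D by (simp add: transient_def)
  let ?R = "inner_steps (insert u D)"
  have uG: "u \<in> verts G" using u(2) by (simp add: regular_def)
  have step: "\<exists>e\<in>out_arcs G x. y = head G e \<and> (y = u \<or> y \<in> D)" if "(y, x) \<in> ?R" for x y
    using that by (auto simp: inner_steps_def)
  have away: "d \<in> D \<Longrightarrow> (\<And>q. exits D d q \<Longrightarrow> awlast d q \<noteq> u) \<Longrightarrow> d \<in> Wellfounded.acc ?R" for d
    using wfD
  proof (induction d rule: wf_induct_rule)
    case (less d)
    show ?case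
    proof (rule acc.accI)
      fix y assume "(y, d) \<in> ?R"
      then obtain e where e: "e \<in> out_arcs G d" "y = head G e" "y = u \<or> y \<in> D" using step by blast
      have "y \<noteq> u" using less(3)[of "[e]"] less(2) e(1,2) u(1) uG by auto
      with e have y: "y \<in> D" by simp
      moreover have "(y, d) \<in> inner_steps D" using e y less(2) by (auto simp: inner_steps_def)
      moreover have "awlast y q \<noteq> u" if "exits D y q" for q
        using less(3)[of "e # q"] that less(2) e(1,2) by simp
      ultimately show "y \<in> Wellfounded.acc ?R" using less(1) by blast
    qed
  qed
  have acc_u: "u \<in> Wellfounded.acc ?R"
  proof (rule acc.accI)
    fix y assume "(y, u) \<in> ?R"
    then obtain e where e: "e \<in> out_arcs G u" "y = head G e" "y = u \<or> y \<in> D" using step by blast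
    have ret: "e # q \<in> returns D u" if "exits D y q" for q
      using that e(1,2) by (auto simp: returns_def)
    have "y \<noteq> u" using no_return[OF ret[of "[]"]] u(1) uG e(2) by auto
    with e have "y \<in> D" by simp
    moreover have "awlast y q \<noteq> u" if "exits D y q" for q
      using no_return[OF ret[OF that]] e(2) by simp
    ultimately show "y \<in> Wellfounded.acc ?R" using away by blast
  qed
  have acc_D: "d \<in> D \<Longrightarrow> d \<in> Wellfounded.acc ?R" for d
    using wfD
  proof (induction d rule: wf_induct_rule)
    case (less d)
    show ?case
    proof (rule acc.accI)
      fix y assume "(y, d) \<in> ?R"
      then obtain e where e: "e \<in> out_arcs G d" "y = head G e" "y = u \<or> y \<in> D" using step by blast
      show "y \<in> Wellfounded.acc ?R"
      proof (cases "y = u")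
        case True
        then show ?thesis using acc_u by simp
      next
        case False
        with e have y: "y \<in> D" by simp
        moreover have "(y, d) \<in> inner_steps D" using e y less(2) by (auto simp: inner_steps_def)
        ultimately show ?thesis using less(1) by blast
      qed
    qed
  qed
  have "x \<in> Wellfounded.acc ?R" for x
  proof (cases "x \<in> insert u D")
    case True
    then show ?thesis using acc_u acc_D by blast
  next
    case False
    show ?thesis
    proof (rule acc.accI)
      fix y assume "(y, x) \<in> ?R"
      then show "y \<in> Wellfounded.acc ?R" using False by (auto simp: inner_steps_def)
    qed
  qed
  then have "wf ?R" by (simp add: wf_iff_acc)
  then show ?thesis using D u(2) by (auto simp: transient_def regular_def)
qed

end

section \<open>Refining a splitting\<close>

context leavitt_family
begin

lemma splits_reindex:
  assumes s: "splits e I w n m" and f: "bij_betw f I' I"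
  shows "splits e I' (w \<circ> f) (n \<circ> f) (m \<circ> f)"
proof -
  have f_mem: "f i \<in> I" if "i \<in> I'" for i using that f by (auto simp: bij_betw_def)
  have f_eq: "f i = f j \<longleftrightarrow> i = j" if "i \<in> I'" "j \<in> I'" for i j
    using that f by (auto simp: bij_betw_def inj_on_eq_iff)
  have "finite I'" using s bij_betw_finite[OF f] by (simp add: splits_def)
  moreover have "e = (\<Sum>i\<in>I'. (n \<circ> f) i * (m \<circ> f) i)"
    using s sum.reindex_bij_betw[OF f, of "\<lambda>i. n i * m i"] by (simp add: splits_def)
  ultimately show ?thesis
    using s f_mem f_eq unfolding splits_def by simp
qed

text \<open>
  A complete code splits a vertex module further: \<open>P (w x)\<close> is the sum of the \<open>q q\<^sup>*\<close>, which
  are equivalent to the end points of the \<open>q\<close>.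
\<close>

lemma splits_expand:
  fixes I :: "nat set"
  assumes s: "splits e I w n m" and x: "x \<in> I" and Q: "full_code (w x) Q"
  shows "\<exists>(I' :: nat set) w' n' m'. splits e I' w' n' m' \<and> w' ` I' = w ` (I - {x}) \<union> awlast (w x) ` Q"
proof -
  have I: "w i \<in> verts E" "n i \<in> alg" "m i \<in> alg" "n i * P (w i) = n i" "P (w i) * m i = m i" if "i \<in> I" for i
    using s that by (auto simp: splits_def)
  have mn: "m i * n j = (if i = j then P (w i) else 0)" if "i \<in> I" "j \<in> I" for i j
    using s that by (auto simp: splits_def)
  have fin: "finite I" and e: "e = (\<Sum>i\<in>I. n i * m i)" using s by (auto simp: splits_def)
  have walk: "awalk (w x) q (awlast (w x) q)" if "q \<in> Q" for q
    using full_code_awalk[OF Q that] by (auto elim: awalkE)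
  have finQ: "finite Q" by (rule full_code_finite[OF Q])
  define J where "J = (I - {x}) <+> Q"
  define w1 where "w1 = case_sum w (awlast (w x))"
  define n1 where "n1 = case_sum n (\<lambda>q. n x * pe (w x) q)"
  define m1 where "m1 = case_sum m (\<lambda>q. ge (w x) q * m x)"
  note defs = J_def w1_def n1_def m1_def
  have "splits e J w1 n1 m1"
    unfolding splits_def
  proof (intro conjI ballI)
    show "finite J" using fin finQ by (simp add: J_def)
  next
    fix i assume "i \<in> J"
    then consider k where "i = Inl k" "k \<in> I" | q where "i = Inr q" "q \<in> Q" by (auto simp: J_def)
    then have "w1 i \<in> verts E \<and> n1 i \<in> alg \<and> m1 i \<in> alg \<and> n1 i * P (w1 i) = n1 i \<and> P (w1 i) * m1 i = m1 i"
    proof cases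
      case 1
      then show ?thesis using I by (simp add: defs)
    next
      case 2
      have "awlast (w x) q \<in> verts E" using walk[OF 2(2)] by (rule awalk_last_in_verts)
      then show ?thesis
        using exact_pe_P[OF walk[OF 2(2)]] exact_P_ge[OF walk[OF 2(2)]] I(2,3)[OF x]
          alg.mult pe_alg[OF walk[OF 2(2)]] ge_alg[OF walk[OF 2(2)]]
        by (simp add: defs 2(1) mult.assoc) (simp flip: mult.assoc)
    qed
    then show "w1 i \<in> verts E" "n1 i \<in> alg" "m1 i \<in> alg" "n1 i * P (w1 i) = n1 i" "P (w1 i) * m1 i = m1 i"
      by blast+
  next
    fix i j assume "i \<in> J" "j \<in> J"
    then have "(\<exists>k\<in>I. i = Inl k \<and> k \<noteq> x) \<or> (\<exists>q\<in>Q. i = Inr q)" "(\<exists>k\<in>I. j = Inl k \<and> k \<noteq> x) \<or> (\<exists>q\<in>Q. j = Inr q)"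
      by (auto simp: J_def)
    then consider k l where "i = Inl k" "j = Inl l" "k \<in> I" "l \<in> I"
      | k q where "i = Inl k" "j = Inr q" "k \<in> I" "k \<noteq> x" "q \<in> Q"
      | p l where "i = Inr p" "j = Inl l" "p \<in> Q" "l \<in> I" "l \<noteq> x"
      | p q where "i = Inr p" "j = Inr q" "p \<in> Q" "q \<in> Q"
      by blast
    then show "m1 i * n1 j = (if i = j then P (w1 i) else 0)"
    proof cases
      case 1
      then show ?thesis using mn by (simp add: defs)
    next
      case 2
      have "m k * (n x * pe (w x) q) = m k * n x * pe (w x) q" by (simp only: mult.assoc)
      then show ?thesis using 2 mn[OF 2(3) x] by (simp add: defs)
    next
      case 3
      then show ?thesis using mn[OF x 3(4)] by (simp add: defs mult.assoc)
    next
      case 4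
      have "ge (w x) p * m x * (n x * pe (w x) q) = ge (w x) p * (m x * n x) * pe (w x) q"
        by (simp only: mult.assoc)
      also have "\<dots> = ge (w x) p * pe (w x) q"
        using mn[OF x x] exact_ge_P[OF walk[OF 4(3)]] by simp
      also have "\<dots> = (if p = q then P (awlast (w x) p) else 0)"
        using exact_ge_pe[OF walk[OF 4(3)]] exact_full_code_orth[OF Q 4(3,4)] by (cases "p = q") simp_all
      finally show ?thesis by (simp add: defs 4(1,2))
    qed
  next
    have "(\<Sum>i\<in>J. n1 i * m1 i) = (\<Sum>i\<in>I - {x}. n i * m i) + (\<Sum>q\<in>Q. n x * pe (w x) q * (ge (w x) q * m x))"
      unfolding defs using fin finQ by (subst sum.Plus) (simp_all add: comp_def)
    also have "(\<Sum>q\<in>Q. n x * pe (w x) q * (ge (w x) q * m x)) = n x * (\<Sum>q\<in>Q. pe (w x) q * ge (w x) q) * m x"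
      by (simp only: sum_distrib_left sum_distrib_right mult.assoc)
    also have "\<dots> = n x * m x"
      using exact_full_code_sum[OF Q] I(4)[OF x] by simp
    also have "(\<Sum>i\<in>I - {x}. n i * m i) + n x * m x = e"
      unfolding e using sum.remove[OF fin x, of "\<lambda>i. n i * m i"] by (simp add: add.commute)
    finally show "e = (\<Sum>i\<in>J. n1 i * m1 i)" by simp
  qed
  moreover obtain h where h: "bij_betw h {0..<card J} J"
    using ex_bij_betw_nat_finite[of J] fin finQ by (auto simp: J_def)
  ultimately have "splits e {0..<card J} (w1 \<circ> h) (n1 \<circ> h) (m1 \<circ> h)" by (rule splits_reindex)
  moreover have "(w1 \<circ> h) ` {0..<card J} = w1 ` J" using h by (simp add: bij_betw_def flip: image_image image_comp)
  moreover have "w1 ` J = w ` (I - {x}) \<union> awlast (w x) ` Q"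
    by (auto simp: J_def w1_def Plus_def image_Un image_image)
  ultimately show ?thesis by metis
qed

text \<open>
  Choose \<open>D\<close> as large as possible and then \<open>w ` I\<close> as large as possible.  If some return from
  \<open>u = w x\<close> ended outside \<open>w ` I\<close>, expand \<open>x\<close> by all returns from \<open>u\<close>.  The new end point then
  belongs to the set of vertices of the new splitting.  Either \<open>u\<close> still belongs to it, and that
  set has grown, or no return from \<open>u\<close> ends in \<open>u\<close>, and \<open>u\<close> can be added to \<open>D\<close>.
\<close>

lemma ex_returning_splitting:
  fixes I0 :: "nat set"
  assumes "splits e I0 w0 n0 m0"
  shows "\<exists>D (I :: nat set) w n m. transient D \<and> splits e I w n m \<and>
    (\<forall>u\<in>w ` I. \<forall>q\<in>returns D u. awlast u q \<in> w ` I)"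
proof -
  define ok where "ok = (\<lambda>(D, I :: nat set, w, n, m). transient D \<and> splits e I w n m \<and> w ` I \<inter> D = {})"
  \<comment> \<open>\<open>N\<close> exceeds the size of every set of vertices, so \<open>f\<close> orders by \<open>D\<close> first.\<close>
  define N where "N = Suc (card (verts E))"
  define f where "f = (\<lambda>(D :: 'v set, I :: nat set, w :: nat \<Rightarrow> 'v, n :: nat \<Rightarrow> 'r, m :: nat \<Rightarrow> 'r). card D * N + card (w ` I))"
  have card_W: "card (w ` I) < N" and card_D: "card D < N" if "ok (D, I, w, n, m)" for D I w n m
  proof -
    have "w ` I \<subseteq> verts E" "D \<subseteq> verts E" using that by (auto simp: ok_def splits_def transient_def)
    then show "card (w ` I) < N" "card D < N"
      unfolding N_def by (auto intro: card_mono simp: less_Suc_eq_le)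
  qed
  have bound: "f t < N * N" if "ok t" for t
  proof -
    obtain D I w n m where t: "t = (D, I, w, n, m)" by (cases t) auto
    have "f t < card D * N + N" using card_W that by (simp add: f_def t)
    also have "\<dots> = Suc (card D) * N" by simp
    also have "\<dots> \<le> N * N" using card_D that t by (intro mult_right_mono) (auto simp: Suc_le_eq)
    finally show ?thesis .
  qed
  have "ok ({}, I0, w0, n0, m0)"
    using assms by (simp add: ok_def transient_def inner_steps_def)
  then obtain t where t: "ok t" and max: "\<And>t'. ok t' \<Longrightarrow> f t' \<le> f t"
    using ex_has_greatest_nat[of ok _ f "N * N"] bound by blast
  obtain D I w n m where tD: "t = (D, I, w, n, m)" by (cases t) auto
  have D: "transient D" and s: "splits e I w n m" and disj: "w ` I \<inter> D = {}"
    using t by (auto simp: ok_def tD)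
  have finI: "finite I" using s by (simp add: splits_def)
  have "awlast u q \<in> w ` I" if u: "u \<in> w ` I" and q: "q \<in> returns D u" for u q
  proof (rule ccontr)
    assume new: "awlast u q \<notin> w ` I"
    obtain x where x: "x \<in> I" "u = w x" using u by blast
    have "u \<in> verts E" using s x by (auto simp: splits_def)
    then have reg: "regular E u" using q by (auto simp: regular_def returns_def)
    have "full_code (w x) (returns D u)" using returns_full_code[OF D reg] x(2) by simp
    from splits_expand[OF s x(1) this] obtain I' :: "nat set" and w' n' m' where
      s': "splits e I' w' n' m'" and w': "w' ` I' = w ` (I - {x}) \<union> awlast u ` returns D u"
      unfolding x(2)[symmetric] by (elim exE conjE)
    have disj': "w' ` I' \<inter> D = {}" unfolding w' using disj returns_awalk(2) by blast
    have qin: "awlast u q \<in> w' ` I'" unfolding w' using q by blast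
    have sup: "w ` I \<subseteq> insert u (w' ` I')" unfolding w' using x(2) by blast
    have finI': "finite (w' ` I')" using s' by (simp add: splits_def)
    show False
    proof (cases "u \<in> w' ` I'")
      case True
      with sup qin new have "w ` I \<subset> w' ` I'" by auto
      then have "card (w ` I) < card (w' ` I')" using finI' by (rule psubset_card_mono[rotated])
      moreover have "ok (D, I', w', n', m')" using D s' disj' by (simp add: ok_def)
      from max[OF this] have "card (w' ` I') \<le> card (w ` I)" by (simp add: f_def tD)
      ultimately show False by simp
    next
      case False
      have "transient (insert u D)"
      proof (rule transient_insert[OF D _ reg])
        show "u \<notin> D" using disj u by blast
        show "awlast u p \<noteq> u" if "p \<in> returns D u" for p
          using False that unfolding w' by (metis UnI2 imageI)
      qed
      then have ok': "ok (insert u D, I', w', n', m')" using s' disj' False by (simp add: ok_def)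
      have "finite D" using D finite_subset[OF _ finite_verts] by (simp add: transient_def)
      moreover have "u \<notin> D" using disj u by blast
      ultimately have "Suc (card D) * N \<le> f t" using max[OF ok'] by (simp add: f_def)
      moreover have "f t < card D * N + N" using card_W[of D I w n m] t by (simp add: f_def tD)
      ultimately show False by simp
    qed
  qed
  then show ?thesis using D s by blast
qed

end

section \<open>The graph of a corner\<close>

text \<open>
  A splitting whose vertices form a set \<open>W = w ` I\<close> to which all walks from \<open>W\<close> return, with nothing
  but vertices of \<open>D\<close> in between.
\<close>

locale corner_graph = faithful_family E \<kappa> P S T
  for E :: "('v, 'e) pre_digraph" and \<kappa> :: "'k::field \<Rightarrow> 'r::ring_1"
  and P :: "'v \<Rightarrow> 'r" and S T :: "'e \<Rightarrow> 'r" +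
  fixes e :: 'r and D :: "'v set" and I :: "nat set" and w :: "nat \<Rightarrow> 'v" and n m :: "nat \<Rightarrow> 'r"
  assumes transient: "transient D" and splits: "splits e I w n m"
    and returning: "u \<in> w ` I \<Longrightarrow> q \<in> returns D u \<Longrightarrow> awlast u q \<in> w ` I"
begin

lemma fin: "finite I"
  and w_verts: "i \<in> I \<Longrightarrow> w i \<in> verts E"
  and n_alg: "i \<in> I \<Longrightarrow> n i \<in> alg"
  and m_alg: "i \<in> I \<Longrightarrow> m i \<in> alg"
  and n_P: "i \<in> I \<Longrightarrow> n i * P (w i) = n i"
  and P_m: "i \<in> I \<Longrightarrow> P (w i) * m i = m i"
  and m_n: "i \<in> I \<Longrightarrow> j \<in> I \<Longrightarrow> m i * n j = (if i = j then P (w i) else 0)"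
  and e_sum: "e = (\<Sum>i\<in>I. n i * m i)"
  using splits by (simp_all add: splits_def)

text \<open>
  The index chosen to represent the vertex \<open>u\<close>.
\<close>

definition pr :: "'v \<Rightarrow> nat" where
  "pr u = (SOME i. i \<in> I \<and> w i = u)"

lemma pr: assumes "u \<in> w ` I" shows "pr u \<in> I" "w (pr u) = u"
proof -
  have "\<exists>i. i \<in> I \<and> w i = u" using assms by blast
  from someI_ex[OF this] show "pr u \<in> I" "w (pr u) = u" by (simp_all add: pr_def)
qed

text \<open>
  The labels of the edges emitted by \<open>i\<close>.  An index that does not represent its vertex gets the
  empty walk as its only label; it becomes the start of an edge to the representative.
\<close>

definition codes :: "nat \<Rightarrow> 'e list set" where
  "codes i = (if pr (w i) = i then returns D (w i) else {[]})"

lemma code_walk: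
  assumes "i \<in> I" "p \<in> codes i"
  shows "awalk (w i) p (awlast (w i) p)" "awlast (w i) p \<in> w ` I"
proof -
  have "awalk (w i) p (awlast (w i) p) \<and> awlast (w i) p \<in> w ` I"
  proof (cases "pr (w i) = i")
    case True
    then have "p \<in> returns D (w i)" using assms(2) by (simp add: codes_def)
    then show ?thesis using returns_awalk(1) returning assms(1) by blast
  next
    case False
    then have "p = []" using assms(2) by (simp add: codes_def)
    then show ?thesis using assms(1) w_verts by (simp add: awalk_Nil_iff)
  qed
  then show "awalk (w i) p (awlast (w i) p)" "awlast (w i) p \<in> w ` I" by blast+
qed

lemma codes_full:
  assumes "i \<in> I" "codes i \<noteq> {}" shows "full_code (w i) (codes i)"
proof (cases "pr (w i) = i")
  case True
  then have "returns D (w i) \<noteq> {}" using assms(2) by (simp add: codes_def)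
  then have "regular E (w i)" using w_verts[OF assms(1)] by (auto simp: returns_def regular_def)
  then show ?thesis using True returns_full_code[OF transient] by (simp add: codes_def)
next
  case False
  then show ?thesis using w_verts[OF assms(1)] by (simp add: codes_def full_code.trivial)
qed

lemma codes_finite: "i \<in> I \<Longrightarrow> finite (codes i)"
  using codes_full full_code_finite by (cases "codes i = {}") auto

definition arc_labels :: "(nat \<times> 'e list) set" where
  "arc_labels = (SIGMA i:I. codes i)"

text \<open>
  Edges are numbered because the graph has to have natural numbers as edges.
\<close>

definition label :: "nat \<Rightarrow> nat \<times> 'e list" where
  "label = (SOME f. bij_betw f {0..<card arc_labels} arc_labels)"

lemma label_bij: "bij_betw label {0..<card arc_labels} arc_labels"
proof -
  have "finite arc_labels" unfolding arc_labels_def using fin codes_finite by (intro finite_SigmaI)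
  from someI_ex[OF ex_bij_betw_nat_finite[OF this]] show ?thesis by (simp add: label_def)
qed

definition G :: "(nat, nat) pre_digraph" where
  "G = \<lparr>verts = I, arcs = {0..<card arc_labels}, tail = \<lambda>a. fst (label a),
    head = \<lambda>a. pr (awlast (w (fst (label a))) (snd (label a)))\<rparr>"

abbreviation word :: "nat \<Rightarrow> 'e list" where
  "word a \<equiv> snd (label a)"

lemma verts_G [simp]: "verts G = I"
  by (simp add: G_def)

lemma arcs_G: "arcs G = {0..<card arc_labels}"
  by (simp add: G_def)

lemma arc_G:
  assumes "a \<in> arcs G"
  shows "tail G a \<in> I" "word a \<in> codes (tail G a)" "head G a \<in> I"
    "awalk (w (tail G a)) (word a) (w (head G a))" "pr (w (head G a)) = head G a"
    "w (head G a) = awlast (w (tail G a)) (word a)"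
proof -
  have "label a \<in> arc_labels" using assms label_bij by (auto simp: arcs_G bij_betw_def)
  then show 1: "tail G a \<in> I" "word a \<in> codes (tail G a)"
    by (auto simp: arc_labels_def G_def)
  note 2 = code_walk[OF 1]
  have h: "head G a = pr (awlast (w (tail G a)) (word a))" by (simp add: G_def)
  then show "head G a \<in> I" "awalk (w (tail G a)) (word a) (w (head G a))" "pr (w (head G a)) = head G a"
    "w (head G a) = awlast (w (tail G a)) (word a)"
    using pr[OF 2(2)] 2(1) by simp_all
qed

lemma arc_eqI:
  assumes "a \<in> arcs G" "b \<in> arcs G" "tail G a = tail G b" "word a = word b"
  shows "a = b"
proof -
  have "label a = label b" using assms(3,4) by (simp add: G_def prod_eq_iff)
  then show ?thesis
    using assms(1,2) inj_onD[OF bij_betw_imp_inj_on[OF label_bij]] by (simp add: arcs_G)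
qed

lemma ex_arc:
  assumes "i \<in> I" "p \<in> codes i"
  shows "\<exists>a\<in>arcs G. tail G a = i \<and> word a = p"
proof -
  have "(i, p) \<in> label ` {0..<card arc_labels}"
    using assms label_bij by (simp add: bij_betw_def arc_labels_def)
  then obtain a where "a \<in> {0..<card arc_labels}" "label a = (i, p)" by auto
  then show ?thesis by (intro bexI[of _ a]) (simp_all add: G_def)
qed

lemma word_bij: "i \<in> I \<Longrightarrow> bij_betw word (out_arcs G i) (codes i)"
proof (rule bij_betw_imageI)
  show "inj_on word (out_arcs G i)"
    by (rule inj_onI) (auto intro: arc_eqI)
  assume i: "i \<in> I"
  show "word ` out_arcs G i = codes i"
  proof (intro equalityI subsetI)
    fix p assume "p \<in> codes i"
    from ex_arc[OF i this] show "p \<in> word ` out_arcs G i" by auto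
  next
    fix p assume "p \<in> word ` out_arcs G i"
    then show "p \<in> codes i" using arc_G(2) by auto
  qed
qed

lemma fin_digraph_G: "fin_digraph G"
proof
  show "finite (verts G)" using fin by simp
  show "finite (arcs G)" by (simp add: arcs_G)
  show "tail G a \<in> verts G" "head G a \<in> verts G" if "a \<in> arcs G" for a
    using arc_G[OF that] by simp_all
qed

definition GP :: "nat \<Rightarrow> 'r" where "GP i = n i * m i"

definition GS :: "nat \<Rightarrow> 'r" where
  "GS a = n (tail G a) * pe (w (tail G a)) (word a) * m (head G a)"

definition GT :: "nat \<Rightarrow> 'r" where
  "GT a = n (head G a) * ge (w (tail G a)) (word a) * m (tail G a)"

text \<open>
  Multiplication of the matrix entries \<open>n i x m j\<close>.
\<close>

lemma sandwich:
  assumes "j \<in> I" "k \<in> I"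
  shows "(n i * x * m j) * (n k * y * m l) = (if j = k then n i * (x * P (w j) * y) * m l else 0)"
proof -
  have "(n i * x * m j) * (n k * y * m l) = n i * x * (m j * n k) * y * m l" by (simp only: mult.assoc)
  then show ?thesis using m_n[OF assms] by (simp add: mult.assoc)
qed

lemma sandwich_one: "i \<in> I \<Longrightarrow> GP i = n i * P (w i) * m i"
  by (simp add: GP_def n_P)

sublocale corner: leavitt_family G \<kappa> GP GS GT
proof (intro leavitt_family.intro leavitt_mod.intro fin_digraph_G scalars_axioms leavitt_mod_axioms.intro)
  show "GP i * GP j - (if i = j then GP j else 0) \<in> {0}" if "i \<in> verts G" "j \<in> verts G" for i j
    using that sandwich[of i j i "P (w i)" "P (w j)" j] exact_P_P[OF w_verts, of j]
    by (auto simp: sandwich_one)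
next
  fix a assume a: "a \<in> arcs G"
  note A = arc_G[OF a]
  show "GP (tail G a) * GS a - GS a \<in> {0}"
    unfolding sandwich_one[OF A(1)] GS_def sandwich[OF A(1) A(1)]
    by (simp add: exact_P_pe[OF A(4)] exact_P_P[OF w_verts[OF A(1)]])
  show "GS a * GP (head G a) - GS a \<in> {0}"
    unfolding sandwich_one[OF A(3)] GS_def sandwich[OF A(3) A(3)]
    by (simp add: exact_pe_P[OF A(4)])
  show "GP (head G a) * GT a - GT a \<in> {0}"
    unfolding sandwich_one[OF A(3)] GT_def sandwich[OF A(3) A(3)]
    by (simp add: exact_P_P[OF w_verts[OF A(3)]] exact_P_ge[OF A(4)])
  show "GT a * GP (tail G a) - GT a \<in> {0}"
    unfolding sandwich_one[OF A(1)] GT_def sandwich[OF A(1) A(1)]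
    by (simp add: exact_ge_P[OF A(4)])
  fix b assume b: "b \<in> arcs G"
  note B = arc_G[OF b]
  have "GT a * GS b = (if tail G a = tail G b then
      n (head G a) * (ge (w (tail G a)) (word a) * P (w (tail G a)) * pe (w (tail G b)) (word b)) * m (head G b) else 0)"
    unfolding GT_def GS_def by (rule sandwich[OF A(1) B(1)])
  also have "\<dots> = (if a = b then GP (head G a) else 0)"
  proof (cases "tail G a = tail G b")
    case True
    have "ge (w (tail G a)) (word a) * pe (w (tail G a)) (word b) = (if a = b then P (w (head G a)) else 0)"
    proof (cases "a = b")
      case True
      then show ?thesis using exact_ge_pe[OF A(4)] by simp
    next
      case False
      then have "word a \<noteq> word b" using arc_eqI[OF a b] True by auto
      moreover have "full_code (w (tail G a)) (codes (tail G a))" using A(2) by (intro codes_full A) auto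
      moreover have "word b \<in> codes (tail G a)" using B(2) True by simp
      ultimately show ?thesis using exact_full_code_orth A(2) False by simp
    qed
    then show ?thesis using True exact_ge_P[OF A(4)] sandwich_one[OF A(3)] by auto
  qed auto
  finally show "GT a * GS b - (if a = b then GP (head G a) else 0) \<in> {0}" by simp
next
  fix i assume "regular G i"
  then have i: "i \<in> I" "out_arcs G i \<noteq> {}" by (auto simp: regular_def)
  have "codes i \<noteq> {}" using word_bij[OF i(1)] i(2) by (auto simp: bij_betw_def)
  then have full: "full_code (w i) (codes i)" by (rule codes_full[OF i(1)])
  have "(\<Sum>a\<in>out_arcs G i. GS a * GT a) = (\<Sum>a\<in>out_arcs G i. n i * (pe (w i) (word a) * ge (w i) (word a)) * m i)"
  proof (rule sum.cong[OF refl])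
    fix a assume "a \<in> out_arcs G i"
    then have a: "a \<in> arcs G" "tail G a = i" by auto
    note A = arc_G[OF a(1)]
    show "GS a * GT a = n i * (pe (w i) (word a) * ge (w i) (word a)) * m i"
      unfolding GS_def GT_def using sandwich[OF A(3) A(3)] exact_pe_P[OF A(4)] a(2) by simp
  qed
  also have "\<dots> = n i * (\<Sum>a\<in>out_arcs G i. pe (w i) (word a) * ge (w i) (word a)) * m i"
    by (simp only: sum_distrib_left sum_distrib_right)
  also have "(\<Sum>a\<in>out_arcs G i. pe (w i) (word a) * ge (w i) (word a)) = (\<Sum>p\<in>codes i. pe (w i) p * ge (w i) p)"
    by (rule sum.reindex_bij_betw[OF word_bij[OF i(1)]])
  also have "\<dots> = P (w i)" by (rule exact_full_code_sum[OF full, symmetric])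
  finally show "GP i - (\<Sum>a\<in>out_arcs G i. GS a * GT a) \<in> {0}"
    using sandwich_one[OF i(1)] by simp
qed auto

abbreviation expand :: "nat list \<Rightarrow> 'e list" where
  "expand \<gamma> \<equiv> concat (map word \<gamma>)"

lemma expand_awalk: "corner.awalk i \<gamma> j \<Longrightarrow> awalk (w i) (expand \<gamma>) (w j)"
proof (induction \<gamma> arbitrary: i)
  case Nil
  then show ?case using w_verts by (auto simp: corner.awalk_Nil_iff awalk_Nil_iff)
next
  case (Cons a \<gamma>)
  then have a: "a \<in> arcs G" "i = tail G a" "corner.awalk (head G a) \<gamma> j" by (auto simp: corner.awalk_Cons_iff)
  show ?case using arc_G(4)[OF a(1)] Cons.IH[OF a(3)] a(2) by (auto intro: awalk_appendI)
qed

lemma corner_pe: "corner.awalk i \<gamma> j \<Longrightarrow> corner.pe i \<gamma> = n i * pe (w i) (expand \<gamma>) * m j"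
proof (induction \<gamma> arbitrary: i)
  case Nil
  then show ?case by (auto simp: corner.awalk_Nil_iff sandwich_one)
next
  case (Cons a \<gamma>)
  then have a: "a \<in> arcs G" "i = tail G a" "corner.awalk (head G a) \<gamma> j" by (auto simp: corner.awalk_Cons_iff)
  note A = arc_G[OF a(1)]
  have "corner.pe i (a # \<gamma>) = GS a * (n (head G a) * pe (w (head G a)) (expand \<gamma>) * m j)"
    using Cons.IH[OF a(3)] by simp
  also have "\<dots> = n i * (pe (w i) (word a) * P (w (head G a)) * pe (w (head G a)) (expand \<gamma>)) * m j"
    unfolding GS_def using sandwich[OF A(3) A(3)] a(2) by simp
  also have "\<dots> = n i * pe (w i) (expand (a # \<gamma>)) * m j"
    using exact_pe_P[OF A(4)] exact_pe_append[OF A(4) expand_awalk[OF a(3)]] a(2) by simp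
  finally show ?case .
qed

lemma awalk_primary: "corner.awalk i \<gamma> j \<Longrightarrow> \<gamma> \<noteq> [] \<Longrightarrow> pr (w j) = j"
proof (induction \<gamma> arbitrary: i)
  case (Cons a \<gamma>)
  then have a: "a \<in> arcs G" "corner.awalk (head G a) \<gamma> j" by (auto simp: corner.awalk_Cons_iff)
  show ?case
  proof (cases "\<gamma> = []")
    case True
    then show ?thesis using a arc_G(5)[OF a(1)] by (auto simp: corner.awalk_Nil_iff)
  next
    case False
    then show ?thesis by (rule Cons.IH[OF a(2)])
  qed
qed simp

text \<open>
  Edges lead to representatives only, so a closed walk starts in a representative and its first
  edge is labelled by a return.
\<close>

lemma expand_closed_nonempty:
  assumes "corner.awalk i \<gamma> i" "\<gamma> \<noteq> []" shows "expand \<gamma> \<noteq> []"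
proof -
  obtain a \<delta> where \<gamma>: "\<gamma> = a # \<delta>" using assms(2) by (cases \<gamma>) auto
  then have a: "a \<in> arcs G" "tail G a = i" using assms(1) by (auto simp: corner.awalk_Cons_iff)
  have "word a \<in> returns D (w i)"
    using awalk_primary[OF assms] arc_G(2)[OF a(1)] a(2) by (simp add: codes_def)
  then show ?thesis using returns_awalk(3) by (simp add: \<gamma>)
qed

text \<open>
  The labels at an index form a prefix code, so the edges can be read off one after the other.  The
  common end point matters for the empty label: it separates the empty walk at an index from the
  edge to its representative.
\<close>

lemma expand_inj:
  "corner.awalk i \<gamma> j \<Longrightarrow> corner.awalk i \<gamma>' j \<Longrightarrow> expand \<gamma> = expand \<gamma>' \<Longrightarrow> \<gamma> = \<gamma>'"
proof (induction \<gamma> arbitrary: i \<gamma>')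
  case Nil
  then have "i = j" by (simp add: corner.awalk_Nil_iff)
  then show ?case using Nil expand_closed_nonempty[of i \<gamma>'] by auto
next
  case (Cons a \<gamma>)
  show ?case
  proof (cases \<gamma>')
    case Nil
    then have "i = j" using Cons.prems(2) by (simp add: corner.awalk_Nil_iff)
    then show ?thesis using Cons.prems(1,3) Nil expand_closed_nonempty[of i "a # \<gamma>"] by auto
  next
    case (Cons b \<delta>)
    have a: "a \<in> arcs G" "tail G a = i" "corner.awalk (head G a) \<gamma> j"
      using Cons.prems(1) by (auto simp: corner.awalk_Cons_iff)
    have b: "b \<in> arcs G" "tail G b = i" "corner.awalk (head G b) \<delta> j"
      using Cons.prems(2) Cons by (auto simp: corner.awalk_Cons_iff)
    have codes: "word a \<in> codes i" "word b \<in> codes i" "i \<in> I"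
      using arc_G[OF a(1)] arc_G[OF b(1)] a(2) b(2) by simp_all
    then have full: "full_code (w i) (codes i)" by (intro codes_full) auto
    have eq: "word a @ expand \<gamma> = word b @ expand \<delta>" using Cons.prems(3) Cons by simp
    have "word a = word b" by (rule full_code_prefix_free[OF full codes(1,2) eq])
    then have "a = b" using arc_eqI[OF a(1) b(1)] a(2) b(2) by simp
    with eq Cons.IH[OF a(3)] b(3) Cons show ?thesis by simp
  qed
qed

lemma m_pe_n:
  assumes "corner.awalk k \<delta> l" "i \<in> I" "j \<in> I"
  shows "m i * corner.pe k \<delta> * n j = (if k = i \<and> l = j then pe (w i) (expand \<delta>) else 0)"
proof -
  have kl: "k \<in> I" "l \<in> I"
    using corner.awalk_hd_in_verts[OF assms(1)] corner.awalk_last_in_verts[OF assms(1)] by simp_all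
  have "m i * corner.pe k \<delta> * n j = (m i * n k) * pe (w k) (expand \<delta>) * (m l * n j)"
    unfolding corner_pe[OF assms(1)] by (simp only: mult.assoc)
  then show ?thesis
    using m_n[OF assms(2) kl(1)] m_n[OF kl(2) assms(3)]
      exact_P_pe[OF expand_awalk[OF assms(1)]] exact_pe_P[OF expand_awalk[OF assms(1)]] by auto
qed

text \<open>
  Multiplying by \<open>m i\<close> and \<open>n j\<close> selects the walks from \<open>i\<close> to \<open>j\<close> and turns them into distinct
  walks of \<open>E\<close>.
\<close>

sublocale corner: faithful_family G \<kappa> GP GS GT
proof
  fix A :: "(nat \<times> nat list) set" and c :: "nat \<times> nat list \<Rightarrow> 'k" and \<mu>
  assume A: "finite A" "A \<subseteq> corner.walks" and zero: "(\<Sum>\<mu>\<in>A. \<kappa> (c \<mu>) * case_prod corner.pe \<mu>) = 0"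
    and \<mu>: "\<mu> \<in> A"
  obtain i \<gamma> j where \<gamma>: "\<mu> = (i, \<gamma>)" "corner.awalk i \<gamma> j" using A(2) \<mu> by (cases \<mu>) auto
  have ij: "i \<in> I" "j \<in> I"
    using corner.awalk_hd_in_verts[OF \<gamma>(2)] corner.awalk_last_in_verts[OF \<gamma>(2)] by simp_all
  define B where "B = {\<delta>. (i, \<delta>) \<in> A \<and> corner.awalk i \<delta> j}"
  have finB: "finite B"
    by (rule finite_subset[of _ "snd ` A"]) (use A(1) in \<open>force simp: B_def\<close>)+
  define f where "f = (\<lambda>\<delta>. (w i, expand \<delta>))"
  have inj: "inj_on f B"
    by (rule inj_onI) (auto simp: f_def B_def intro: expand_inj)
  have "0 = m i * (\<Sum>\<mu>\<in>A. \<kappa> (c \<mu>) * case_prod corner.pe \<mu>) * n j" using zero by simp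
  also have "\<dots> = (\<Sum>\<mu>\<in>A. \<kappa> (c \<mu>) * (m i * case_prod corner.pe \<mu> * n j))"
    by (simp only: sum_distrib_left sum_distrib_right mult_scalar_left mult.assoc)
  also have "\<dots> = (\<Sum>\<mu>\<in>Pair i ` B. \<kappa> (c \<mu>) * (m i * case_prod corner.pe \<mu> * n j))"
  proof (rule sum.mono_neutral_right[OF A(1)])
    show "Pair i ` B \<subseteq> A" by (auto simp: B_def)
    show "\<forall>\<mu>\<in>A - Pair i ` B. \<kappa> (c \<mu>) * (m i * case_prod corner.pe \<mu> * n j) = 0"
    proof
      fix \<nu> assume \<nu>: "\<nu> \<in> A - Pair i ` B"
      then obtain k \<delta> l where \<delta>: "\<nu> = (k, \<delta>)" "corner.awalk k \<delta> l" using A(2) by (cases \<nu>) auto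
      have "\<not> (k = i \<and> l = j)" using \<nu> \<delta> by (auto simp: B_def)
      then show "\<kappa> (c \<nu>) * (m i * case_prod corner.pe \<nu> * n j) = 0"
        using m_pe_n[OF \<delta>(2) ij] by (auto simp: \<delta>(1))
    qed
  qed
  also have "\<dots> = (\<Sum>\<delta>\<in>B. \<kappa> (c (i, \<delta>)) * pe (w i) (expand \<delta>))"
    by (subst sum.reindex) (auto simp: B_def m_pe_n[OF _ ij] intro!: inj_onI sum.cong)
  also have "\<dots> = (\<Sum>\<nu>\<in>f ` B. \<kappa> (c (i, the_inv_into B f \<nu>)) * case_prod pe \<nu>)"
    by (subst sum.reindex[OF inj], rule sum.cong[OF refl])
      (simp add: the_inv_into_f_f[OF inj], simp add: f_def)
  finally have "(\<Sum>\<nu>\<in>f ` B. \<kappa> (c (i, the_inv_into B f \<nu>)) * case_prod pe \<nu>) = 0" by simp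
  moreover have "f ` B \<subseteq> walks" using expand_awalk by (auto simp: f_def B_def)
  moreover have \<gamma>B: "\<gamma> \<in> B" using \<gamma> \<mu> by (simp add: B_def)
  ultimately have "c (i, the_inv_into B f (f \<gamma>)) = 0"
    using finB by (intro independent[of "f ` B" "\<lambda>\<nu>. c (i, the_inv_into B f \<nu>)"]) auto
  then show "c \<mu> = 0" using the_inv_into_f_f[OF inj \<gamma>B] \<gamma>(1) by simp
qed

lemma e_n: "i \<in> I \<Longrightarrow> e * n i = n i"
  and m_e: "i \<in> I \<Longrightarrow> m i * e = m i"
proof -
  assume i: "i \<in> I"
  have "e * n i = (\<Sum>k\<in>I. if k = i then n i else 0)"
    unfolding e_sum sum_distrib_right using i m_n n_P by (intro sum.cong refl) (simp add: mult.assoc)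
  then show "e * n i = n i" using i fin by simp
  have "m i * e = (\<Sum>k\<in>I. if k = i then m i else 0)"
    unfolding e_sum sum_distrib_left using i m_n P_m by (intro sum.cong refl) (simp flip: mult.assoc)
  then show "m i * e = m i" using i fin by simp
qed

lemma e_alg: "e \<in> alg"
  unfolding e_sum by (intro alg_sum alg.mult n_alg m_alg)

lemma corner_alg_subset:
  assumes "x \<in> corner.alg" shows "x \<in> alg \<and> e * x = x \<and> x * e = x"
  using assms
proof induction
  case zero
  then show ?case by (simp add: alg.zero)
next
  case (vertex i)
  then show ?case using e_n m_e n_alg m_alg by (auto simp: GP_def mult.assoc intro: alg.mult) (simp flip: mult.assoc)
next
  case (edge a)
  note A = arc_G[OF edge]
  have "e * GS a = (e * n (tail G a)) * pe (w (tail G a)) (word a) * m (head G a)"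
    "GS a * e = n (tail G a) * pe (w (tail G a)) (word a) * (m (head G a) * e)"
    by (simp_all only: GS_def mult.assoc)
  moreover have "GS a \<in> alg" unfolding GS_def by (intro alg.mult n_alg m_alg A pe_alg[OF A(4)])
  ultimately show ?case using e_n[OF A(1)] m_e[OF A(3)] by (simp add: GS_def)
next
  case (ghost a)
  note A = arc_G[OF ghost]
  have "e * GT a = (e * n (head G a)) * ge (w (tail G a)) (word a) * m (tail G a)"
    "GT a * e = n (head G a) * ge (w (tail G a)) (word a) * (m (tail G a) * e)"
    by (simp_all only: GT_def mult.assoc)
  moreover have "GT a \<in> alg" unfolding GT_def by (intro alg.mult n_alg m_alg A ge_alg[OF A(4)])
  ultimately show ?case using e_n[OF A(3)] m_e[OF A(1)] by (simp add: GT_def)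
next
  case (add x y)
  then show ?case by (simp add: distrib_left distrib_right alg.add)
next
  case (mult x y)
  then have "e * (x * y) = x * y" "x * y * e = x * y" by (simp_all add: mult.assoc) (simp flip: mult.assoc)
  with mult show ?case by (simp add: alg.mult)
next
  case (scale x c)
  then show ?case by (simp add: alg.scale mult_scalar_left mult.assoc)
qed

lemma primary_mem:
  assumes "i \<in> I"
  shows "n i * P (w i) * m (pr (w i)) \<in> corner.alg" "n (pr (w i)) * P (w i) * m i \<in> corner.alg"
proof -
  have "n i * P (w i) * m (pr (w i)) \<in> corner.alg \<and> n (pr (w i)) * P (w i) * m i \<in> corner.alg"
  proof (cases "pr (w i) = i")
    case True
    then show ?thesis using corner.alg.vertex[of i] sandwich_one[OF assms] assms by simp
  next
    case False
    then obtain a where a: "a \<in> arcs G" "tail G a = i" "word a = []"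
      using ex_arc[OF assms, of "[]"] by (auto simp: codes_def)
    have "head G a = pr (w i)" using arc_G(5,6)[OF a(1)] a(2,3) by simp
    then show ?thesis
      using corner.alg.edge[OF a(1)] corner.alg.ghost[OF a(1)] a(2,3) by (simp add: GS_def GT_def)
  qed
  then show "n i * P (w i) * m (pr (w i)) \<in> corner.alg" "n (pr (w i)) * P (w i) * m i \<in> corner.alg" by blast+
qed

text \<open>
  A walk from \<open>w i\<close> that ends outside \<open>D\<close> is a product of returns, all of which end in \<open>w ` I\<close>.
\<close>

lemma path_mem:
  assumes "i \<in> I" "awalk (w i) \<alpha> z" "z \<notin> D"
  shows "z \<in> w ` I \<and> n i * pe (w i) \<alpha> * m (pr z) \<in> corner.alg \<and> n (pr z) * ge (w i) \<alpha> * m i \<in> corner.alg"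
  using assms
proof (induction "length \<alpha>" arbitrary: i \<alpha> rule: less_induct)
  case less
  show ?case
  proof (cases "\<alpha> = []")
    case True
    then have "z = w i" using less.prems(2) by (simp add: awalk_Nil_iff)
    then show ?thesis using True primary_mem[OF less.prems(1)] less.prems(1) by simp
  next
    case False
    let ?i = "pr (w i)"
    have i: "?i \<in> I" "w ?i = w i" using pr[of "w i"] less.prems(1) by auto
    obtain q r where qr: "\<alpha> = q @ r" "q \<in> returns D (w i)"
      using returns_prefix[OF less.prems(2,3) False] by blast
    have "q \<in> codes ?i" using qr(2) i(2) by (simp add: codes_def)
    then obtain a where a: "a \<in> arcs G" "tail G a = ?i" "word a = q" using ex_arc[OF i(1)] by blast
    let ?h = "head G a"
    note A = arc_G[OF a(1)]
    have q: "awalk (w i) q (w ?h)" using A(4) a(2,3) i(2) by simp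
    then have "awlast (w i) q = w ?h" by auto
    then have r: "awalk (w ?h) r z" using less.prems(2) by (simp add: qr(1) awalk_append_iff)
    have "length r < length \<alpha>" using returns_awalk(3)[OF qr(2)] by (simp add: qr(1))
    from less.hyps[OF this A(3) r less.prems(3)]
    have z: "z \<in> w ` I" and IH: "n ?h * pe (w ?h) r * m (pr z) \<in> corner.alg"
      "n (pr z) * ge (w ?h) r * m ?h \<in> corner.alg" by blast+
    have S_a: "GS a = n ?i * pe (w i) q * m ?h" and T_a: "GT a = n ?h * ge (w i) q * m ?i"
      using a(2,3) i(2) by (simp_all add: GS_def GT_def)
    have "n i * pe (w i) \<alpha> * m (pr z) = (n i * P (w i) * m ?i) * GS a * (n ?h * pe (w ?h) r * m (pr z))"
      unfolding S_a sandwich[OF i(1) i(1)] using sandwich[OF A(3) A(3)] i(2)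
        exact_P_P[OF w_verts[OF less.prems(1)]] exact_P_pe[OF q] exact_pe_P[OF q] exact_pe_append[OF q r]
      by (simp add: qr(1))
    moreover have "GT a * (n ?i * P (w i) * m i) = n ?h * ge (w i) q * m i"
      unfolding T_a sandwich[OF i(1) i(1)] by (simp add: i(2) exact_ge_P[OF q])
    then have "n (pr z) * ge (w i) \<alpha> * m i = (n (pr z) * ge (w ?h) r * m ?h) * (GT a * (n ?i * P (w i) * m i))"
      using sandwich[OF A(3) A(3)] by (simp add: qr(1) exact_ge_P[OF r] exact_ge_append[OF q r])
    ultimately show ?thesis
      using z IH corner.alg.mult corner.alg.edge[OF a(1)] corner.alg.ghost[OF a(1)] primary_mem[OF less.prems(1)]
      by simp
  qed
qed

text \<open>
  If the common end point lies in \<open>D\<close>, both walks are first prolonged by the walks that leave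
  \<open>D\<close>.
\<close>

lemma path_ghost_mem:
  assumes "i \<in> I" "j \<in> I" "awalk (w i) \<alpha> u" "awalk (w j) \<beta> u"
  shows "n i * (pe (w i) \<alpha> * ge (w j) \<beta>) * m j \<in> corner.alg"
proof -
  have u: "u \<in> verts E" using assms(3) by auto
  let ?Q = "{p. exits D u p}"
  have full: "full_code u ?Q" by (rule exits_full_code[OF transient u])
  have "pe (w i) \<alpha> * ge (w j) \<beta> = pe (w i) \<alpha> * P u * ge (w j) \<beta>" using exact_pe_P[OF assms(3)] by simp
  also have "\<dots> = (\<Sum>p\<in>?Q. (pe (w i) \<alpha> * pe u p) * (ge u p * ge (w j) \<beta>))"
    by (subst exact_full_code_sum[OF full]) (simp only: sum_distrib_left sum_distrib_right mult.assoc)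
  finally have "n i * (pe (w i) \<alpha> * ge (w j) \<beta>) * m j
      = (\<Sum>p\<in>?Q. n i * ((pe (w i) \<alpha> * pe u p) * (ge u p * ge (w j) \<beta>)) * m j)"
    by (simp only: sum_distrib_left sum_distrib_right)
  also have "\<dots> \<in> corner.alg"
  proof (rule corner.alg_sum)
    fix p assume p: "p \<in> ?Q"
    let ?z = "awlast u p"
    have z: "awalk u p ?z" "?z \<notin> D" using exits_awalk[of D u p] p by simp_all
    have \<alpha>: "awalk (w i) (\<alpha> @ p) ?z" and \<beta>: "awalk (w j) (\<beta> @ p) ?z"
      using assms(3,4) z(1) by (auto intro: awalk_appendI)
    have pr: "pr ?z \<in> I" "w (pr ?z) = ?z" using path_mem[OF assms(1) \<alpha> z(2)] pr by blast+
    have "n i * ((pe (w i) \<alpha> * pe u p) * (ge u p * ge (w j) \<beta>)) * m j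
        = (n i * pe (w i) (\<alpha> @ p) * m (pr ?z)) * (n (pr ?z) * ge (w j) (\<beta> @ p) * m j)"
      using sandwich[OF pr(1) pr(1)] pr(2) exact_pe_P[OF \<alpha>]
        exact_pe_append[OF assms(3) z(1)] exact_ge_append[OF assms(4) z(1)] by simp
    then show "n i * ((pe (w i) \<alpha> * pe u p) * (ge u p * ge (w j) \<beta>)) * m j \<in> corner.alg"
      using path_mem[OF assms(1) \<alpha> z(2)] path_mem[OF assms(2) \<beta> z(2)] corner.alg.mult by simp
  qed
  finally show ?thesis .
qed

text \<open>
  Multiplying \<open>b\<close> by long walks expresses it through products of a path and a ghost path.
\<close>

lemma block_mem:
  assumes ij: "i \<in> I" "j \<in> I" and b: "b \<in> alg" "P (w i) * b = b" "b * P (w j) = b"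
  shows "n i * b * m j \<in> corner.alg"
proof -
  obtain N where N: "\<And>v \<alpha>. (v, \<alpha>) \<in> long_walks N \<Longrightarrow> b * pe v \<alpha> \<in> path_alg"
    using alg_path_multiple[OF b(1)] by blast
  obtain Q where Q: "full_code (w j) Q" "Pair (w j) ` Q \<subseteq> long_walks N"
    using long_full_code[OF w_verts[OF ij(2)]] by blast
  have "b = b * (\<Sum>q\<in>Q. pe (w j) q * ge (w j) q)"
    using b(3) exact_full_code_sum[OF Q(1)] by simp
  then have "n i * b * m j = n i * (b * (\<Sum>q\<in>Q. pe (w j) q * ge (w j) q)) * m j" by simp
  also have "\<dots> = (\<Sum>q\<in>Q. n i * ((b * pe (w j) q) * ge (w j) q) * m j)"
    by (simp only: sum_distrib_left sum_distrib_right mult.assoc)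
  also have "\<dots> \<in> corner.alg"
  proof (rule corner.alg_sum)
    fix q assume q: "q \<in> Q"
    obtain u where u: "awalk (w j) q u" using full_code_awalk[OF Q(1) q] by blast
    have "b * pe (w j) q \<in> path_alg" using N Q(2) q by blast
    moreover have "P (w i) * (b * pe (w j) q) = b * pe (w j) q" using b(2) by (simp flip: mult.assoc)
    ultimately have "b * pe (w j) q \<in> vs.span (pe (w i) ` {\<alpha>. \<exists>u. awalk (w i) \<alpha> u})"
      using path_alg_at w_verts[OF ij(1)] by blast
    then show "n i * ((b * pe (w j) q) * ge (w j) q) * m j \<in> corner.alg"
    proof (induction rule: vs.span_induct_alt)
      case base
      then show ?case by (simp add: corner.alg.zero)
    next
      case (step c x y)
      then obtain \<alpha> z where \<alpha>: "x = pe (w i) \<alpha>" "awalk (w i) \<alpha> z" by blast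
      have "n i * (x * ge (w j) q) * m j \<in> corner.alg"
      proof (cases "z = u")
        case True
        then show ?thesis using path_ghost_mem[OF ij \<alpha>(2)] u \<alpha>(1) by simp
      next
        case False
        have "x * ge (w j) q = x * P u * ge (w j) q" using exact_P_ge[OF u] by (simp add: mult.assoc)
        also have "x * P u = 0" unfolding \<alpha>(1) using u False by (intro exact_pe_P_orth[OF \<alpha>(2)]) auto
        finally show ?thesis by (simp add: corner.alg.zero)
      qed
      then have "\<kappa> c * (n i * (x * ge (w j) q) * m j) + n i * (y * ge (w j) q) * m j \<in> corner.alg"
        using step(2) by (intro corner.alg.add corner.alg.scale)
      moreover have "n i * ((\<kappa> c * x + y) * ge (w j) q) * m j
          = \<kappa> c * (n i * (x * ge (w j) q) * m j) + n i * (y * ge (w j) q) * m j"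
        by (simp only: distrib_left distrib_right mult.assoc mult_scalar_left)
      ultimately show ?case by simp
    qed
  qed
  finally show ?thesis .
qed

lemma corner_alg: "corner.alg = {e * a * e | a. a \<in> alg}"
proof (intro equalityI subsetI)
  fix x assume "x \<in> corner.alg"
  then have "x \<in> alg" "x = e * x * e" using corner_alg_subset[of x] by simp_all
  then show "x \<in> {e * a * e | a. a \<in> alg}" by blast
next
  fix x assume "x \<in> {e * a * e | a. a \<in> alg}"
  then obtain a where a: "a \<in> alg" "x = e * a * e" by blast
  have "x = (\<Sum>i\<in>I. \<Sum>j\<in>I. n i * (m i * a * n j) * m j)"
    unfolding a(2) by (subst (1 2) e_sum) (simp only: sum_distrib_left sum_distrib_right mult.assoc, rule sum.swap)
  also have "\<dots> \<in> corner.alg"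
  proof (intro corner.alg_sum block_mem)
    fix i j assume ij: "i \<in> I" "j \<in> I"
    show "m i * a * n j \<in> alg" by (intro alg.mult m_alg n_alg ij a(1))
    show "P (w i) * (m i * a * n j) = m i * a * n j" using P_m[OF ij(1)] by (simp flip: mult.assoc)
    show "m i * a * n j * P (w j) = m i * a * n j" using n_P[OF ij(2)] by (simp add: mult.assoc)
  qed
  finally show "x \<in> corner.alg" .
qed

lemma corner_one: "(\<Sum>i\<in>verts G. GP i) = e"
  by (simp add: e_sum GP_def)

end

section \<open>A faithful representation\<close>

text \<open>
  The linear endomorphisms of the space of functions \<open>'x \<Rightarrow> 'k\<close>, made into a ring type.
\<close>

typedef (overloaded) ('x, 'k::field) linop =
  "{f :: ('x \<Rightarrow> 'k) \<Rightarrow> 'x \<Rightarrow> 'k. (\<forall>g h. f (\<lambda>x. g x + h x) = (\<lambda>x. f g x + f h x)) \<and>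
      (\<forall>c g. f (\<lambda>x. c * g x) = (\<lambda>x. c * f g x))}"
  morphisms app Linop
  by (rule exI[of _ "\<lambda>g. g"]) simp

setup_lifting type_definition_linop

lemma app_add: "app a (\<lambda>x. g x + h x) = (\<lambda>x. app a g x + app a h x)"
  and app_scale: "app a (\<lambda>x. c * g x) = (\<lambda>x. c * app a g x)"
  using app[of a] by simp_all

lemma linop_eqI: "(\<And>g x. app a g x = app b g x) \<Longrightarrow> a = b"
  by (simp add: fun_eq_iff flip: app_inject)

instantiation linop :: (type, field) ring_1
begin

lift_definition zero_linop :: "('a, 'b) linop" is "\<lambda>g x. 0" by simp
lift_definition one_linop :: "('a, 'b) linop" is "\<lambda>g. g" by simp
lift_definition plus_linop :: "('a, 'b) linop \<Rightarrow> ('a, 'b) linop \<Rightarrow> ('a, 'b) linop"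
  is "\<lambda>a b g x. a g x + b g x" by (simp add: algebra_simps)
lift_definition minus_linop :: "('a, 'b) linop \<Rightarrow> ('a, 'b) linop \<Rightarrow> ('a, 'b) linop"
  is "\<lambda>a b g x. a g x - b g x" by (simp add: algebra_simps)
lift_definition uminus_linop :: "('a, 'b) linop \<Rightarrow> ('a, 'b) linop"
  is "\<lambda>a g x. - a g x" by simp
lift_definition times_linop :: "('a, 'b) linop \<Rightarrow> ('a, 'b) linop \<Rightarrow> ('a, 'b) linop"
  is "\<lambda>a b g. a (b g)" by simp

lemmas linop_app = zero_linop.rep_eq one_linop.rep_eq plus_linop.rep_eq minus_linop.rep_eq
  uminus_linop.rep_eq times_linop.rep_eq

instance
proof
  have "app (0 :: ('a, 'b) linop) (\<lambda>_. 1) undefined \<noteq> app 1 (\<lambda>_. 1) undefined"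
    by (simp add: linop_app)
  then show "(0 :: ('a, 'b) linop) \<noteq> 1" by metis
qed (rule linop_eqI, simp add: linop_app app_add)+

end

lift_definition scalar_op :: "'k \<Rightarrow> ('x, 'k::field) linop" is "\<lambda>c g x. c * g x"
  by (simp add: algebra_simps)

text \<open>
  Composition with a partial map.  Vertices, edges and ghost edges will act in this way, which
  reduces all Leavitt relations but the last one to identities between partial maps.
\<close>

lift_definition pull :: "('x \<Rightarrow> 'x option) \<Rightarrow> ('x, 'k::field) linop"
  is "\<lambda>\<phi> g x. case \<phi> x of None \<Rightarrow> 0 | Some y \<Rightarrow> g y"
  by (auto simp: fun_eq_iff split: option.split)

lemma scalars_scalar_op: "scalars (scalar_op :: 'k::field \<Rightarrow> ('x, 'k) linop)"
  by unfold_locales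
    (rule linop_eqI, simp add: linop_app scalar_op.rep_eq app_scale distrib_right mult.assoc)+

lemma pull_mult: "pull \<phi> * pull \<psi> = pull (\<lambda>x. Option.bind (\<phi> x) \<psi>)"
  by (rule linop_eqI) (simp add: linop_app pull.rep_eq split: option.split)

lemma app_scalar_op: "app (scalar_op c * a) g x = c * app a g x"
  by (simp add: linop_app scalar_op.rep_eq)

lemma app_sum: "app (sum f A) g x = (\<Sum>i\<in>A. app (f i) g x)"
  by (induction A rule: infinite_finite_induct) (simp_all add: linop_app)

text \<open>
  The last component of \<open>'v \<times> nat \<times> int\<close> is a degree; the values of \<open>app a g\<close> in degree \<open>z\<close>
  depend only on those of \<open>g\<close> in degree \<open>z + d\<close>.
\<close>

definition homogeneous :: "int \<Rightarrow> ('v \<times> nat \<times> int, 'k::field) linop \<Rightarrow> bool" where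
  "homogeneous d a \<longleftrightarrow>
     (\<forall>g u i z. (\<forall>u' i'. g (u', i', z + d) = 0) \<longrightarrow> app a g (u, i, z) = 0)"

lemma homogeneous_mult:
  assumes a: "homogeneous d a" and b: "homogeneous d' b"
  shows "homogeneous (d + d') (a * b)"
  unfolding homogeneous_def
proof (intro allI impI)
  fix g :: "'a \<times> nat \<times> int \<Rightarrow> 'b" and u i z
  assume g: "\<forall>u' i'. g (u', i', z + (d + d')) = 0"
  have "app b g (u', i', z + d) = 0" for u' i'
    using b g unfolding homogeneous_def by (simp add: add.assoc)
  then show "app (a * b) g (u, i, z) = 0"
    using a unfolding homogeneous_def times_linop.rep_eq by blast
qed

lemma homogeneous_pull:
  assumes "\<And>u i z y. \<phi> (u, i, z) = Some y \<Longrightarrow> snd (snd y) = z + d"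
  shows "homogeneous d (pull \<phi>)"
  unfolding homogeneous_def
proof (intro allI impI)
  fix g :: "'a \<times> nat \<times> int \<Rightarrow> 'b" and u i z
  assume g: "\<forall>u' i'. g (u', i', z + d) = 0"
  show "app (pull \<phi>) g (u, i, z) = 0"
  proof (cases "\<phi> (u, i, z)")
    case (Some y)
    then have "y = (fst y, fst (snd y), z + d)" using assms[OF Some] by (simp add: prod_eq_iff)
    then show ?thesis using g Some by (metis (mono_tags, lifting) option.simps(5) pull.rep_eq)
  qed (simp add: pull.rep_eq)
qed

lemma (in leavitt_family) ge_pe_same_length:
  "awalk v \<alpha> w \<Longrightarrow> awalk v \<beta> u \<Longrightarrow> length \<alpha> = length \<beta> \<Longrightarrow> \<alpha> \<noteq> \<beta> \<Longrightarrow> ge v \<alpha> * pe v \<beta> = 0"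
proof (induction \<alpha> arbitrary: v \<beta>)
  case (Cons e \<alpha>)
  obtain f \<delta> where \<beta>: "\<beta> = f # \<delta>" using Cons.prems(3) by (cases \<beta>) auto
  have e: "e \<in> arcs E" "awalk (head E e) \<alpha> w" and f: "f \<in> arcs E" "awalk (head E f) \<delta> u"
    using Cons.prems(1,2) by (auto simp: \<beta> awalk_Cons_iff)
  have eq: "ge v (e # \<alpha>) * pe v \<beta> = ge (head E e) \<alpha> * (T e * S f) * pe (head E f) \<delta>"
    by (simp add: \<beta> mult.assoc)
  show ?case
  proof (cases "e = f")
    case True
    then have "T e * S f = P (head E e)" using T_S[OF e(1)] eqv_iff by simp
    then show ?thesis
      unfolding eq using exact_ge_P[OF e(2)] Cons.IH[OF e(2)] f(2) Cons.prems(3,4) True \<beta> by simp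
  next
    case False
    then have "T e * S f = 0" using T_S_orth[OF e(1) f(1)] by simp
    then show ?thesis unfolding eq by simp
  qed
qed simp

text \<open>
  The operators act on functions of a vertex, a natural number and an integer.  If \<open>v\<close> emits \<open>d\<close> edges, division by \<open>d\<close>
  with remainder identifies the copy of \<open>\<nat>\<close> at \<open>v\<close> with the disjoint union of the copies at the
  heads of these edges, which is the relation \<open>v = \<Sum> e e\<^sup>*\<close>.  Edges shift the integer by one.  This makes the
  walks independent: multiplying a combination by the ghost of one of its walks on the left
  annihilates the other walks of the same length and moves those of different length away from
  degree zero.  Without the integer a cycle could act as
  the identity.
\<close>

theorem ex_faithful_family:
  assumes "fin_digraph (E :: ('v, 'e) pre_digraph)"
  shows "\<exists>P S T. faithful_family E (scalar_op :: 'k::field \<Rightarrow> ('v \<times> nat \<times> int, 'k) linop) P S T"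
proof -
  interpret fin_digraph E by fact
  define deg where "deg v = card (out_arcs E v)" for v
  have "\<forall>v. \<exists>f. bij_betw f (out_arcs E v) {0..<deg v}"
    unfolding deg_def using ex_bij_betw_finite_nat[OF finite_out_arcs] by blast
  then obtain h where h: "\<And>v. bij_betw (h v) (out_arcs E v) {0..<deg v}" by metis
  define idx where "idx e = h (tail E e) e" for e
  have idx_less: "idx e < deg (tail E e)" if "e \<in> arcs E" for e
    using h[of "tail E e"] that by (auto simp: idx_def bij_betw_def)
  have idx_inj: "e = f" if "e \<in> arcs E" "f \<in> arcs E" "tail E e = tail E f" "idx e = idx f" for e f
    using inj_onD[OF bij_betw_imp_inj_on[OF h[of "tail E e"]], of e f] that by (simp add: idx_def)
  have idx_ex: "\<exists>e\<in>out_arcs E v. idx e = i" if "i < deg v" for v i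
  proof -
    have "i \<in> h v ` out_arcs E v" using h[of v] that by (simp add: bij_betw_def)
    then obtain e where "e \<in> out_arcs E v" "i = h v e" by blast
    then show ?thesis by (intro bexI[of _ e]) (auto simp: idx_def)
  qed
  define p where "p v = (\<lambda>(u, i :: nat, z :: int). if u = v then Some (u, i, z) else None)" for v :: 'v
  define s where "s e = (\<lambda>(u, i, z :: int). if u = tail E e \<and> i mod deg u = idx e
      then Some (head E e, i div deg u, z + 1) else None)" for e
  define t where "t e = (\<lambda>(u, i, z :: int). if u = head E e
      then Some (tail E e, i * deg (tail E e) + idx e, z - 1) else None)" for e
  define P S T where "P v = (pull (p v) :: ('v \<times> nat \<times> int, 'k) linop)"
    and "S e = (pull (s e) :: ('v \<times> nat \<times> int, 'k) linop)"
    and "T e = (pull (t e) :: ('v \<times> nat \<times> int, 'k) linop)" for v e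
  note defs = P_def S_def T_def pull_mult
  interpret L: leavitt_family E "scalar_op :: 'k \<Rightarrow> ('v \<times> nat \<times> int, 'k) linop" P S T
  proof (intro leavitt_family.intro leavitt_mod.intro assms scalars_scalar_op leavitt_mod_axioms.intro)
    fix v w assume "v \<in> verts E" "w \<in> verts E"
    have "(\<lambda>x. Option.bind (p v x) (p w)) = (if v = w then p w else (\<lambda>_. None))"
      by (auto simp: p_def fun_eq_iff)
    then show "P v * P w - (if v = w then P w else 0) \<in> {0}"
      by (auto simp: defs linop_app pull.rep_eq intro: linop_eqI)
  next
    fix e assume e: "e \<in> arcs E"
    have "(\<lambda>x. Option.bind (p (tail E e) x) (s e)) = s e" "(\<lambda>x. Option.bind (s e x) (p (head E e))) = s e"
      "(\<lambda>x. Option.bind (p (head E e) x) (t e)) = t e" "(\<lambda>x. Option.bind (t e x) (p (tail E e))) = t e"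
      by (auto simp: p_def s_def t_def fun_eq_iff)
    then show "P (tail E e) * S e - S e \<in> {0}" "S e * P (head E e) - S e \<in> {0}"
      "P (head E e) * T e - T e \<in> {0}" "T e * P (tail E e) - T e \<in> {0}"
      by (simp_all add: defs)
    fix f assume f: "f \<in> arcs E"
    have "(\<lambda>x. Option.bind (t e x) (s f)) = (if e = f then p (head E e) else (\<lambda>_. None))"
    proof (rule ext)
      fix x :: "'v \<times> nat \<times> int"
      obtain u i z where x: "x = (u, i, z)" by (cases x) auto
      show "Option.bind (t e x) (s f) = (if e = f then p (head E e) else (\<lambda>_. None)) x"
        using idx_less[OF e] idx_inj[OF e f] by (auto simp: x t_def s_def p_def)
    qed
    then show "T e * S f - (if e = f then P (head E e) else 0) \<in> {0}"
      by (auto simp: defs linop_app pull.rep_eq intro: linop_eqI)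
  next
    fix v assume v: "regular E v"
    have "P v = (\<Sum>e\<in>out_arcs E v. S e * T e)"
    proof (rule linop_eqI)
      fix g :: "'v \<times> nat \<times> int \<Rightarrow> 'k" and x :: "'v \<times> nat \<times> int"
      obtain u i z where x: "x = (u, i, z)" by (cases x) auto
      have ST: "app (S e * T e) g x = (if u = v \<and> i mod deg v = idx e then g x else 0)"
        if "e \<in> out_arcs E v" for e
      proof -
        have "Option.bind (s e x) (t e) = (if u = v \<and> i mod deg v = idx e then Some x else None)"
          using that by (auto simp: x s_def t_def) (metis div_mult_mod_eq)
        then show ?thesis by (simp add: defs pull.rep_eq)
      qed
      have "app (\<Sum>e\<in>out_arcs E v. S e * T e) g x = (\<Sum>e\<in>out_arcs E v. if u = v \<and> i mod deg v = idx e then g x else 0)"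
        unfolding app_sum using ST by (intro sum.cong) auto
      also have "\<dots> = (if u = v then g x else 0)"
      proof (cases "u = v")
        case True
        have "0 < deg v" using v finite_out_arcs by (simp add: deg_def regular_def card_gt_0_iff)
        then obtain e0 where e0: "e0 \<in> out_arcs E v" "idx e0 = i mod deg v"
          using idx_ex[of "i mod deg v" v] by auto
        have "(i mod deg v = idx e) = (e = e0)" if "e \<in> out_arcs E v" for e
          using idx_inj[of e e0] e0 that by auto
        then have "(\<Sum>e\<in>out_arcs E v. if u = v \<and> i mod deg v = idx e then g x else 0)
            = (\<Sum>e\<in>out_arcs E v. if e = e0 then g x else 0)"
          using True by (intro sum.cong) auto
        also have "\<dots> = g x" using e0(1) finite_out_arcs by (simp add: sum.delta)
        finally show ?thesis using True by simp
      qed simp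
      also have "\<dots> = app (P v) g x" by (simp add: P_def pull.rep_eq p_def x)
      finally show "app (P v) g x = app (\<Sum>e\<in>out_arcs E v. S e * T e) g x" by simp
    qed
    then show "P v - (\<Sum>e\<in>out_arcs E v. S e * T e) \<in> {0}" by simp
  qed auto
  have hP: "homogeneous 0 (P v)" and hS: "homogeneous 1 (S e)" and hT: "homogeneous (- 1) (T e)" for v e
    unfolding P_def S_def T_def
    by (rule homogeneous_pull, auto simp: p_def s_def t_def split: if_splits)+
  have hpe: "homogeneous (int (length \<alpha>)) (L.pe v \<alpha>)" for v \<alpha>
  proof (induction \<alpha> arbitrary: v)
    case (Cons e \<alpha>)
    then show ?case using homogeneous_mult[OF hS[of e], of "int (length \<alpha>)" "L.pe (head E e) \<alpha>"] by simp
  qed (simp add: hP)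
  have hge: "homogeneous (- int (length \<alpha>)) (L.ge v \<alpha>)" for v \<alpha>
  proof (induction \<alpha> arbitrary: v)
    case (Cons e \<alpha>)
    have "- int (length (e # \<alpha>)) = - int (length \<alpha>) + - 1" by simp
    then show ?case using homogeneous_mult[OF Cons hT[of e]] by (simp only: L.ge.simps)
  qed (simp add: hP)
  have "faithful_family E (scalar_op :: 'k \<Rightarrow> ('v \<times> nat \<times> int, 'k) linop) P S T"
  proof
    fix A :: "('v \<times> 'e list) set" and c :: "'v \<times> 'e list \<Rightarrow> 'k" and \<mu>
    assume A: "finite A" "A \<subseteq> walks" and zero: "(\<Sum>\<mu>\<in>A. scalar_op (c \<mu>) * case_prod L.pe \<mu>) = 0"
      and \<mu>: "\<mu> \<in> A"
    obtain v \<alpha> w where \<alpha>: "\<mu> = (v, \<alpha>)" "awalk v \<alpha> w" using A(2) \<mu> by (cases \<mu>) auto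
    define g :: "'v \<times> nat \<times> int \<Rightarrow> 'k" where "g x = (if x = (w, 0, 0) then 1 else 0)" for x
    let ?x = "(w, 0 :: nat, 0 :: int)"
    have val: "app (L.ge v \<alpha> * case_prod L.pe \<nu> * P w) g ?x = (if \<nu> = \<mu> then 1 else 0)" if \<nu>: "\<nu> \<in> A" for \<nu>
    proof -
      obtain v' \<beta> u where \<beta>: "\<nu> = (v', \<beta>)" "awalk v' \<beta> u" using A(2) \<nu> by (cases \<nu>) auto
      consider "\<nu> = \<mu>" | "v' \<noteq> v" | "v' = v" "length \<beta> = length \<alpha>" "\<beta> \<noteq> \<alpha>" | "length \<beta> \<noteq> length \<alpha>"
        using \<alpha>(1) \<beta>(1) by auto
      then show ?thesis
      proof cases
        case 1
        have "L.ge v \<alpha> * L.pe v \<alpha> * P w = P w"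
          using L.exact_ge_pe[OF \<alpha>(2)] L.exact_P_P[OF awalk_last_in_verts[OF \<alpha>(2)]] by simp
        then show ?thesis using 1 \<alpha>(1) by (simp add: P_def pull.rep_eq p_def g_def)
      next
        case 2
        have "L.ge v \<alpha> * L.pe v' \<beta> = L.ge v \<alpha> * (P v * L.pe v' \<beta>)"
          using L.exact_ge_P[OF \<alpha>(2)] by (simp flip: mult.assoc)
        also have "P v * L.pe v' \<beta> = 0"
          using 2 awalk_hd_in_verts[OF \<alpha>(2)] by (intro L.exact_P_pe_orth[OF \<beta>(2)]) auto
        finally show ?thesis using 2 by (simp add: \<alpha>(1) \<beta>(1) linop_app)
      next
        case 3
        then show ?thesis
          using L.ge_pe_same_length[OF \<alpha>(2), of \<beta> u] \<beta>(2) by (simp add: \<alpha>(1) \<beta>(1) linop_app)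
      next
        case 4
        let ?d = "- int (length \<alpha>) + int (length \<beta>) + 0"
        have "homogeneous ?d (L.ge v \<alpha> * L.pe v' \<beta> * P w)"
          by (intro homogeneous_mult hge hpe hP)
        moreover have "\<forall>u' i'. g (u', i', 0 + ?d) = 0" using 4 by (simp add: g_def)
        ultimately have "app (L.ge v \<alpha> * L.pe v' \<beta> * P w) g ?x = 0"
          unfolding homogeneous_def by blast
        then show ?thesis using 4 by (auto simp: \<alpha>(1) \<beta>(1))
      qed
    qed
    have "0 = L.ge v \<alpha> * (\<Sum>\<mu>\<in>A. scalar_op (c \<mu>) * case_prod L.pe \<mu>) * P w" using zero by simp
    also have "\<dots> = (\<Sum>\<mu>\<in>A. scalar_op (c \<mu>) * (L.ge v \<alpha> * case_prod L.pe \<mu> * P w))"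
      by (simp only: sum_distrib_left sum_distrib_right L.mult_scalar_left mult.assoc)
    finally have "app 0 g ?x = app (\<Sum>\<mu>\<in>A. scalar_op (c \<mu>) * (L.ge v \<alpha> * case_prod L.pe \<mu> * P w)) g ?x"
      by (rule arg_cong)
    also have "\<dots> = (\<Sum>\<nu>\<in>A. c \<nu> * (if \<nu> = \<mu> then 1 else 0))"
      unfolding app_sum using val by (intro sum.cong refl) (simp only: app_scalar_op)
    also have "\<dots> = c \<mu>" using A(1) \<mu> by (simp add: if_distrib cong: if_cong)
    finally show "c \<mu> = 0" by (simp add: linop_app)
  qed
  then show ?thesis by blast
qed

section \<open>Corners of Leavitt path algebras\<close>

theorem theorem3p15:
  fixes E :: "('v, 'e) pre_digraph"
    and \<epsilon> :: "(('v, 'e) lpa_gen, 'k::field) free_poly set"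
  assumes "fin_digraph E" and "verts E \<noteq> {}"
    and "\<epsilon> \<in> carrier (leavitt E)"
    and "\<epsilon> \<otimes>\<^bsub>leavitt E\<^esub> \<epsilon> = \<epsilon>"
    and "\<epsilon> \<noteq> \<zero>\<^bsub>leavitt E\<^esub>"
  shows "\<exists>G :: (nat, nat) pre_digraph. fin_digraph G \<and> verts G \<noteq> {} \<and>
           algebra_isomorphic (corner (leavitt E) \<epsilon>)
             (leavitt G :: ('k, ((nat, nat) lpa_gen, 'k) free_poly set) module)"
proof -
  obtain P S T where "faithful_family E (scalar_op :: 'k \<Rightarrow> ('v \<times> nat \<times> int, 'k) linop) P S T"
    using ex_faithful_family[OF assms(1)] by blast
  then interpret F: faithful_family E "scalar_op :: 'k \<Rightarrow> ('v \<times> nat \<times> int, 'k) linop" P S T .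
  define e where "e = F.embed \<epsilon>"
  have e_alg: "e \<in> F.alg" using F.embed_image assms(3) by (auto simp: e_def)
  have ee: "e * e = e" using F.embed_mult(1)[OF assms(3,3)] assms(4) by (simp add: e_def)
  have "\<zero>\<^bsub>leavitt E\<^esub> \<in> carrier (leavitt E :: ('k, (('v, 'e) lpa_gen, 'k) free_poly set) module)"
    unfolding F.leavitt_zero F.leavitt_carrier by (rule imageI) (simp add: free_nonunital_def)
  then have "e \<noteq> 0"
    using inj_onD[OF F.embed_inj, of \<epsilon> "\<zero>\<^bsub>leavitt E\<^esub>"] assms(3,5) by (auto simp: e_def F.embed_zero)
  obtain J :: "('v \<times> 'e list) set" and w1 n1 m1 where s1: "F.splits e J w1 n1 m1"
    using F.idempotent_splits[OF e_alg ee] by blast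
  then have "finite J" by (simp add: F.splits_def)
  then obtain b where "bij_betw b {0..<card J} J" using ex_bij_betw_nat_finite by blast
  from F.ex_returning_splitting[OF F.splits_reindex[OF s1 this]]
  obtain D and I :: "nat set" and w n m where s: "F.transient D" "F.splits e I w n m"
    "\<forall>u\<in>w ` I. \<forall>q\<in>F.returns D u. F.awlast u q \<in> w ` I"
    by (elim exE conjE)
  interpret C: corner_graph E "scalar_op :: 'k \<Rightarrow> ('v \<times> nat \<times> int, 'k) linop" P S T e D I w n m
    by unfold_locales (use s in auto)
  let ?L = "leavitt E :: ('k, (('v, 'e) lpa_gen, 'k) free_poly set) module"
  let ?M = "leavitt C.G :: ('k, ((nat, nat) lpa_gen, 'k) free_poly set) module"
  let ?C = "corner ?L \<epsilon>"
  have ops: "x \<otimes>\<^bsub>?C\<^esub> y = x \<otimes>\<^bsub>?L\<^esub> y" "x \<oplus>\<^bsub>?C\<^esub> y = x \<oplus>\<^bsub>?L\<^esub> y" "c \<odot>\<^bsub>?C\<^esub> x = c \<odot>\<^bsub>?L\<^esub> x" for x y c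
    by (simp_all add: corner_def)
  \<comment> \<open>Both algebras have the same image in the ring of operators.\<close>
  define h where "h x = inv_into (carrier ?M) C.corner.embed (F.embed x)" for x
  have sub: "x \<in> carrier ?L" if "x \<in> carrier ?C" for x
    using that assms(3) by (auto simp: corner_def intro!: F.embed_mult(2))
  have emb_C: "F.embed ` carrier ?C = C.corner.alg"
  proof -
    have "F.embed ` carrier ?C = (\<lambda>x. e * x * e) ` (F.embed ` carrier ?L)"
    proof -
      have "F.embed (\<epsilon> \<otimes>\<^bsub>?L\<^esub> x \<otimes>\<^bsub>?L\<^esub> \<epsilon>) = e * F.embed x * e" if "x \<in> carrier ?L" for x
        using that assms(3) by (simp add: e_def F.embed_mult)
      then show ?thesis by (auto simp: corner_def image_iff) metis+
    qed
    then show ?thesis unfolding F.embed_image C.corner_alg by blast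
  qed
  have h: "h x \<in> carrier ?M" "C.corner.embed (h x) = F.embed x" if "x \<in> carrier ?C" for x
  proof -
    have "F.embed x \<in> C.corner.embed ` carrier ?M"
      using that emb_C C.corner.embed_image by blast
    then show "h x \<in> carrier ?M" "C.corner.embed (h x) = F.embed x"
      unfolding h_def by (rule inv_into_into, rule f_inv_into_f)
  qed
  have h_eqI: "h x = y" if "F.embed x = C.corner.embed y" "y \<in> carrier ?M" for x y
    unfolding h_def that(1) by (rule inv_into_f_f[OF C.corner.embed_inj that(2)])
  have "h \<in> ring_hom ?C ?M"
  proof (rule ring_hom_memI)
    fix x y assume xy: "x \<in> carrier ?C" "y \<in> carrier ?C"
    show "h x \<in> carrier ?M" by (rule h(1)[OF xy(1)])
    note hx = h[OF xy(1)] and hy = h[OF xy(2)]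
    show "h (x \<otimes>\<^bsub>?C\<^esub> y) = h x \<otimes>\<^bsub>?M\<^esub> h y"
    proof (rule h_eqI)
      show "F.embed (x \<otimes>\<^bsub>?C\<^esub> y) = C.corner.embed (h x \<otimes>\<^bsub>?M\<^esub> h y)"
        unfolding ops C.corner.embed_mult(1)[OF hx(1) hy(1)] hx(2) hy(2) by (rule F.embed_mult(1)[OF xy[THEN sub]])
    qed (rule C.corner.embed_mult(2)[OF hx(1) hy(1)])
    show "h (x \<oplus>\<^bsub>?C\<^esub> y) = h x \<oplus>\<^bsub>?M\<^esub> h y"
    proof (rule h_eqI)
      show "F.embed (x \<oplus>\<^bsub>?C\<^esub> y) = C.corner.embed (h x \<oplus>\<^bsub>?M\<^esub> h y)"
        unfolding ops C.corner.embed_add(1)[OF hx(1) hy(1)] hx(2) hy(2) by (rule F.embed_add(1)[OF xy[THEN sub]])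
    qed (rule C.corner.embed_add(2)[OF hx(1) hy(1)])
  next
    have "\<one>\<^bsub>?M\<^esub> \<in> carrier ?M"
      by (rule C.corner.leavitt_one_closed)
    then show "h \<one>\<^bsub>?C\<^esub> = \<one>\<^bsub>?M\<^esub>"
      by (intro h_eqI) (simp_all add: corner_def C.corner.embed_one C.corner_one[simplified] flip: e_def)
  qed
  moreover have "bij_betw h (carrier ?C) (carrier ?M)"
  proof (rule bij_betw_imageI)
    show "inj_on h (carrier ?C)"
      by (rule inj_onI) (metis F.embed_inj h(2) inj_onD sub)
    show "h ` carrier ?C = carrier ?M"
    proof (intro equalityI subsetI)
      fix y assume y: "y \<in> carrier ?M"
      then have "C.corner.embed y \<in> F.embed ` carrier ?C" using emb_C C.corner.embed_image by blast
      then obtain x where "x \<in> carrier ?C" "C.corner.embed y = F.embed x" by blast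
      then show "y \<in> h ` carrier ?C" using h_eqI[of x y] y by (intro image_eqI[of _ _ x]) auto
    qed (use h in auto)
  qed
  moreover have "h (c \<odot>\<^bsub>?C\<^esub> x) = c \<odot>\<^bsub>?M\<^esub> h x" if "x \<in> carrier ?C" for c x
  proof (rule h_eqI)
    show "F.embed (c \<odot>\<^bsub>?C\<^esub> x) = C.corner.embed (c \<odot>\<^bsub>?M\<^esub> h x)"
      unfolding ops C.corner.embed_smult(1)[OF h(1)[OF that]] h(2)[OF that] by (rule F.embed_smult(1)[OF sub[OF that]])
  qed (rule C.corner.embed_smult(2)[OF h(1)[OF that]])
  ultimately have "h \<in> algebra_iso ?C ?M" by (simp add: algebra_iso_def ring_iso_def)
  moreover have "I \<noteq> {}" using \<open>e \<noteq> 0\<close> C.e_sum by auto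
  ultimately show ?thesis
    using C.fin_digraph_G by (intro exI[of _ C.G]) (auto simp: algebra_isomorphic_def)
qed

end
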